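(* Let $n\in\mathbb{N}$, let $\mu$ be the standard Gaussian measure on $\mathbb{R}^n$, let $\alpha\in\,]0,1]$ and let $\nu$ be a probability measure on $(\mathbb{R}^n,\mathcal{B}(\mathbb{R}^n))$ such that $$\int_{\mathbb{R}^n}\exp\Big\{\frac{|y|^2}{1+\alpha}\Big\}\,d\nu(y)<+\infty.$$ Let $\rho:=\mu\star\nu$ and let $\xi$ be the density of $\rho$ with respect to $\mu$. Then for every $f\in\mathbb{D}^{1,3+\alpha}$ one has $$\int_{\mathbb{R}^n}|f(w)|^2\,d\rho(w)-\int_{\mathbb{R}^n}(f\circ_{\alpha}f)(w)\,d\rho(w)\leq (1-\alpha)\int_{\mathbb{R}^n}\Vert Df(w)\Vert_H^2\,d\rho(w)$$ or equivalently, $$\int_{\mathbb{R}^n}|f(w)|^2\,d\rho(w)-\int_{\mathbb{R}^n}|(\Gamma(\sqrt{\alpha})f)(w)|^2\cdot(\Gamma(1/\sqrt{\alpha})\xi)(w)\,d\mu(w)\leq (1-\alpha)\int_{\mathbb{R}^n}\Vert Df(w)\Vert_H^2\,d\rho(w),$$ where $$(\Gamma(1/\sqrt{\alpha})\xi)(w):=\int_{\mathbb{R}^n}\exp\Big\{\Big\langle w,\frac{y}{\sqrt{\alpha}}\Big\rangle-\frac{|y|^2}{2\alpha}\Big\}\,d\nu(y),\quad w\in\mathbb{R}^n.$$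
   Context: Here the abstract Wiener space is $W=H=\mathbb{R}^n$ with Euclidean norm $|\cdot|=\Vert\cdot\Vert_H$ and inner product $\langle\cdot,\cdot\rangle$, and $\mu(A)=\int_A(2\pi)^{-n/2}e^{-|w|^2/2}dw$. Convolution: $(\mu\star\nu)(A)=\int\mu(A-w)\,d\nu(w)$. The measure $\rho=\mu\star\nu$ is always absolutely continuous with respect to $\mu$, with density $\xi(w)=\int_{\mathbb{R}^n}\exp\{\langle w,y\rangle-|y|^2/2\}\,d\nu(y)$. Functions are real-valued. Sobolev spaces: on functions $f(w)=\varphi(\langle w,h_1\rangle,\dots,\langle w,h_m\rangle)$ with $m\in\mathbb{N}$, $h_j\in \mathbb{R}^n$, $\varphi\in C_0^\infty(\mathbb{R}^m)$, $Df$ is the usual gradient $\sum_j\frac{\partial\varphi}{\partial x_j}(\langle w,h_1\rangle,\dots,\langle w,h_m\rangle)h_j$. $\mathbb{D}^{1,p}$ is the closure of these functions under $\Vert f\Vert_{1,p}=(\int|f|^pd\mu+\int\Vert Df\Vert_H^pd\mu)^{1/p}$, with $D$ extended by closure. Chaos expansion: each $f\in\mathcal{L}^2(\mathbb{R}^n,\mu)$ has a unique orthogonal expansion $f=\sum_{k\ge0}\delta^k(f_k)$ with $f_k$ a symmetric tensor in $(\mathbb{R}^n)^{\hat\otimes k}$ and $\delta^k$ the $k$-fold Wiener-Itô integral (the Hermite expansion), with $\Vert f\Vert_2^2=\sum_k k!\Vert f_k\Vert^2$. For $\lambda>0$, $\mathcal{G}_\lambda$ is the Hilbert space of (formal, if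 $\lambda<1$) series $\sum_k\delta^k(f_k)$ with $\sum_k k!\lambda^{2k}\Vert f_k\Vert^2<\infty$. For $a>0$, $\Gamma(a)\sum_k\delta^k(f_k):=\sum_k a^k\delta^k(f_k)$; for $a=e^{-\tau}\in\,]0,1]$ this is the Ornstein-Uhlenbeck operator $f\mapsto\int f(e^{-\tau}w+\sqrt{1-e^{-2\tau}}\,\tilde w)\,d\mu(\tilde w)$. $\alpha$-product: $f\circ_\alpha g:=\Gamma(1/\sqrt\alpha)\big(\Gamma(\sqrt\alpha)f\cdot\Gamma(\sqrt\alpha)g\big)$. For $f\in\mathcal{L}^{3+\alpha}(\mathbb{R}^n,\mu)$ it is known that $f\circ_\alpha f\in\mathcal{G}_{\sqrt{(1+\alpha)/2}}$. The integral $\int(f\circ_\alpha f)\,d\rho$ means $\int (f\circ_\alpha f)\,\xi\,d\mu$, understood as the duality pairing $\sum_k k!\langle u_k,\xi_k\rangle$ between $u=f\circ_\alpha f\in\mathcal{G}_{\sqrt{(1+\alpha)/2}}$ and $\xi\in\mathcal{G}_{\sqrt{2/(1+\alpha)}}$ (equal to the ordinary integral when $u\in\mathcal{L}^2(\mathbb{R}^n,\mu)$). *)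

theory Defs
  imports "HOL-Probability.Probability"
begin

definition gaussian :: "(real ^ 'n) measure" where
  "gaussian = density lborel
     (\<lambda>w. ennreal ((2 * pi) powr (- (real CARD('n) / 2)) * exp (- (norm w)\<^sup>2 / 2)))"


section \<open>Smooth cylindrical functions and the Sobolev spaces\<close>

text \<open>
  The number \<open>m\<close> of variables of \<open>\<phi>\<close> is existentially quantified in the definition of a
  cylindrical function, so it cannot be the dimension of a type. A function on the
  \<open>m\<close>-dimensional space is therefore encoded as a function on sequences \<open>nat \<Rightarrow> real\<close> that depends
  only on the coordinates below \<open>m\<close>; for such a function, continuity in the product topology is
  continuity in the first \<open>m\<close> variables.
\<close>

definition partial :: "nat \<Rightarrow> ((nat \<Rightarrow> real) \<Rightarrow> real) \<Rightarrow> (nat \<Rightarrow> real) \<Rightarrow> real" where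
  "partial i \<phi> x = deriv (\<lambda>t. \<phi> (x(i := t))) (x i)"

text \<open>Smoothness: all iterated partial derivatives \<open>foldr partial I \<phi>\<close> exist and are continuous.\<close>

definition smooth_compact_support :: "nat \<Rightarrow> ((nat \<Rightarrow> real) \<Rightarrow> real) \<Rightarrow> bool" where
  "smooth_compact_support m \<phi> \<longleftrightarrow>
     (\<forall>x y. (\<forall>i<m. x i = y i) \<longrightarrow> \<phi> x = \<phi> y) \<and>
     (\<forall>I. set I \<subseteq> {..<m} \<longrightarrow>
        continuous_on UNIV (foldr partial I \<phi>) \<and>
        (\<forall>i<m. \<forall>x. (\<lambda>t. foldr partial I \<phi> (x(i := t))) differentiable (at (x i)))) \<and>
     (\<exists>R. \<forall>x. \<phi> x \<noteq> 0 \<longrightarrow> (\<forall>i<m. \<bar>x i\<bar> \<le> R))"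

definition cyl_coords :: "nat \<Rightarrow> (nat \<Rightarrow> real ^ 'n) \<Rightarrow> real ^ 'n \<Rightarrow> nat \<Rightarrow> real" where
  "cyl_coords m h w = (\<lambda>j. if j < m then w \<bullet> h j else 0)"

definition has_cyl_gradient :: "(real ^ 'n \<Rightarrow> real) \<Rightarrow> (real ^ 'n \<Rightarrow> real ^ 'n) \<Rightarrow> bool" where
  "has_cyl_gradient f Df \<longleftrightarrow>
     (\<exists>m h \<phi>. 0 < m \<and> smooth_compact_support m \<phi> \<and>
        f = (\<lambda>w. \<phi> (cyl_coords m h w)) \<and>
        Df = (\<lambda>w. \<Sum>j<m. partial j \<phi> (cyl_coords m h w) *\<^sub>R h j))"

text \<open>
  \<open>has_sobolev_gradient p f Df\<close>: the pair \<open>(f, Df)\<close> lies in the closure, with respect to the norm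
  of order \<open>(1, p)\<close>, of the graph of the gradient on smooth cylindrical functions. Thus \<open>f\<close> belongs
  to the Sobolev space of order \<open>(1, p)\<close> iff such a \<open>Df\<close> exists; by closability \<open>Df\<close> is then
  determined up to a Gaussian null set.
\<close>

definition has_sobolev_gradient ::
  "real \<Rightarrow> (real ^ 'n \<Rightarrow> real) \<Rightarrow> (real ^ 'n \<Rightarrow> real ^ 'n) \<Rightarrow> bool" where
  "has_sobolev_gradient p f Df \<longleftrightarrow>
     f \<in> borel_measurable borel \<and> Df \<in> borel_measurable borel \<and>
     (\<exists>F DF. (\<forall>j::nat. has_cyl_gradient (F j) (DF j)) \<and>
        (\<lambda>j. (\<integral>\<^sup>+ w. ennreal (\<bar>F j w - f w\<bar> powr p) \<partial>gaussian)
            + (\<integral>\<^sup>+ w. ennreal (norm (DF j w - Df w) powr p) \<partial>gaussian)) \<longlonglongrightarrow> 0)"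


section \<open>Chaos expansions\<close>

text \<open>The probabilists' Hermite polynomials.\<close>

fun hermite :: "nat \<Rightarrow> real \<Rightarrow> real" where
  "hermite 0 x = 1"
| "hermite (Suc 0) x = x"
| "hermite (Suc (Suc k)) x = x * hermite (Suc k) x - real (Suc k) * hermite k x"

text \<open>
  A formal chaos series is a sequence of symmetric tensors, one of each order \<open>k\<close>. The components
  of a tensor of order \<open>k\<close> in the standard basis are indexed by the lists of length \<open>k\<close> over \<open>'n\<close>,
  so the whole sequence is a single real function on lists, whose restriction to the lists of
  length \<open>k\<close> is the tensor of order \<open>k\<close>.
\<close>

type_synonym 'n chaos = "'n list \<Rightarrow> real"

definition symmetric_tensors :: "'n chaos \<Rightarrow> bool" where
  "symmetric_tensors u \<longleftrightarrow> (\<forall>is js. mset is = mset js \<longrightarrow> u is = u js)"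

definition tensor_inner :: "nat \<Rightarrow> 'n::finite chaos \<Rightarrow> 'n chaos \<Rightarrow> real" where
  "tensor_inner k u v = (\<Sum>is | length is = k. u is * v is)"

text \<open>
  The \<open>k\<close>-fold Wiener-Ito integral of the tensor of order \<open>k\<close> of \<open>u\<close>. On the elementary tensor
  with factors \<open>axis i 1\<close>, \<open>i\<close> ranging over the list \<open>is\<close>, it is the product over all coordinates
  \<open>i\<close> of the Hermite polynomial in \<open>w $ i\<close> whose degree is the number of occurrences of \<open>i\<close> in \<open>is\<close>.
\<close>

definition wiener_ito :: "nat \<Rightarrow> 'n::finite chaos \<Rightarrow> real ^ 'n \<Rightarrow> real" where
  "wiener_ito k u w =
     (\<Sum>is | length is = k. u is * (\<Prod>i\<in>UNIV. hermite (count_list is i) (w $ i)))"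

definition has_chaos_expansion :: "(real ^ 'n \<Rightarrow> real) \<Rightarrow> 'n chaos \<Rightarrow> bool" where
  "has_chaos_expansion f u \<longleftrightarrow>
     f \<in> borel_measurable borel \<and> symmetric_tensors u \<and>
     (\<lambda>N. \<integral>\<^sup>+ w. ennreal ((f w - (\<Sum>k<N. wiener_ito k u w))\<^sup>2) \<partial>gaussian) \<longlonglongrightarrow> 0"

text \<open>Meaningful for square integrable functions, which have exactly one chaos expansion.\<close>

definition chaos_of :: "(real ^ 'n \<Rightarrow> real) \<Rightarrow> 'n chaos" where
  "chaos_of f = (THE u. has_chaos_expansion f u)"

definition Gamma_chaos :: "real \<Rightarrow> 'n chaos \<Rightarrow> 'n chaos" where
  "Gamma_chaos a u = (\<lambda>is. a ^ length is * u is)"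

text \<open>
  For \<open>0 < a \<le> 1\<close>, the operator \<open>Gamma_chaos a\<close> acts on functions as the Ornstein-Uhlenbeck
  operator at time \<open>- ln a\<close>.
\<close>

definition Gamma_fun :: "real \<Rightarrow> (real ^ 'n \<Rightarrow> real) \<Rightarrow> real ^ 'n \<Rightarrow> real" where
  "Gamma_fun a f w = (\<integral>z. f (a *\<^sub>R w + sqrt (1 - a\<^sup>2) *\<^sub>R z) \<partial>gaussian)"

text \<open>
  The product need not be a function (the outer factor \<open>1 / sqrt \<alpha>\<close> is at least 1), so its value is
  a formal chaos series.
\<close>

definition alpha_product ::
  "real \<Rightarrow> (real ^ 'n \<Rightarrow> real) \<Rightarrow> (real ^ 'n \<Rightarrow> real) \<Rightarrow> 'n chaos" where
  "alpha_product \<alpha> f g =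
     Gamma_chaos (1 / sqrt \<alpha>) (chaos_of (\<lambda>w. Gamma_fun (sqrt \<alpha>) f w * Gamma_fun (sqrt \<alpha>) g w))"

definition chaos_pairing :: "'n::finite chaos \<Rightarrow> 'n chaos \<Rightarrow> real" where
  "chaos_pairing u v = (\<Sum>k. fact k * tensor_inner k u v)"

end

theory Submission
  imports Defs "HOL-Combinatorics.Multiset_Permutations"
begin

text \<open>
  Write \<open>\<mu>\<close> for the Gaussian measure. Since \<open>\<rho>\<close> is the mixture over \<open>\<nu>\<close> of the translates of \<open>\<mu>\<close> by
  \<open>y\<close>, everything reduces to the functions \<open>g = f(\<cdot> + y)\<close>, for which
  \<open>\<integral> g\<^sup>2 d\<mu> - \<integral> (\<Gamma>(\<surd>\<alpha>) g)\<^sup>2 d\<mu> \<le> (1 - \<alpha>) \<integral> |Dg|\<^sup>2 d\<mu>\<close> is the termwise inequality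
  \<open>1 - \<alpha>\<^sup>k \<le> k (1 - \<alpha>)\<close> between the chaos expansions; the gradient enters only through the
  integration by parts \<open>\<integral> \<partial>\<^sub>i g H d\<mu> = \<integral> g \<delta>\<^sub>i H d\<mu>\<close> against Hermite polynomials, which passes to the
  Sobolev closure. Completeness of the Hermite polynomials comes from Stone-Weierstrass in the
  variables \<open>sin (w\<^sub>i / L)\<close>.

  To evaluate the duality pairing put \<open>\<beta> = (1 + \<alpha>) / 2\<close> and
  \<open>v(z) = \<integral> f(\<surd>\<beta> z + \<surd>(1 - \<beta>) w) f(\<surd>\<beta> z - \<surd>(1 - \<beta>) w) d\<mu>(w)\<close>. A rotation gives
  \<open>(\<Gamma>(\<surd>\<alpha>) f)\<^sup>2 = \<Gamma>(\<surd>(\<alpha>/\<beta>)) v\<close>, that is, \<open>v = \<Gamma>(\<surd>\<beta>) (f \<circ>\<^sub>\<alpha> f)\<close>, while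
  \<open>\<xi> = \<Gamma>(\<surd>\<beta>) \<eta>\<close> with \<open>\<eta> = \<Gamma>(1/\<surd>\<beta>) \<xi>\<close> given by an explicit integral. Both \<open>v\<close> and \<open>\<eta>\<close> are
  square integrable, so by Parseval the pairing is the ordinary integral of \<open>v \<eta>\<close>, which equals
  the integral over \<open>y\<close> of \<open>\<integral> (\<Gamma>(\<surd>\<alpha>) g)\<^sup>2 d\<mu>\<close>.
\<close>

section \<open>The Gaussian measure\<close>

text \<open>The exponent of the Sobolev space, the moment condition on \<open>\<nu>\<close> and the
  number \<open>\<beta>\<close> belong together. Translation by \<open>y\<close> does not preserve
  the integrability of order \<open>3 + \<alpha>\<close>: it costs a factor
  \<open>shift_density y\<close>, and the exponents \<open>(3 + \<alpha>) / 2\<close> and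
  \<open>(3 + \<alpha>) / (1 + \<alpha>)\<close> bound the second moment of a translate by a
  multiple of \<open>exp (|y|^2 / (1 + \<alpha>))\<close>, precisely what is
  \<open>\<nu>\<close>-integrable. Square integrability is all that the chaos expansion of a
  translate requires.

  The obstacle is the pairing, whose first argument is only a formal series, so a smoothing factor
  has to be taken from \<open>\<xi>\<close> and given to the product. The value of
  \<open>\<beta>\<close> comes from correlations: \<open>(\<Gamma>(\<surd>\<alpha>) f)^2\<close> at
  \<open>x\<close> is the conditional expectation of \<open>f(X) f(Y)\<close> given
  \<open>x\<close>, for standard Gaussian vectors \<open>X\<close> and \<open>Y\<close> with
  correlation \<open>\<alpha>\<close>. Then \<open>X + Y\<close> has variance
  \<open>2 (1 + \<alpha>) = 4 \<beta>\<close> in each coordinate. Conditioning on the normalised sum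
  \<open>z = (X + Y) / (2 \<surd>\<beta>)\<close> gives \<open>v(z)\<close>, and \<open>x\<close> is
  a noisier copy of \<open>z\<close>, with correlation
  \<open>\<surd>(\<alpha>/\<beta>)\<close>.\<close>

definition gauss_density :: "real ^ 'n \<Rightarrow> real" where
  "gauss_density w = (2 * pi) powr (- (real CARD('n) / 2)) * exp (- (norm w)\<^sup>2 / 2)"

text \<open>The Cameron-Martin density of a translated Gaussian measure, equally the stochastic
  exponential of the linear functional given by \<open>y\<close>.\<close>

definition shift_density :: "real ^ 'n \<Rightarrow> real ^ 'n \<Rightarrow> real" where
  "shift_density y w = exp (w \<bullet> y - (norm y)\<^sup>2 / 2)"

lemma gaussian_eq_density: "gaussian = density lborel (\<lambda>w. ennreal (gauss_density w))"
  by (simp add: gaussian_def gauss_density_def)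

lemma borel_measurable_gauss_density [measurable]: "gauss_density \<in> borel_measurable borel"
  unfolding gauss_density_def by measurable

lemma borel_measurable_shift_density [measurable (raw)]:
  assumes [measurable]: "f \<in> M \<rightarrow>\<^sub>M borel" "g \<in> M \<rightarrow>\<^sub>M borel"
  shows "(\<lambda>x. shift_density (f x) (g x)) \<in> borel_measurable M"
  unfolding shift_density_def by measurable

lemma gauss_density_nonneg [simp]: "0 \<le> gauss_density w"
  by (simp add: gauss_density_def)

lemma shift_density_nonneg [simp]: "0 \<le> shift_density y w"
  by (simp add: shift_density_def)

lemma sets_gaussian [simp, measurable_cong]: "sets gaussian = sets borel"
  by (simp add: gaussian_def)

lemma space_gaussian [simp]: "space gaussian = UNIV"
  by (simp add: gaussian_def)

lemma nn_integral_gaussian: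
  assumes [measurable]: "f \<in> borel_measurable borel"
  shows "(\<integral>\<^sup>+w. f w \<partial>gaussian) = (\<integral>\<^sup>+w. ennreal (gauss_density w) * f w \<partial>lborel)"
  unfolding gaussian_eq_density by (simp add: nn_integral_density)

lemma gauss_density_eq_prod:
  fixes w :: "real ^ 'n"
  shows "gauss_density w = (\<Prod>b\<in>Basis. std_normal_density (w \<bullet> b))"
proof -
  have "(\<Sum>b\<in>Basis. - (w \<bullet> b)\<^sup>2 / 2) = - (norm w)\<^sup>2 / 2"
    unfolding power2_norm_eq_inner euclidean_inner[of w w] by (simp add: power2_eq_square sum_negf sum_divide_distrib)
  moreover have "(1 / sqrt (2 * pi)) ^ CARD('n) = (2 * pi) powr (- (real CARD('n) / 2))"
  proof -
    have "1 / sqrt (2 * pi) = (2 * pi) powr (- 1 / 2)"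
      by (simp add: powr_minus_divide powr_half_sqrt)
    then have "(1 / sqrt (2 * pi)) ^ CARD('n) = ((2 * pi) powr (- 1 / 2)) powr real CARD('n)"
      by (simp add: powr_realpow)
    then show ?thesis by (simp add: powr_powr)
  qed
  ultimately show ?thesis
    by (simp add: gauss_density_def std_normal_density_def exp_sum[symmetric] prod_dividef power_one_over
          power_divide)
       (metis mult.commute mult_1 times_divide_eq_left)
qed

lemma prob_space_gaussian: "prob_space (gaussian :: (real ^ 'n) measure)"
proof
  interpret N: prob_space "density lborel (\<lambda>x. ennreal (std_normal_density x))"
    by (rule prob_space_normal_density) simp
  have 1: "(\<integral>\<^sup>+x. ennreal (std_normal_density x) \<partial>lborel) = 1"
    using N.emeasure_space_1 by (simp add: emeasure_density)
  have "emeasure gaussian (space (gaussian :: (real ^ 'n) measure))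
      = (\<integral>\<^sup>+w. ennreal (gauss_density (w :: real ^ 'n)) \<partial>lborel)"
    unfolding gaussian_eq_density by (simp add: emeasure_density)
  also have "\<dots> = (\<integral>\<^sup>+w. (\<Prod>b\<in>Basis. ennreal (std_normal_density ((w :: real ^ 'n) \<bullet> b))) \<partial>lborel)"
    by (simp add: gauss_density_eq_prod prod_ennreal)
  also have "\<dots> = 1"
    by (subst nn_integral_lborel_prod) (simp_all add: 1)
  finally show "emeasure gaussian (space (gaussian :: (real ^ 'n) measure)) = 1" .
qed

interpretation gaussian: prob_space "gaussian :: (real ^ 'n) measure"
  by (rule prob_space_gaussian)

abbreviation (input) gaussian_mean (binder "\<E>" 10) where
  "gaussian_mean f \<equiv> integral\<^sup>L gaussian f"

abbreviation (input) gaussian_nn_mean (binder "\<E>\<^sup>+" 10) where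
  "gaussian_nn_mean f \<equiv> integral\<^sup>N gaussian f"

interpretation gaussian_pair: pair_prob_space "gaussian :: (real ^ 'n) measure" "gaussian :: (real ^ 'n) measure"
  by unfold_locales

lemma gaussian_UNIV [simp]: "emeasure (gaussian :: (real ^ 'n) measure) UNIV = 1"
  using gaussian.emeasure_space_1 by simp

section \<open>Linear substitutions, reflections and translations\<close>

lemma nn_integral_lborel_affine:
  fixes t :: "'a::euclidean_space"
  assumes "c \<noteq> 0" and [measurable]: "f \<in> borel_measurable borel"
  shows "(\<integral>\<^sup>+x. f x \<partial>lborel) = ennreal (\<bar>c\<bar> ^ DIM('a)) * (\<integral>\<^sup>+x. f (t + c *\<^sub>R x) \<partial>lborel)"
  by (subst lborel_affine[OF assms(1), of t])
     (simp add: nn_integral_density nn_integral_distr nn_integral_cmult)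

text \<open>The matrix with scalar blocks \<open>a\<close>, \<open>b\<close>, \<open>c\<close>,
  \<open>d\<close> is factored into two triangular maps, so that each substitution is affine in one
  variable while the other is held fixed: first in \<open>y\<close> with ratio
  \<open>?D / a\<close>, then, after exchanging the integrals, in \<open>x\<close> with ratio
  \<open>a\<close>. The Jacobian is the product of the two contributions.\<close>

lemma nn_integral_lborel_linear2:
  fixes G :: "'a::euclidean_space \<times> 'a \<Rightarrow> ennreal"
  assumes a: "a \<noteq> 0" and D: "a * d - b * c \<noteq> 0"
    and [measurable]: "G \<in> borel_measurable (borel \<Otimes>\<^sub>M borel)"
  shows "(\<integral>\<^sup>+x. \<integral>\<^sup>+y. G (x, y) \<partial>lborel \<partial>lborel) =
    ennreal (\<bar>a * d - b * c\<bar> ^ DIM('a)) *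
      (\<integral>\<^sup>+x. \<integral>\<^sup>+y. G (a *\<^sub>R x + b *\<^sub>R y, c *\<^sub>R x + d *\<^sub>R y) \<partial>lborel \<partial>lborel)"
proof -
  let ?D = "a * d - b * c" and ?n = "DIM('a)"
  let ?H = "\<lambda>u y. G (u, (c / a) *\<^sub>R u + (?D / a) *\<^sub>R y)"
  have 1: "(\<integral>\<^sup>+y. G (x, y) \<partial>lborel) = ennreal (\<bar>?D / a\<bar> ^ ?n) * (\<integral>\<^sup>+y. ?H x y \<partial>lborel)" for x
    using a D by (intro nn_integral_lborel_affine) auto
  have 2: "(\<integral>\<^sup>+u. ?H u y \<partial>lborel) = ennreal (\<bar>a\<bar> ^ ?n) *
      (\<integral>\<^sup>+x. G (a *\<^sub>R x + b *\<^sub>R y, c *\<^sub>R x + d *\<^sub>R y) \<partial>lborel)" for y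
  proof -
    have "?H (b *\<^sub>R y + a *\<^sub>R x) y = G (a *\<^sub>R x + b *\<^sub>R y, c *\<^sub>R x + d *\<^sub>R y)" for x
    proof -
      have "(c / a) *\<^sub>R (b *\<^sub>R y + a *\<^sub>R x) + (?D / a) *\<^sub>R y = c *\<^sub>R x + (c * b / a + ?D / a) *\<^sub>R y"
        using a by (simp add: algebra_simps)
      also have "c * b / a + ?D / a = d" using a by (simp add: field_simps)
      finally show ?thesis by (simp add: add.commute)
    qed
    then show ?thesis
      using nn_integral_lborel_affine[OF a, of "\<lambda>u. ?H u y" "b *\<^sub>R y"] by simp
  qed
  have "(\<integral>\<^sup>+x. \<integral>\<^sup>+y. G (x, y) \<partial>lborel \<partial>lborel)
      = ennreal (\<bar>?D / a\<bar> ^ ?n) * (\<integral>\<^sup>+x. \<integral>\<^sup>+y. ?H x y \<partial>lborel \<partial>lborel)"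
    by (simp add: 1 nn_integral_cmult)
  also have "(\<integral>\<^sup>+x. \<integral>\<^sup>+y. ?H x y \<partial>lborel \<partial>lborel) = (\<integral>\<^sup>+y. \<integral>\<^sup>+x. ?H x y \<partial>lborel \<partial>lborel)"
    by (rule lborel_pair.Fubini') measurable
  also have "\<dots> = ennreal (\<bar>a\<bar> ^ ?n) *
      (\<integral>\<^sup>+y. \<integral>\<^sup>+x. G (a *\<^sub>R x + b *\<^sub>R y, c *\<^sub>R x + d *\<^sub>R y) \<partial>lborel \<partial>lborel)"
    by (simp add: 2 nn_integral_cmult)
  also have "(\<integral>\<^sup>+y. \<integral>\<^sup>+x. G (a *\<^sub>R x + b *\<^sub>R y, c *\<^sub>R x + d *\<^sub>R y) \<partial>lborel \<partial>lborel) =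
      (\<integral>\<^sup>+x. \<integral>\<^sup>+y. G (a *\<^sub>R x + b *\<^sub>R y, c *\<^sub>R x + d *\<^sub>R y) \<partial>lborel \<partial>lborel)"
    by (rule lborel_pair.Fubini') measurable
  finally show ?thesis
    using a by (simp add: mult.assoc[symmetric] ennreal_mult'[symmetric] power_mult_distrib[symmetric] abs_divide)
qed

lemma norm_reflect:
  fixes x y :: "'a::real_inner"
  assumes "c\<^sup>2 + s\<^sup>2 = (1::real)"
  shows "(norm (c *\<^sub>R x + s *\<^sub>R y))\<^sup>2 + (norm (s *\<^sub>R x - c *\<^sub>R y))\<^sup>2 = (norm x)\<^sup>2 + (norm y)\<^sup>2"
proof -
  have "(norm (c *\<^sub>R x + s *\<^sub>R y))\<^sup>2 + (norm (s *\<^sub>R x - c *\<^sub>R y))\<^sup>2 = (c\<^sup>2 + s\<^sup>2) * ((norm x)\<^sup>2 + (norm y)\<^sup>2)"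
    unfolding power2_norm_eq_inner
    by (simp add: inner_add_left inner_add_right inner_diff_left inner_diff_right
          inner_commute power2_eq_square ring_distribs)
  with assms show ?thesis by simp
qed

lemma nn_integral_gaussian_pair:
  fixes G :: "(real ^ 'n) \<times> (real ^ 'n) \<Rightarrow> ennreal"
  assumes [measurable]: "G \<in> borel_measurable (borel \<Otimes>\<^sub>M borel)"
  shows "(\<integral>\<^sup>+z. G z \<partial>(gaussian \<Otimes>\<^sub>M gaussian)) =
    (\<integral>\<^sup>+x. \<integral>\<^sup>+y. ennreal (gauss_density x * gauss_density y) * G (x, y) \<partial>lborel \<partial>lborel)"
proof -
  have "G \<in> borel_measurable (gaussian \<Otimes>\<^sub>M gaussian)"
    using assms by (simp cong: measurable_cong_sets sets_pair_measure_cong)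
  from gaussian.nn_integral_fst[OF this] show ?thesis
    by (simp add: nn_integral_gaussian nn_integral_cmult[symmetric] ennreal_mult mult.assoc cong: nn_integral_cong)
qed

text \<open>The product density depends only on \<open>|x|^2 + |y|^2\<close>, which the orthogonal
  map preserves, and the Jacobian is 1. A reflection is chosen because it is its own inverse, which
  later yields the symmetry of the Ornstein-Uhlenbeck operator.\<close>

lemma distr_gaussian_reflect:
  fixes c s :: real
  assumes cs: "c\<^sup>2 + s\<^sup>2 = 1" and c: "c \<noteq> 0"
  shows "distr (gaussian \<Otimes>\<^sub>M gaussian) (borel \<Otimes>\<^sub>M borel) (\<lambda>(x :: real ^ 'n, y). (c *\<^sub>R x + s *\<^sub>R y, s *\<^sub>R x - c *\<^sub>R y))
    = gaussian \<Otimes>\<^sub>M gaussian" (is "distr ?P ?B ?T = _")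
proof (rule measure_eqI)
  show "sets (distr ?P ?B ?T) = sets ?P" by (simp cong: sets_pair_measure_cong)
next
  fix A assume "A \<in> sets (distr ?P ?B ?T)"
  then have A [measurable]: "A \<in> sets ?B" by simp
  have T [measurable]: "?T \<in> ?B \<rightarrow>\<^sub>M ?B" by measurable
  have D: "c * (-c) - s * s = -1" using cs by (simp add: power2_eq_square)
  have *: "gauss_density (c *\<^sub>R x + s *\<^sub>R y) * gauss_density (s *\<^sub>R x - c *\<^sub>R y) = gauss_density x * gauss_density y"
    for x y :: "real ^ 'n"
    using norm_reflect[OF cs, of x y]
    by (simp add: gauss_density_def exp_add[symmetric] mult.assoc mult.left_commute[of "exp _"] add_divide_distrib[symmetric])
  have "emeasure (distr ?P ?B ?T) A = (\<integral>\<^sup>+z. indicator A (?T z) \<partial>?P)"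
    by (subst nn_integral_indicator[symmetric], simp, subst nn_integral_distr, auto cong: measurable_cong_sets)
  also have "\<dots> = (\<integral>\<^sup>+x. \<integral>\<^sup>+y. ennreal (gauss_density x * gauss_density y) * indicator A (?T (x, y)) \<partial>lborel \<partial>lborel)"
    by (subst nn_integral_gaussian_pair) simp_all
  also have "\<dots> = (\<integral>\<^sup>+x. \<integral>\<^sup>+y. ennreal (gauss_density x * gauss_density y) * indicator A (x, y) \<partial>lborel \<partial>lborel)"
    using nn_integral_lborel_linear2[of c "-c" s s "\<lambda>z. ennreal (gauss_density (fst z) * gauss_density (snd z)) * indicator A z"] c
    unfolding D by (simp add: *)
  also have "\<dots> = (\<integral>\<^sup>+z. indicator A z \<partial>?P)"
    by (subst nn_integral_gaussian_pair) simp_all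
  also have "\<dots> = emeasure ?P A"
    using A by (subst nn_integral_indicator) (auto cong: sets_pair_measure_cong)
  finally show "emeasure (distr ?P ?B ?T) A = emeasure ?P A" .
qed

lemma distr_gaussian_mix:
  fixes c s :: real
  assumes "c\<^sup>2 + s\<^sup>2 = 1" and "c \<noteq> 0"
  shows "distr (gaussian \<Otimes>\<^sub>M gaussian) borel (\<lambda>(x :: real ^ 'n, y). c *\<^sub>R x + s *\<^sub>R y) = gaussian"
proof -
  have "distr (gaussian \<Otimes>\<^sub>M gaussian) borel (\<lambda>(x :: real ^ 'n, y). c *\<^sub>R x + s *\<^sub>R y)
    = distr (distr (gaussian \<Otimes>\<^sub>M gaussian) (borel \<Otimes>\<^sub>M borel) (\<lambda>(x :: real ^ 'n, y). (c *\<^sub>R x + s *\<^sub>R y, s *\<^sub>R x - c *\<^sub>R y))) borel fst"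
    by (subst distr_distr) (auto simp: comp_def case_prod_beta' cong: measurable_cong_sets)
  also have "\<dots> = distr (gaussian \<Otimes>\<^sub>M gaussian) borel (fst :: (real ^ 'n) \<times> (real ^ 'n) \<Rightarrow> _)"
    by (simp add: distr_gaussian_reflect[OF assms])
  also have "\<dots> = distr (gaussian \<Otimes>\<^sub>M gaussian) gaussian (fst :: (real ^ 'n) \<times> (real ^ 'n) \<Rightarrow> _)"
    by (rule distr_cong) auto
  also have "\<dots> = gaussian"
    by (rule gaussian.distr_pair_fst)
  finally show ?thesis .
qed

text \<open>The Cameron-Martin formula: translation invariance of Lebesgue measure after completing
  the square.\<close>

lemma distr_gaussian_shift:
  fixes y :: "real ^ 'n"
  shows "distr gaussian borel (\<lambda>w. w + y) = density gaussian (\<lambda>w. ennreal (shift_density y w))" (is "?L = ?R")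
proof (rule measure_eqI)
  fix A assume "A \<in> sets ?L"
  then have A [measurable]: "A \<in> sets borel" by simp
  have *: "gauss_density (y + w) * shift_density y (y + w) = gauss_density w" for w
    by (simp add: gauss_density_def shift_density_def mult.assoc exp_add[symmetric] power2_norm_eq_inner
          inner_add_left inner_add_right inner_commute field_simps)
  have "emeasure ?L A = (\<E>\<^sup>+ w. indicator A (w + y))"
    by (subst nn_integral_indicator[symmetric], simp, subst nn_integral_distr, auto)
  also have "\<dots> = (\<integral>\<^sup>+w. ennreal (gauss_density w) * indicator A (w + y) \<partial>lborel)"
    by (subst nn_integral_gaussian) simp_all
  also have "\<dots> = (\<integral>\<^sup>+w. ennreal (gauss_density w) * (ennreal (shift_density y w) * indicator A w) \<partial>lborel)"
    by (subst (2) nn_integral_lborel_affine[of 1 _ y])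
       (simp_all add: mult.assoc[symmetric] ennreal_mult'[symmetric] *, simp add: add.commute)
  also have "\<dots> = emeasure ?R A"
    by (simp add: emeasure_density nn_integral_gaussian)
  finally show "emeasure ?L A = emeasure ?R A" .
qed simp

lemma nn_integral_gaussian_shift:
  fixes y :: "real ^ 'n"
  assumes [measurable]: "f \<in> borel_measurable borel"
  shows "(\<E>\<^sup>+ w. f (w + y)) = (\<E>\<^sup>+ w. ennreal (shift_density y w) * f w)"
proof -
  have "(\<E>\<^sup>+ w. f (w + y)) = (\<integral>\<^sup>+w. f w \<partial>distr gaussian borel (\<lambda>w. w + y))"
    by (subst nn_integral_distr) auto
  then show ?thesis
    unfolding distr_gaussian_shift by (simp add: nn_integral_density)
qed

lemma integral_gaussian_shift:
  fixes y :: "real ^ 'n" and f :: "real ^ 'n \<Rightarrow> real"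
  assumes [measurable]: "f \<in> borel_measurable borel"
  shows "(\<E> w. f (w + y)) = (\<E> w. shift_density y w * f w)"
proof -
  have "(\<E> w. f (w + y)) = (\<integral>w. f w \<partial>distr gaussian borel (\<lambda>w. w + y))"
    by (subst integral_distr) auto
  then show ?thesis
    unfolding distr_gaussian_shift by (simp add: integral_density)
qed

lemma integrable_gaussian_shift:
  fixes y :: "real ^ 'n" and f :: "real ^ 'n \<Rightarrow> real"
  assumes [measurable]: "f \<in> borel_measurable borel"
  shows "integrable gaussian (\<lambda>w. f (w + y)) \<longleftrightarrow> integrable gaussian (\<lambda>w. shift_density y w * f w)"
proof -
  have "integrable gaussian (\<lambda>w. f (w + y)) \<longleftrightarrow> integrable (distr gaussian borel (\<lambda>w. w + y)) f"
    by (subst integrable_distr_eq) auto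
  then show ?thesis
    unfolding distr_gaussian_shift by (simp add: integrable_density)
qed

text \<open>The integrand times the Gaussian density is the same density evaluated at
  \<open>sqrt (1 - k) *\<^sub>R w\<close>, and rescaling Lebesgue measure leaves a finite multiple
  of the total mass.\<close>

lemma nn_integral_gaussian_exp_norm2:
  assumes "k < 1"
  shows "(\<integral>\<^sup>+w. ennreal (exp (k * (norm w)\<^sup>2 / 2)) \<partial>(gaussian :: (real ^ 'n) measure)) < \<infinity>"
proof -
  define c where "c = sqrt (1 - k)"
  have c: "c > 0" "c\<^sup>2 = 1 - k" using assms by (auto simp: c_def)
  have "1 = (\<integral>\<^sup>+w. ennreal (gauss_density (w :: real ^ 'n)) \<partial>lborel)"
    using gaussian_UNIV[where 'n='n] by (simp add: gaussian_eq_density emeasure_density)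
  also have "\<dots> = ennreal (\<bar>c\<bar> ^ DIM(real ^ 'n)) * (\<integral>\<^sup>+w. ennreal (gauss_density (0 + c *\<^sub>R w :: real ^ 'n)) \<partial>lborel)"
    using c by (intro nn_integral_lborel_affine) auto
  finally have "(\<integral>\<^sup>+w. ennreal (gauss_density (c *\<^sub>R w :: real ^ 'n)) \<partial>lborel) \<noteq> \<infinity>"
    using c by (auto simp: ennreal_mult_top)
  moreover have "(\<integral>\<^sup>+w. ennreal (exp (k * (norm w)\<^sup>2 / 2)) \<partial>(gaussian :: (real ^ 'n) measure))
      = (\<integral>\<^sup>+w. ennreal (gauss_density (c *\<^sub>R w :: real ^ 'n)) \<partial>lborel)"
    using c by (subst nn_integral_gaussian)
      (auto intro!: nn_integral_cong simp: gauss_density_def ennreal_mult'[symmetric] exp_add[symmetric]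
         power_mult_distrib left_diff_distrib diff_divide_distrib)
  ultimately show ?thesis by (simp add: less_top)
qed

lemma shift_density_integrable: "integrable gaussian (shift_density y)"
  using integrable_gaussian_shift[of "\<lambda>_. 1" y] by simp

lemma shift_density_integral: "(\<E> w. shift_density (y :: real ^ 'n) w) = 1"
  using integral_gaussian_shift[of "\<lambda>_. 1" y] gaussian.prob_space[where 'n='n] by simp

section \<open>Integration by parts and Hermite tensors\<close>

text \<open>A growth class that contains bounded functions and polynomials, is closed under sums,
  products and affine substitutions, and consists of Gaussian integrable functions once they are
  measurable; integrability conditions below thus become closure checks.\<close>

definition exp_bounded :: "('a::real_normed_vector \<Rightarrow> real) \<Rightarrow> bool" where
  "exp_bounded F \<longleftrightarrow> (\<exists>C c. \<forall>x. \<bar>F x\<bar> \<le> C * exp (c * norm x))"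

definition square_integrable :: "(real ^ 'n \<Rightarrow> real) \<Rightarrow> bool" where
  "square_integrable f \<longleftrightarrow> f \<in> borel_measurable borel \<and> integrable gaussian (\<lambda>w. (f w)\<^sup>2)"

definition hermite_tensor :: "'n::finite list \<Rightarrow> real ^ 'n \<Rightarrow> real" where
  "hermite_tensor is w = (\<Prod>i\<in>UNIV. hermite (count_list is i) (w $ i))"

lemma exp_boundedE:
  fixes F :: "'a::real_normed_vector \<Rightarrow> real"
  assumes "exp_bounded F"
  obtains C c where "0 \<le> C" "0 \<le> c" "\<And>x. \<bar>F x\<bar> \<le> C * exp (c * norm x)"
proof -
  obtain C c where F: "\<bar>F x\<bar> \<le> C * exp (c * norm x)" for x
    using assms by (auto simp: exp_bounded_def)
  have C: "0 \<le> C" using F[of 0] by simp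
  show thesis
  proof
    fix x :: 'a
    have "c * norm x \<le> max c 0 * norm x" by (intro mult_right_mono) auto
    then have "C * exp (c * norm x) \<le> C * exp (max c 0 * norm x)"
      using C by (intro mult_left_mono) auto
    with F[of x] show "\<bar>F x\<bar> \<le> C * exp (max c 0 * norm x)" by linarith
  qed (use C in auto)
qed

lemma exp_boundedI: "(\<And>x. \<bar>F x\<bar> \<le> C * exp (c * norm x)) \<Longrightarrow> exp_bounded F"
  unfolding exp_bounded_def by blast

lemma exp_bounded_const [intro, simp]: "exp_bounded (\<lambda>_. k)"
  by (rule exp_boundedI[of _ "\<bar>k\<bar>" 0]) simp

lemma exp_bounded_add [intro]:
  assumes "exp_bounded F" "exp_bounded G" shows "exp_bounded (\<lambda>x. F x + G x)"
proof -
  obtain C c where F: "0 \<le> C" "0 \<le> c" "\<And>x. \<bar>F x\<bar> \<le> C * exp (c * norm x)"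
    using assms(1) by (rule exp_boundedE) blast
  obtain D d where G: "0 \<le> D" "0 \<le> d" "\<And>x. \<bar>G x\<bar> \<le> D * exp (d * norm x)"
    using assms(2) by (rule exp_boundedE) blast
  have "\<bar>F x + G x\<bar> \<le> (C + D) * exp (max c d * norm x)" for x
  proof -
    have "C * exp (c * norm x) \<le> C * exp (max c d * norm x)"
      using F by (intro mult_left_mono) (auto intro!: mult_right_mono)
    moreover have "D * exp (d * norm x) \<le> D * exp (max c d * norm x)"
      using G by (intro mult_left_mono) (auto intro!: mult_right_mono)
    ultimately show ?thesis
      using F(3)[of x] G(3)[of x] by (simp add: distrib_right)
  qed
  then show ?thesis by (rule exp_boundedI)
qed

lemma exp_bounded_mult [intro]:
  assumes "exp_bounded F" "exp_bounded G" shows "exp_bounded (\<lambda>x. F x * G x)"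
proof -
  obtain C c where F: "0 \<le> C" "0 \<le> c" "\<And>x. \<bar>F x\<bar> \<le> C * exp (c * norm x)"
    using assms(1) by (rule exp_boundedE) blast
  obtain D d where G: "0 \<le> D" "0 \<le> d" "\<And>x. \<bar>G x\<bar> \<le> D * exp (d * norm x)"
    using assms(2) by (rule exp_boundedE) blast
  have "\<bar>F x * G x\<bar> \<le> (C * D) * exp ((c + d) * norm x)" for x
  proof -
    have "\<bar>F x\<bar> * \<bar>G x\<bar> \<le> (C * exp (c * norm x)) * (D * exp (d * norm x))"
      using F(1) by (intro mult_mono F G) auto
    also have "\<dots> = (C * D) * exp ((c + d) * norm x)"
      unfolding distrib_right exp_add by (simp only: mult_ac)
    finally show ?thesis by (simp add: abs_mult)
  qed
  then show ?thesis by (rule exp_boundedI)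
qed

lemma exp_bounded_diff [intro]:
  assumes "exp_bounded F" "exp_bounded G" shows "exp_bounded (\<lambda>x. F x - G x)"
proof -
  have "exp_bounded (\<lambda>x. F x + (-1) * G x)"
    using assms by (intro exp_bounded_add exp_bounded_mult exp_bounded_const)
  then show ?thesis by simp
qed

lemma exp_bounded_prod [intro]: "(\<And>i. i \<in> I \<Longrightarrow> exp_bounded (F i)) \<Longrightarrow> exp_bounded (\<lambda>x. \<Prod>i\<in>I. F i x)"
  by (induction I rule: infinite_finite_induct) auto

lemma exp_bounded_linear [intro]:
  assumes "bounded_linear F" shows "exp_bounded F"
proof -
  obtain K where K: "0 < K" "\<And>x. norm (F x) \<le> norm x * K"
    using bounded_linear.pos_bounded[OF assms] by auto
  have "\<bar>F x\<bar> \<le> K * exp (1 * norm x)" for x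
  proof -
    have "norm x \<le> exp (norm x)" using exp_ge_add_one_self[of "norm x"] by linarith
    then have "norm x * K \<le> exp (norm x) * K" using K(1) by (intro mult_right_mono) auto
    then show ?thesis using K(2)[of x] by (simp add: mult.commute)
  qed
  then show ?thesis by (rule exp_boundedI)
qed

lemma exp_bounded_affine:
  assumes "exp_bounded F" shows "exp_bounded (\<lambda>x. F (y + a *\<^sub>R x))"
proof -
  obtain C c where F: "0 \<le> C" "0 \<le> c" "\<And>x. \<bar>F x\<bar> \<le> C * exp (c * norm x)"
    using assms(1) by (rule exp_boundedE) blast
  have "\<bar>F (y + a *\<^sub>R x)\<bar> \<le> (C * exp (c * norm y)) * exp ((c * \<bar>a\<bar>) * norm x)" for x
  proof -
    have "norm (y + a *\<^sub>R x) \<le> norm y + \<bar>a\<bar> * norm x" by (rule norm_triangle_le) simp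
    from mult_left_mono[OF this F(2)]
    have "c * norm (y + a *\<^sub>R x) \<le> c * norm y + c * \<bar>a\<bar> * norm x"
      by (simp add: distrib_left mult.assoc)
    then have "C * exp (c * norm (y + a *\<^sub>R x)) \<le> C * exp (c * norm y + c * \<bar>a\<bar> * norm x)"
      using F(1) by (intro mult_left_mono) auto
    with F(3)[of "y + a *\<^sub>R x"] show ?thesis by (simp add: exp_add mult.assoc)
  qed
  then show ?thesis by (rule exp_boundedI)
qed

lemma exp_bounded_nth [intro, simp]: "exp_bounded (\<lambda>w :: real ^ 'n. w $ i)"
  by (rule exp_bounded_linear) (rule bounded_linear_vec_nth)

text \<open>By \<open>c t \<le> c^2 + t^2 / 4\<close> the integrand is dominated by a multiple of
  \<open>exp (|w|^2 / 4)\<close>, which uses up only half of the Gaussian exponent.\<close>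

lemma exp_norm_integrable: "integrable gaussian (\<lambda>w :: real ^ 'n. exp (c * norm w))"
proof (rule Bochner_Integration.integrable_bound)
  have "integrable gaussian (\<lambda>w :: real ^ 'n. exp (1/2 * (norm w)\<^sup>2 / 2))"
    using nn_integral_gaussian_exp_norm2[of "1/2", where 'n='n]
    by (simp add: integrable_iff_bounded)
  then show "integrable gaussian (\<lambda>w :: real ^ 'n. exp (c\<^sup>2) * exp (1/2 * (norm w)\<^sup>2 / 2))"
    by simp
  have "c * t \<le> c\<^sup>2 + 1/2 * t\<^sup>2 / 2" for t :: real
    using zero_le_power2[of "c - t/2"] by (simp add: power2_eq_square algebra_simps)
  then show "AE w in gaussian. norm (exp (c * norm w)) \<le> norm (exp (c\<^sup>2) * exp (1/2 * (norm w)\<^sup>2 / 2))"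
    by (simp add: exp_add[symmetric])
qed simp

lemma exp_bounded_integrable:
  fixes F :: "real ^ 'n \<Rightarrow> real"
  assumes [measurable]: "F \<in> borel_measurable borel" and "exp_bounded F"
  shows "integrable gaussian F"
proof -
  obtain C c where F: "0 \<le> C" "0 \<le> c" "\<And>x. \<bar>F x\<bar> \<le> C * exp (c * norm x)"
    using assms(2) by (rule exp_boundedE) blast
  have i: "integrable gaussian (\<lambda>w :: real ^ 'n. C * exp (c * norm w))"
    by (intro integrable_mult_right exp_norm_integrable)
  show ?thesis
    by (rule Bochner_Integration.integrable_bound[OF i]) (use F in \<open>auto simp: abs_mult\<close>)
qed

lemma square_integrableD [dest]:
  assumes "square_integrable f"
  shows "f \<in> borel_measurable borel" "integrable gaussian (\<lambda>w. (f w)\<^sup>2)"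
  using assms by (auto simp: square_integrable_def)

lemma exp_bounded_square_integrable:
  assumes "F \<in> borel_measurable borel" "exp_bounded F"
  shows "square_integrable F"
  unfolding square_integrable_def power2_eq_square
  using assms by (auto intro!: exp_bounded_integrable borel_measurable_times)

lemma abs_mult_le_squares: "\<bar>a * b\<bar> \<le> (a\<^sup>2 + b\<^sup>2) / 2" for a b :: real
  using sum_squares_bound[of "\<bar>a\<bar>" "\<bar>b\<bar>"] unfolding abs_mult power2_abs by simp

lemma square_integrable_mult_integrable:
  assumes "square_integrable f" "square_integrable g"
  shows "integrable gaussian (\<lambda>w. f w * g w)"
proof (rule Bochner_Integration.integrable_bound)
  note [measurable] = square_integrableD(1)[OF assms(1)] square_integrableD(1)[OF assms(2)]
  show "(\<lambda>w. f w * g w) \<in> borel_measurable gaussian" by simp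
  show "integrable gaussian (\<lambda>w. ((f w)\<^sup>2 + (g w)\<^sup>2) / 2)"
    using assms[THEN square_integrableD(2)] by simp
  show "AE w in gaussian. norm (f w * g w) \<le> norm (((f w)\<^sup>2 + (g w)\<^sup>2) / 2)"
    using abs_mult_le_squares[of "f _" "g _"] by (intro AE_I2) simp
qed

lemma square_integrable_cmult [intro]: "square_integrable f \<Longrightarrow> square_integrable (\<lambda>w. c * f w)"
  unfolding square_integrable_def by (auto simp: power_mult_distrib)

lemma square_integrable_const [intro, simp]: "square_integrable (\<lambda>_. c)"
  by (rule exp_bounded_square_integrable) auto

lemma square_integrable_add [intro]:
  assumes "square_integrable f" "square_integrable g"
  shows "square_integrable (\<lambda>w. f w + g w)"
  unfolding square_integrable_def power2_sum
  using assms[THEN square_integrableD(1)] assms[THEN square_integrableD(2)] square_integrable_mult_integrable[OF assms]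
  by (auto simp: mult.assoc)

lemma square_integrable_diff [intro]:
  assumes "square_integrable f" "square_integrable g"
  shows "square_integrable (\<lambda>w. f w - g w)"
  using square_integrable_add[OF assms(1) square_integrable_cmult[OF assms(2), of "-1"]] by simp

lemma square_integrable_sum [intro]:
  "(\<And>i. i \<in> I \<Longrightarrow> square_integrable (f i)) \<Longrightarrow> square_integrable (\<lambda>w. \<Sum>i\<in>I. f i w)"
  by (induction I rule: infinite_finite_induct) auto

lemma square_integrable_integrable: "square_integrable f \<Longrightarrow> integrable gaussian f"
  using square_integrable_mult_integrable[of f "\<lambda>_. 1"] by simp

lemma abs_exp_minus_one_le: "\<bar>exp u - 1\<bar> \<le> \<bar>u\<bar> * exp \<bar>u\<bar>" for u :: real
proof (cases "u \<ge> 0")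
  case True
  have "(1 - u) * exp u \<le> exp (-u) * exp u"
    using exp_ge_add_one_self[of "-u"] by (intro mult_right_mono) auto
  with True show ?thesis by (simp add: exp_add[symmetric] algebra_simps)
next
  case False
  have "1 - exp u \<le> -u" using exp_ge_add_one_self[of u] by linarith
  also have "\<dots> \<le> \<bar>u\<bar> * exp \<bar>u\<bar>" using False by (simp add: mult_le_cancel_left1)
  finally show ?thesis using False by simp
qed

lemma tendsto_difference_quotient:
  assumes "(f has_real_derivative D) (at 0)"
  shows "(\<lambda>n. (f (inverse (real (Suc n))) - f 0) / inverse (real (Suc n))) \<longlonglongrightarrow> D"
proof -
  have "((\<lambda>h. (f h - f 0) / h) \<longlongrightarrow> D) (at 0)"
    using assms by (simp add: DERIV_def)
  moreover have "filterlim (\<lambda>n. inverse (real (Suc n))) (at 0) sequentially"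
    by (intro filterlim_atI LIMSEQ_inverse_real_of_nat) auto
  ultimately show ?thesis by (rule filterlim_compose)
qed

text \<open>The Cameron-Martin formula is differentiated at translation 0 in the direction
  \<open>axis i 1\<close>: the difference quotient of \<open>G\<close> on one side becomes one of
  \<open>shift_density\<close> on the other, whose derivative at 0 is \<open>w $ i\<close>.
  Dominated convergence applies to both sides.\<close>

lemma gaussian_integration_by_parts:
  fixes G :: "real ^ 'n \<Rightarrow> real"
  assumes deriv: "\<And>w. ((\<lambda>t. G (w + t *\<^sub>R axis i 1)) has_real_derivative G' w) (at 0)"
    and [measurable]: "G \<in> borel_measurable borel" "G' \<in> borel_measurable borel"
    and G: "exp_bounded G" and G': "exp_bounded G'"
  shows "(\<E> w. G' w) = (\<E> w. w $ i * G w)"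
proof -
  define e :: "real ^ 'n" where "e = axis i 1"
  define s :: "nat \<Rightarrow> real" where "s n = inverse (real (Suc n))" for n
  have s: "0 < s n" "s n \<le> 1" for n by (auto simp: s_def field_simps)
  have e: "norm e = 1" by (simp add: e_def)
  have we: "w \<bullet> e = w $ i" for w :: "real ^ 'n" by (simp add: e_def inner_axis)
  have intG: "integrable gaussian (\<lambda>w. G (w + s n *\<^sub>R e))" "integrable gaussian G" for n
    using exp_bounded_affine[OF G, of "s n *\<^sub>R e" 1] G
    by (auto intro!: exp_bounded_integrable simp: add.commute)
  have eq: "(\<E> w. (G (w + s n *\<^sub>R e) - G w) / s n)
      = (\<E> w. G w * ((shift_density (s n *\<^sub>R e) w - 1) / s n))" for n
  proof -
    have i: "integrable gaussian (\<lambda>w. shift_density (s n *\<^sub>R e) w * G w)"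
      using intG(1)[of n] by (simp add: integrable_gaussian_shift)
    have "(\<E> w. (G (w + s n *\<^sub>R e) - G w) / s n)
      = ((\<E> w. shift_density (s n *\<^sub>R e) w * G w) - (\<E> w. G w)) / s n"
      using intG by (simp add: integral_gaussian_shift)
    also have "\<dots> = (\<E> w. (shift_density (s n *\<^sub>R e) w * G w - G w) / s n)"
      using i intG by simp
    finally show ?thesis by (simp add: algebra_simps)
  qed
  obtain C c where C: "0 \<le> C" "0 \<le> c" "\<And>x. \<bar>G' x\<bar> \<le> C * exp (c * norm x)"
    using G' by (rule exp_boundedE) blast
  have lim1: "(\<lambda>n. (\<E> w. (G (w + s n *\<^sub>R e) - G w) / s n)) \<longlonglongrightarrow> (\<E> w. G' w)"
  proof (rule integral_dominated_convergence)
    show "integrable gaussian (\<lambda>w :: real ^ 'n. C * exp c * exp (c * norm w))"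
      by (intro integrable_mult_right exp_norm_integrable)
    show "AE w in gaussian. (\<lambda>n. (G (w + s n *\<^sub>R e) - G w) / s n) \<longlonglongrightarrow> G' w"
      using tendsto_difference_quotient[OF deriv] by (simp add: s_def e_def)
    show "AE w in gaussian. norm ((G (w + s n *\<^sub>R e) - G w) / s n) \<le> C * exp c * exp (c * norm w)" for n
    proof (rule AE_I2)
      fix w :: "real ^ 'n"
      have d: "((\<lambda>t. G (w + t *\<^sub>R e)) has_real_derivative G' (w + t *\<^sub>R e)) (at t)" for t
        using deriv[of "w + t *\<^sub>R e"] DERIV_shift[of "\<lambda>t. G (w + t *\<^sub>R e)" "G' (w + t *\<^sub>R e)" 0 t]
        by (simp add: e_def algebra_simps)
      \<comment> \<open>The mean value theorem replaces the quotient by \<open>G'\<close> at a point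
        within distance 1 of \<open>w\<close>, because \<open>s n \<le> 1\<close>; this makes the
        bound uniform in \<open>n\<close>.\<close>
      obtain z where z: "0 < z" "z < s n"
        "G (w + s n *\<^sub>R e) - G (w + 0 *\<^sub>R e) = (s n - 0) * G' (w + z *\<^sub>R e)"
        using MVT2[OF s(1)[of n] d] by blast
      then have "norm ((G (w + s n *\<^sub>R e) - G w) / s n) = \<bar>G' (w + z *\<^sub>R e)\<bar>"
        using s[of n] by simp
      also have "\<dots> \<le> C * exp (c * norm (w + z *\<^sub>R e))" by (rule C)
      also have "\<dots> \<le> C * exp (c * (norm w + 1))"
      proof -
        have "norm (w + z *\<^sub>R e) \<le> norm w + 1"
          using z s[of n] e by (intro norm_triangle_le) auto
        then show ?thesis using C by (auto intro!: mult_left_mono)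
      qed
      finally show "norm ((G (w + s n *\<^sub>R e) - G w) / s n) \<le> C * exp c * exp (c * norm w)"
        by (simp add: distrib_left exp_add mult_ac)
    qed
  qed measurable
  have lim2: "(\<lambda>n. (\<E> w. G w * ((shift_density (s n *\<^sub>R e) w - 1) / s n))) \<longlonglongrightarrow> (\<E> w. G w * w $ i)"
  proof (rule integral_dominated_convergence)
    have "exp_bounded (\<lambda>w :: real ^ 'n. exp (2 * norm w + 2))"
      by (rule exp_boundedI[of _ "exp 2" 2]) (simp add: exp_add)
    then show "integrable gaussian (\<lambda>w. \<bar>G w\<bar> * exp (2 * norm w + 2))"
      using exp_bounded_integrable[OF _ exp_bounded_mult[OF G], of "\<lambda>w. exp (2 * norm w + 2)", THEN integrable_abs]
      by (simp add: abs_mult)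
    show "AE w in gaussian. (\<lambda>n. G w * ((shift_density (s n *\<^sub>R e) w - 1) / s n)) \<longlonglongrightarrow> G w * w $ i"
    proof (rule AE_I2)
      fix w :: "real ^ 'n"
      have "((\<lambda>t. exp (t * w $ i - t\<^sup>2 / 2)) has_real_derivative w $ i) (at 0)"
        by (auto intro!: derivative_eq_intros)
      from tendsto_difference_quotient[OF this]
      show "(\<lambda>n. G w * ((shift_density (s n *\<^sub>R e) w - 1) / s n)) \<longlonglongrightarrow> G w * w $ i"
        by (intro tendsto_mult_left) (simp add: s_def shift_density_def we e power_mult_distrib)
    qed
    show "AE w in gaussian. norm (G w * ((shift_density (s n *\<^sub>R e) w - 1) / s n)) \<le> \<bar>G w\<bar> * exp (2 * norm w + 2)" for n
    proof (rule AE_I2)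
      fix w :: "real ^ 'n"
      \<comment> \<open>\<open>u\<close> is the exponent of the shift density. Since
        \<open>\<bar>u\<bar>\<close> carries a factor \<open>s n\<close>, the estimate
        \<open>\<bar>exp u - 1\<bar> \<le> \<bar>u\<bar> * exp \<bar>u\<bar>\<close> absorbs the
        division by \<open>s n\<close>; the remaining factor \<open>norm w + 1\<close> is absorbed
        by one more exponential.\<close>
      define u where "u = s n * (w $ i) - (s n)\<^sup>2 / 2"
      have wi: "\<bar>w $ i\<bar> \<le> norm w" by (rule component_le_norm_cart)
      have "\<bar>u\<bar> \<le> s n * (norm w + 1)"
      proof -
        have "\<bar>u\<bar> \<le> s n * \<bar>w $ i\<bar> + s n * (s n / 2)"
          unfolding u_def using s[of n] by (auto simp: power2_eq_square abs_mult intro!: order_trans[OF abs_triangle_ineq4])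
        also have "\<dots> \<le> s n * norm w + s n * 1"
          using s[of n] wi by (intro add_mono mult_left_mono) auto
        finally show ?thesis by (simp add: distrib_left)
      qed
      moreover from this have "\<bar>u\<bar> \<le> norm w + 1"
        using s[of n] mult_left_le_one_le[of "norm w + 1" "s n"] norm_ge_zero[of w] by linarith
      ultimately have "\<bar>u\<bar> * exp \<bar>u\<bar> \<le> (s n * (norm w + 1)) * exp (norm w + 1)"
        using s[of n] by (intro mult_mono) auto
      also have "\<dots> \<le> (s n * exp (norm w + 1)) * exp (norm w + 1)"
        using s[of n] exp_ge_add_one_self[of "norm w + 1"] by (intro mult_right_mono mult_left_mono) auto
      also have "\<dots> = s n * exp (2 * norm w + 2)"
        by (simp add: mult.assoc exp_add[symmetric])
      finally have "\<bar>exp u - 1\<bar> \<le> s n * exp (2 * norm w + 2)"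
        using abs_exp_minus_one_le[of u] by linarith
      then have "\<bar>(shift_density (s n *\<^sub>R e) w - 1) / s n\<bar> \<le> exp (2 * norm w + 2)"
        using s[of n] by (simp add: shift_density_def we e u_def power_mult_distrib divide_le_eq mult.commute)
      then show "norm (G w * ((shift_density (s n *\<^sub>R e) w - 1) / s n)) \<le> \<bar>G w\<bar> * exp (2 * norm w + 2)"
        unfolding real_norm_def abs_mult by (rule mult_left_mono) simp
    qed
  qed measurable
  show ?thesis
    using LIMSEQ_unique[OF lim1 lim2[folded eq]] by (simp add: mult.commute)
qed

section \<open>Hermite polynomials and their tensor products\<close>

lemma hermite_Suc: "hermite (Suc k) x = x * hermite k x - real k * hermite (k - 1) x"
  by (cases k) auto

lemma hermite_has_derivative [derivative_intros]:
  "(hermite k has_real_derivative real k * hermite (k - 1) x) (at x)"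
proof (induction k rule: induct_nat_012)
  case (ge2 k)
  have "((\<lambda>x. x * hermite (Suc k) x - real (Suc k) * hermite k x) has_real_derivative
     (1 * hermite (Suc k) x + (real (Suc k) * hermite (Suc k - 1) x) * x) - real (Suc k) * (real k * hermite (k - 1) x)) (at x)"
    by (intro DERIV_diff DERIV_mult DERIV_ident DERIV_cmult ge2)
  moreover have "(1 * hermite (Suc k) x + (real (Suc k) * hermite (Suc k - 1) x) * x) - real (Suc k) * (real k * hermite (k - 1) x)
     = real (Suc (Suc k)) * hermite (Suc (Suc k) - 1) x"
    by (simp add: hermite_Suc[of k x] algebra_simps)
  ultimately show ?case by simp
qed simp_all

lemma borel_measurable_hermite [measurable]: "hermite k \<in> borel_measurable borel"
  by (intro borel_measurable_continuous_onI continuous_at_imp_continuous_on ballI DERIV_isCont[OF hermite_has_derivative])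

lemma exp_bounded_hermite: "exp_bounded (hermite k)"
proof (induction k rule: induct_nat_012)
  case (ge2 k)
  have "exp_bounded (\<lambda>x. x * hermite (Suc k) x - real (Suc k) * hermite k x)"
    by (intro exp_bounded_diff exp_bounded_mult exp_bounded_const exp_bounded_linear bounded_linear_ident ge2)
  then show ?case by simp
next
  case 1
  have "exp_bounded (\<lambda>x::real. x)" by (intro exp_bounded_linear bounded_linear_ident)
  then show ?case by simp
qed simp

lemma exp_bounded_hermite_nth: "exp_bounded (\<lambda>w :: real ^ 'n. hermite k (w $ i))"
proof -
  obtain C c where C: "0 \<le> C" "0 \<le> c" "\<And>x. \<bar>hermite k x\<bar> \<le> C * exp (c * norm x)"
    using exp_bounded_hermite by (rule exp_boundedE) blast
  have "\<bar>hermite k (w $ i)\<bar> \<le> C * exp (c * norm w)" for w :: "real ^ 'n"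
  proof -
    have "c * norm (w $ i) \<le> c * norm w"
      using C component_le_norm_cart[of w i] by (intro mult_left_mono) auto
    then have "C * exp (c * norm (w $ i)) \<le> C * exp (c * norm w)"
      using C by (intro mult_left_mono) auto
    with C(3)[of "w $ i"] show ?thesis by linarith
  qed
  then show ?thesis by (rule exp_boundedI)
qed

lemma borel_measurable_hermite_tensor [measurable]:
  "hermite_tensor (is :: 'n::finite list) \<in> borel_measurable borel"
  unfolding hermite_tensor_def by measurable

lemma exp_bounded_hermite_tensor [intro, simp]: "exp_bounded (hermite_tensor is)"
  unfolding hermite_tensor_def by (intro exp_bounded_prod exp_bounded_hermite_nth)

lemma square_integrable_hermite_tensor [intro, simp]: "square_integrable (hermite_tensor is)"
  by (rule exp_bounded_square_integrable) auto

lemma hermite_tensor_Nil [simp]: "hermite_tensor [] w = 1"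
  by (simp add: hermite_tensor_def)

lemma hermite_tensor_split:
  "hermite_tensor is w = hermite (count_list is i) (w $ i) * (\<Prod>j\<in>UNIV - {i}. hermite (count_list is j) (w $ j))"
  unfolding hermite_tensor_def by (rule prod.remove) auto

lemma prod_hermite_Cons:
  "(\<Prod>j\<in>UNIV - {i}. hermite (count_list (i # is) j) (w $ j)) = (\<Prod>j\<in>UNIV - {i}. hermite (count_list is j) (w $ j))"
  by (rule prod.cong) auto

lemma prod_hermite_remove1:
  "(\<Prod>j\<in>UNIV - {i}. hermite (count_list (remove1 i is) j) (w $ j)) = (\<Prod>j\<in>UNIV - {i}. hermite (count_list is j) (w $ j))"
  by (rule prod.cong) auto

text \<open>The subtracted term is the derivative of \<open>hermite_tensor is\<close> in the
  direction \<open>i\<close>, so prepending \<open>i\<close> applies the Gaussian divergence, the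
  adjoint of that derivative. If \<open>i\<close> does not occur in the list, its multiplicity 0
  removes the term.\<close>

lemma hermite_tensor_Cons:
  "hermite_tensor (i # is) w = w $ i * hermite_tensor is w - real (count_list is i) * hermite_tensor (remove1 i is) w"
  unfolding hermite_tensor_split[of _ _ i] prod_hermite_Cons prod_hermite_remove1
  by (simp add: hermite_Suc[of "count_list is i"] left_diff_distrib)

lemma hermite_tensor_has_derivative:
  "((\<lambda>t. hermite_tensor is (w + t *\<^sub>R axis i 1)) has_real_derivative
     real (count_list is i) * hermite_tensor (remove1 i is) w) (at 0)"
proof -
  let ?P = "\<Prod>j\<in>UNIV - {i}. hermite (count_list is j) (w $ j)" and ?k = "count_list is i"
  have *: "hermite_tensor is (w + t *\<^sub>R axis i 1) = hermite ?k (w $ i + t) * ?P" for t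
  proof -
    have "(\<Prod>j\<in>UNIV - {i}. hermite (count_list is j) ((w + t *\<^sub>R axis i 1) $ j)) = ?P"
      by (rule prod.cong) (auto simp: axis_def)
    then show ?thesis
      unfolding hermite_tensor_split[of _ _ i] by (simp add: axis_def)
  qed
  have "((\<lambda>t. hermite ?k (w $ i + t)) has_real_derivative real ?k * hermite (?k - 1) (w $ i)) (at 0)"
    using hermite_has_derivative[of ?k "w $ i"] DERIV_shift[of "hermite ?k" _ 0 "w $ i"]
    by (simp add: add.commute)
  from DERIV_cmult_right[OF this, of ?P]
  show ?thesis
    unfolding * hermite_tensor_split[of "remove1 i is" _ i] prod_hermite_remove1 by (simp add: mult.assoc)
qed

text \<open>In the product rule for \<open>F\<close> times the tensor, the derivative of the tensor
  combines with the factor \<open>w $ i\<close> into the recurrence for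
  \<open>i # is\<close>.\<close>

lemma gaussian_integration_by_parts_hermite:
  fixes F :: "real ^ 'n \<Rightarrow> real"
  assumes deriv: "\<And>w. ((\<lambda>t. F (w + t *\<^sub>R axis i 1)) has_real_derivative F' w) (at 0)"
    and [measurable]: "F \<in> borel_measurable borel" "F' \<in> borel_measurable borel"
    and F: "exp_bounded F" and F': "exp_bounded F'"
  shows "(\<E> w. F' w * hermite_tensor is w) = (\<E> w. F w * hermite_tensor (i # is) w)"
proof -
  let ?H = "hermite_tensor is" and ?H' = "\<lambda>w. real (count_list is i) * hermite_tensor (remove1 i is) w"
  have "(\<E> w. F' w * ?H w + F w * ?H' w) = (\<E> w. w $ i * (F w * ?H w))"
  proof (rule gaussian_integration_by_parts)
    show "((\<lambda>t. F (w + t *\<^sub>R axis i 1) * ?H (w + t *\<^sub>R axis i 1)) has_real_derivative (F' w * ?H w + F w * ?H' w)) (at 0)" for w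
      using DERIV_mult[OF deriv hermite_tensor_has_derivative, of w "is" w] by (simp add: mult.commute)
  qed (use F F' in \<open>auto intro!: exp_bounded_add exp_bounded_mult\<close>)
  moreover have "integrable gaussian (\<lambda>w. F' w * ?H w)" "integrable gaussian (\<lambda>w. F w * ?H' w)"
    "integrable gaussian (\<lambda>w. w $ i * (F w * ?H w))"
    using F F' by (auto intro!: exp_bounded_integrable exp_bounded_mult)
  ultimately show ?thesis
    by (simp add: hermite_tensor_Cons right_diff_distrib mult.left_commute)
qed

lemma count_mset_eq_count_list: "count (mset xs) x = count_list xs x"
  by (induction xs) auto

text \<open>Integration by parts moves the head \<open>i\<close> of the first list to the other
  factor as a derivative, which deletes one \<open>i\<close> from \<open>js\<close> and produces its
  multiplicity there. Iteration yields the factorials of the multiplicities.\<close>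

lemma hermite_tensor_orthogonal:
  "(\<E> w. hermite_tensor is w * hermite_tensor js w) =
     (if mset is = mset js then \<Prod>i\<in>UNIV. fact (count_list is i) else 0)"
proof (induction "is" arbitrary: js)
  case Nil
  show ?case
  proof (cases js)
    case (Cons j js')
    have "(\<E> w. 0 * hermite_tensor js' w) = (\<E> w. 1 * hermite_tensor (j # js') w)"
      by (rule gaussian_integration_by_parts_hermite) auto
    then show ?thesis using Cons by simp
  qed (use gaussian.prob_space in simp)
next
  case (Cons i "is")
  have "(\<E> w. hermite_tensor (i # is) w * hermite_tensor js w)
      = (\<E> w. real (count_list js i) * hermite_tensor (remove1 i js) w * hermite_tensor is w)"
    by (subst gaussian_integration_by_parts_hermite[OF hermite_tensor_has_derivative])
       (auto simp: mult.commute intro!: exp_bounded_mult)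
  also have "\<dots> = real (count_list js i) * (\<E> w. hermite_tensor is w * hermite_tensor (remove1 i js) w)"
    by (subst integral_mult_right_zero[symmetric]) (simp only: mult_ac)
  also have "\<dots> = (if mset (i # is) = mset js then \<Prod>j\<in>UNIV. fact (count_list (i # is) j) else 0)"
  proof (cases "i \<in> set js")
    case True
    then have eq: "mset (i # is) = mset js \<longleftrightarrow> mset is = mset (remove1 i js)"
      by simp (metis add_mset_remove_trivial insert_DiffM set_mset_mset)
    have "real (count_list js i) * (\<Prod>j\<in>UNIV. fact (count_list is j)) = (\<Prod>j\<in>UNIV. fact (count_list (i # is) j))"
      if "mset (i # is) = mset js"
    proof -
      have c: "count_list js i = Suc (count_list is i)"
        using arg_cong[OF that, of "\<lambda>M. count M i"] by (simp add: count_mset_eq_count_list)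
      show ?thesis
        unfolding prod.remove[OF finite_class.finite_UNIV UNIV_I[of i]]
        using prod.cong[of "UNIV - {i}" "UNIV - {i}" "\<lambda>j. fact (count_list (i # is) j) :: real" "\<lambda>j. fact (count_list is j)"]
        by (simp add: c)
    qed
    then show ?thesis using eq Cons.IH[of "remove1 i js"] by simp
  next
    case False
    then have "mset (i # is) \<noteq> mset js" by (metis list.set_intros(1) mset_eq_setD)
    then show ?thesis using False by (simp add: count_list_0_iff)
  qed
  finally show ?case .
qed

text \<open>Mehler's formula. Expanding the recurrence at the mixed point and integrating by parts
  in \<open>z\<close> leaves the coefficient \<open>1 - b^2 = a^2\<close> on the tensor with one
  \<open>i\<close> removed, exactly the two powers of \<open>a\<close> by which the length of that
  list falls short of the length of \<open>is\<close>. Two different shorter lists occur, hence the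
  induction on the length.\<close>

lemma hermite_tensor_mehler:
  fixes a b :: real and w :: "real ^ 'n"
  assumes ab: "a\<^sup>2 + b\<^sup>2 = 1"
  shows "(\<E> z. hermite_tensor is (a *\<^sub>R w + b *\<^sub>R z)) = a ^ length is * hermite_tensor is w"
proof (induction "is" rule: length_induct)
  case (1 "is")
  show ?case
  proof (cases "is")
    case Nil
    then show ?thesis using gaussian.prob_space[where 'n='n] by simp
  next
    case (Cons i js)
    let ?x = "\<lambda>z :: real ^ 'n. a *\<^sub>R w + b *\<^sub>R z" and ?c = "real (count_list js i)"
    let ?F = "\<lambda>z. hermite_tensor js (?x z)" and ?R = "\<lambda>z. hermite_tensor (remove1 i js) (?x z)"
    have eb: "exp_bounded ?F" "exp_bounded ?R" by (intro exp_bounded_affine exp_bounded_hermite_tensor)+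
    have "(\<E> z. b * (?c * ?R z)) = (\<E> z. z $ i * ?F z)"
    proof (rule gaussian_integration_by_parts)
      fix z :: "real ^ 'n"
      have "((\<lambda>t. hermite_tensor js (?x z + (b * t) *\<^sub>R axis i 1)) has_real_derivative ?c * ?R z * b) (at 0)"
        by (rule DERIV_chain2[where f="\<lambda>t. hermite_tensor js (?x z + t *\<^sub>R axis i 1)"])
           (auto intro!: derivative_eq_intros hermite_tensor_has_derivative)
      then show "((\<lambda>t. hermite_tensor js (?x (z + t *\<^sub>R axis i 1))) has_real_derivative b * (?c * ?R z)) (at 0)"
        by (simp add: algebra_simps)
    qed (use eb in \<open>auto intro!: exp_bounded_mult\<close>)
    then have ibp: "(\<E> z. z $ i * ?F z) = b * (?c * (\<E> z. ?R z))" by simp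
    have int: "integrable gaussian ?F" "integrable gaussian ?R" "integrable gaussian (\<lambda>z. z $ i * ?F z)"
      using eb by (auto intro!: exp_bounded_integrable exp_bounded_mult)
    have "hermite_tensor is (?x z) = a * (w $ i) * ?F z + b * (z $ i * ?F z) - ?c * ?R z" for z
      by (simp add: Cons hermite_tensor_Cons algebra_simps)
    then have "(\<E> z. hermite_tensor is (?x z))
       = a * (w $ i) * (\<E> z. ?F z) + b * (\<E> z. z $ i * ?F z) - ?c * (\<E> z. ?R z)"
      using int by simp
    also have "\<dots> = a * (w $ i) * (\<E> z. ?F z) - (1 - b\<^sup>2) * (?c * (\<E> z. ?R z))"
      by (simp add: ibp power2_eq_square algebra_simps)
    also have "(\<E> z. ?F z) = a ^ length js * hermite_tensor js w"
      using 1 Cons by simp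
    also have "(1 - b\<^sup>2) * (?c * (\<E> z. ?R z)) = a ^ length is * (?c * hermite_tensor (remove1 i js) w)"
    proof (cases "i \<in> set js")
      case True
      then have l: "length js = Suc (length (remove1 i js))"
        by (simp add: length_remove1) (metis Suc_pred length_pos_if_in_set)
      have "1 - b\<^sup>2 = a\<^sup>2" using ab by simp
      moreover have "(\<E> z. ?R z) = a ^ length (remove1 i js) * hermite_tensor (remove1 i js) w"
        using 1 Cons l by simp
      ultimately show ?thesis by (simp add: Cons l power2_eq_square del: length_remove1)
    qed (simp add: count_list_0_iff)
    finally show ?thesis
      unfolding Cons hermite_tensor_Cons by (simp add: right_diff_distrib mult.assoc mult.left_commute)
  qed
qed

lemma wiener_ito_eq: "wiener_ito k u w = (\<Sum>is | length is = k. u is * hermite_tensor is w)"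
  by (simp add: wiener_ito_def hermite_tensor_def)

lemma finite_lists_length [simp, intro]: "finite {is :: 'n::finite list. length is = k}"
  using finite_lists_length_eq[of "UNIV :: 'n set" k] by simp

lemma square_integrable_wiener_ito [intro, simp]: "square_integrable (wiener_ito k u)"
  unfolding wiener_ito_eq[abs_def] by (intro square_integrable_sum square_integrable_cmult) auto

text \<open>By symmetry all arrangements of \<open>is\<close> carry the same coefficient. Their
  number times the squared norm of the Hermite tensor, a product of factorials of multiplicities, is
  \<open>fact l\<close> by the multinomial count.\<close>

lemma integral_hermite_tensor_wiener_ito:
  fixes "is" :: "'n::finite list"
  assumes v: "symmetric_tensors v"
  shows "(\<E> w. hermite_tensor is w * wiener_ito l v w) = (if l = length is then fact l * v is else 0)"
proof -
  let ?P = "\<Prod>i\<in>UNIV. fact (count_list is i) :: nat"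
  have "(\<E> w. hermite_tensor is w * wiener_ito l v w)
      = (\<E> w. (\<Sum>js | length js = l. v js * (hermite_tensor is w * hermite_tensor js w)))"
    unfolding wiener_ito_eq sum_distrib_left by (simp only: mult.left_commute)
  also have "\<dots> = (\<Sum>js | length js = l. v js * (\<E> w. hermite_tensor is w * hermite_tensor js w))"
    by (subst Bochner_Integration.integral_sum) (auto intro!: square_integrable_mult_integrable)
  also have "\<dots> = (\<Sum>js | length js = l. if mset js = mset is then v is * real ?P else 0)"
  proof (rule sum.cong[OF refl])
    fix js :: "'n list"
    have "mset js = mset is \<Longrightarrow> v js = v is" using v unfolding symmetric_tensors_def by blast
    then show "v js * (\<E> w. hermite_tensor is w * hermite_tensor js w)
        = (if mset js = mset is then v is * real ?P else 0)"
      by (simp add: hermite_tensor_orthogonal eq_commute)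
  qed
  also have "\<dots> = (\<Sum>js \<in> {js. length js = l \<and> mset js = mset is}. v is * real ?P)"
    by (subst sum.inter_filter[symmetric]) auto
  also have "\<dots> = (if l = length is then fact l * v is else 0)"
  proof (cases "l = length is")
    case True
    have "{js. length js = l \<and> mset js = mset is} = permutations_of_multiset (mset is)"
      using True by (auto simp: permutations_of_multiset_def dest: mset_eq_length)
    moreover have "?P = (\<Prod>i\<in>set_mset (mset is). fact (count (mset is) i))"
      unfolding count_mset_eq_count_list by (rule prod.mono_neutral_right) (auto simp: count_list_0_iff)
    ultimately have "card {js. length js = l \<and> mset js = mset is} * ?P = fact l"
      using card_permutations_of_multiset_aux[of "mset is"] True by simp
    then have "real (card {js. length js = l \<and> mset js = mset is}) * real ?P = fact l"
      by (metis of_nat_fact of_nat_mult)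
    then show ?thesis using True by simp
  next
    case False
    then have "{js. length js = l \<and> mset js = mset is} = {}"
      by (auto dest: mset_eq_length)
    with False show ?thesis by simp
  qed
  finally show ?thesis .
qed

section \<open>Completeness of the Hermite polynomials and Parseval\<close>

text \<open>The divisor is the factorial of the whole length and not the squared norm of the Hermite
  tensor, because a symmetric tensor spreads the coefficient over all arrangements of the
  indices.\<close>

definition chaos_coeff :: "(real ^ 'n \<Rightarrow> real) \<Rightarrow> 'n chaos" where
  "chaos_coeff f is = (\<E> w. f w * hermite_tensor is w) / fact (length is)"

definition hermite_comb :: "nat \<Rightarrow> (real ^ 'n \<Rightarrow> real) \<Rightarrow> bool" where
  "hermite_comb N p \<longleftrightarrow> (\<exists>c. p = (\<lambda>w. \<Sum>is | length is < N. c is * hermite_tensor is w))"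

definition poly_approximable :: "(real ^ 'n \<Rightarrow> real) \<Rightarrow> bool" where
  "poly_approximable f \<longleftrightarrow> square_integrable f \<and>
     (\<forall>\<epsilon>>0. \<exists>p. real_polynomial_function p \<and> (\<E> w. (f w - p w)\<^sup>2) < \<epsilon>)"

text \<open>The second moment of \<open>f + t g\<close> is a nonnegative quadratic in
  \<open>t\<close>. It is evaluated at its minimum \<open>- ?B / ?C\<close>, unless the leading
  coefficient vanishes.\<close>

lemma integral_cauchy_schwarz:
  assumes f: "square_integrable f" and g: "square_integrable g"
  shows "(\<E> w. f w * g w)\<^sup>2 \<le> (\<E> w. (f w)\<^sup>2) * (\<E> w. (g w)\<^sup>2)"
proof -
  let ?A = "(\<E> w. (f w)\<^sup>2)" and ?B = "(\<E> w. f w * g w)" and ?C = "(\<E> w. (g w)\<^sup>2)"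
  have fg: "integrable gaussian (\<lambda>w. f w * g w)" by (rule square_integrable_mult_integrable[OF f g])
  have q: "0 \<le> ?A + 2 * t * ?B + t\<^sup>2 * ?C" for t
  proof -
    have "0 \<le> (\<E> w. (f w + t * g w)\<^sup>2)" by (rule Bochner_Integration.integral_nonneg) simp
    also have "\<dots> = (\<E> w. (f w)\<^sup>2 + 2 * t * (f w * g w) + t\<^sup>2 * (g w)\<^sup>2)"
      by (simp add: power2_sum power_mult_distrib algebra_simps)
    also have "\<dots> = ?A + 2 * t * ?B + t\<^sup>2 * ?C"
      using square_integrableD(2)[OF f] square_integrableD(2)[OF g] fg by simp
    finally show ?thesis .
  qed
  have C: "0 \<le> ?C" by (rule Bochner_Integration.integral_nonneg) simp
  show ?thesis
  proof (cases "?C = 0")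
    case True
    have "?B = 0"
    proof (rule ccontr)
      assume B: "?B \<noteq> 0"
      \<comment> \<open>With \<open>?C = 0\<close> the quadratic is affine in \<open>t\<close>, and
        this \<open>t\<close> gives it the value -1.\<close>
      from q[of "- (?A + 1) / (2 * ?B)"] True B show False by (simp add: field_simps)
    qed
    then show ?thesis using True by simp
  next
    case False
    then have "0 < ?C" using C by linarith
    then show ?thesis using q[of "- ?B / ?C"] by (simp add: field_simps power2_eq_square)
  qed
qed

section \<open>Density of the polynomials\<close>

lemma real_polynomial_function_measurable [measurable_dest]:
  assumes "real_polynomial_function (p :: real ^ 'n \<Rightarrow> real)" shows "p \<in> borel_measurable borel"
  using continuous_on_polymonial_function[of p UNIV] assms
  by (auto intro: borel_measurable_continuous_onI simp: real_polynomial_function_eq)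

lemma real_polynomial_function_exp_bounded:
  "real_polynomial_function p \<Longrightarrow> exp_bounded p"
  by (induction rule: real_polynomial_function.induct) auto

lemma real_polynomial_function_square_integrable:
  "real_polynomial_function p \<Longrightarrow> square_integrable p"
  by (intro exp_bounded_square_integrable real_polynomial_function_measurable real_polynomial_function_exp_bounded)

lemma real_polynomial_function_poly_approximable:
  "real_polynomial_function p \<Longrightarrow> poly_approximable p"
  unfolding poly_approximable_def by (auto intro!: exI[of _ p] real_polynomial_function_square_integrable)

lemma integral_square_add_le:
  assumes f: "square_integrable f" and g: "square_integrable g"
  shows "(\<E> w. (f w + g w)\<^sup>2) \<le> 2 * (\<E> w. (f w)\<^sup>2) + 2 * (\<E> w. (g w)\<^sup>2)"
proof -
  have "(\<E> w. (f w + g w)\<^sup>2) \<le> (\<E> w. 2 * (f w)\<^sup>2 + 2 * (g w)\<^sup>2)"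
  proof (rule integral_mono)
    show "integrable gaussian (\<lambda>w. (f w + g w)\<^sup>2)" using square_integrable_add[OF f g] by auto
    show "integrable gaussian (\<lambda>w. 2 * (f w)\<^sup>2 + 2 * (g w)\<^sup>2)"
      using square_integrableD(2)[OF f] square_integrableD(2)[OF g] by simp
    show "(f w + g w)\<^sup>2 \<le> 2 * (f w)\<^sup>2 + 2 * (g w)\<^sup>2" for w
      using zero_le_power2[of "f w - g w"] by (simp add: power2_eq_square algebra_simps)
  qed
  also have "\<dots> = 2 * (\<E> w. (f w)\<^sup>2) + 2 * (\<E> w. (g w)\<^sup>2)"
    using square_integrableD(2)[OF f] square_integrableD(2)[OF g] by simp
  finally show ?thesis .
qed

lemma poly_approximable_square_integrable: "poly_approximable f \<Longrightarrow> square_integrable f"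
  by (simp add: poly_approximable_def)

lemma poly_approximable_limit:
  assumes f: "square_integrable f" and g: "\<And>n. poly_approximable (g n)"
    and lim: "(\<lambda>n::nat. (\<E> w. (f w - g n w)\<^sup>2)) \<longlonglongrightarrow> 0"
  shows "poly_approximable f"
  unfolding poly_approximable_def
proof (intro conjI allI impI f)
  fix \<epsilon> :: real assume "\<epsilon> > 0"
  then have e: "\<epsilon> / 4 > 0" by simp
  from order_tendstoD(2)[OF lim this] obtain n where n: "(\<E> w. (f w - g n w)\<^sup>2) < \<epsilon> / 4"
    by (auto simp: eventually_sequentially)
  obtain p where p: "real_polynomial_function p" "(\<E> w. (g n w - p w)\<^sup>2) < \<epsilon> / 4"
    using g e unfolding poly_approximable_def by blast
  have "(\<E> w. (f w - p w)\<^sup>2) = (\<E> w. ((f w - g n w) + (g n w - p w))\<^sup>2)" by simp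
  also have "\<dots> \<le> 2 * (\<E> w. (f w - g n w)\<^sup>2) + 2 * (\<E> w. (g n w - p w)\<^sup>2)"
    by (intro integral_square_add_le square_integrable_diff f poly_approximable_square_integrable[OF g]
          real_polynomial_function_square_integrable p)
  also have "\<dots> < \<epsilon>" using n p by simp
  finally show "\<exists>p. real_polynomial_function p \<and> (\<E> w. (f w - p w)\<^sup>2) < \<epsilon>" using p by blast
qed

lemma poly_approximable_dominated:
  fixes f :: "real ^ 'n \<Rightarrow> real"
  assumes f [measurable]: "f \<in> borel_measurable borel" and g: "\<And>n. poly_approximable (g n)"
    and B: "square_integrable B" "\<And>n w. \<bar>g n w\<bar> \<le> B w"
    and lim: "\<And>w. (\<lambda>n::nat. g n w) \<longlonglongrightarrow> f w"
  shows "poly_approximable f"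
proof -
  have fB: "\<bar>f w\<bar> \<le> B w" for w
    by (rule LIMSEQ_le_const2[OF tendsto_rabs[OF lim]]) (use B in auto)
  have gm [measurable]: "g n \<in> borel_measurable borel" for n
    using g poly_approximable_square_integrable by blast
  have B0: "0 \<le> B w" for w using B(2)[of 0 w] by linarith
  have "integrable gaussian (\<lambda>w. (f w)\<^sup>2)"
    by (rule Bochner_Integration.integrable_bound[OF square_integrableD(2)[OF B(1)]])
       (use fB B0 in \<open>auto intro!: abs_le_square_iff[THEN iffD1]\<close>)
  then have sf: "square_integrable f" by (simp add: square_integrable_def)
  have "(\<lambda>n. (\<E> w. (f w - g n w)\<^sup>2)) \<longlonglongrightarrow> (\<integral>w. 0 \<partial>(gaussian :: (real ^ 'n) measure))"
  proof (rule integral_dominated_convergence)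
    show "integrable gaussian (\<lambda>w. (2 * B w)\<^sup>2)"
      using square_integrableD(2)[OF B(1)] by (simp add: power_mult_distrib)
    show "AE w in gaussian. (\<lambda>n. (f w - g n w)\<^sup>2) \<longlonglongrightarrow> 0"
    proof (rule AE_I2)
      fix w
      have "(\<lambda>n. (f w - g n w)\<^sup>2) \<longlonglongrightarrow> (f w - f w)\<^sup>2" by (intro tendsto_intros lim)
      then show "(\<lambda>n. (f w - g n w)\<^sup>2) \<longlonglongrightarrow> 0" by simp
    qed
    show "AE w in gaussian. norm ((f w - g n w)\<^sup>2) \<le> (2 * B w)\<^sup>2" for n
    proof (rule AE_I2)
      fix w
      have "\<bar>f w - g n w\<bar> \<le> \<bar>2 * B w\<bar>" using fB[of w] B(2)[of n w] B0[of w] by linarith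
      then show "norm ((f w - g n w)\<^sup>2) \<le> (2 * B w)\<^sup>2" by (simp add: abs_le_square_iff)
    qed
  qed simp_all
  then show ?thesis by (intro poly_approximable_limit[OF sf g]) simp
qed

lemma poly_approximable_cmult:
  assumes "poly_approximable f" shows "poly_approximable (\<lambda>w. c * f w)"
  unfolding poly_approximable_def
proof (intro conjI allI impI square_integrable_cmult poly_approximable_square_integrable[OF assms])
  fix \<epsilon> :: real assume e: "\<epsilon> > 0"
  have d: "c\<^sup>2 + 1 > 0" by (simp add: add_nonneg_pos)
  then have "\<epsilon> / (c\<^sup>2 + 1) > 0" using e by simp
  then obtain p where p: "real_polynomial_function p" "(\<E> w. (f w - p w)\<^sup>2) < \<epsilon> / (c\<^sup>2 + 1)"
    using assms unfolding poly_approximable_def by blast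
  have nn: "0 \<le> (\<E> w. (f w - p w)\<^sup>2)" by simp
  have "(\<E> w. (c * f w - c * p w)\<^sup>2) = c\<^sup>2 * (\<E> w. (f w - p w)\<^sup>2)"
    by (simp add: right_diff_distrib[symmetric] power_mult_distrib)
  also have "\<dots> \<le> (c\<^sup>2 + 1) * (\<E> w. (f w - p w)\<^sup>2)"
    using nn by (intro mult_right_mono) auto
  also have "\<dots> < \<epsilon>" using p(2) d by (simp add: less_divide_eq mult.commute)
  finally show "\<exists>p. real_polynomial_function p \<and> (\<E> w. (c * f w - p w)\<^sup>2) < \<epsilon>"
    using p(1) by (intro exI[of _ "\<lambda>w. c * p w"]) auto
qed

lemma poly_approximable_add:
  assumes f: "poly_approximable f" and g: "poly_approximable g"
  shows "poly_approximable (\<lambda>w. f w + g w)"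
  unfolding poly_approximable_def
proof (intro conjI allI impI square_integrable_add poly_approximable_square_integrable f g)
  fix \<epsilon> :: real assume "\<epsilon> > 0"
  then have e: "\<epsilon> / 4 > 0" by simp
  obtain p where p: "real_polynomial_function p" "(\<E> w. (f w - p w)\<^sup>2) < \<epsilon> / 4"
    using f e unfolding poly_approximable_def by blast
  obtain q where q: "real_polynomial_function q" "(\<E> w. (g w - q w)\<^sup>2) < \<epsilon> / 4"
    using g e unfolding poly_approximable_def by blast
  have "(\<E> w. (f w + g w - (p w + q w))\<^sup>2) = (\<E> w. ((f w - p w) + (g w - q w))\<^sup>2)"
    by (simp add: algebra_simps)
  also have "\<dots> \<le> 2 * (\<E> w. (f w - p w)\<^sup>2) + 2 * (\<E> w. (g w - q w)\<^sup>2)"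
    by (intro integral_square_add_le square_integrable_diff poly_approximable_square_integrable f g
          real_polynomial_function_square_integrable p q)
  also have "\<dots> < \<epsilon>" using p q by simp
  finally show "\<exists>p. real_polynomial_function p \<and> (\<E> w. (f w + g w - p w)\<^sup>2) < \<epsilon>"
    using p q by (intro exI[of _ "\<lambda>w. p w + q w"]) auto
qed

lemma poly_approximable_const [simp]: "poly_approximable (\<lambda>_. c)"
  by (rule real_polynomial_function_poly_approximable) auto

lemma poly_approximable_sum:
  "(\<And>i. i \<in> I \<Longrightarrow> poly_approximable (f i)) \<Longrightarrow> poly_approximable (\<lambda>w. \<Sum>i\<in>I. f i w)"
  by (induction I rule: infinite_finite_induct) (auto intro!: poly_approximable_add)

text \<open>Mean square approximability is not evidently stable under products, which polynomials in
  sines require. Pointwise limits under an exponential bound are stable, and the bound turns them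
  into dominated limits.\<close>

definition poly_limit :: "(real ^ 'n \<Rightarrow> real) \<Rightarrow> bool" where
  "poly_limit q \<longleftrightarrow> (\<exists>P B. exp_bounded B \<and> (\<forall>N::nat. real_polynomial_function (P N)) \<and>
     (\<forall>w. (\<lambda>N. P N w) \<longlonglongrightarrow> q w) \<and> (\<forall>N w. \<bar>P N w\<bar> \<le> B w))"

lemma poly_limitE:
  assumes "poly_limit q"
  obtains P B where "exp_bounded B" "\<And>N::nat. real_polynomial_function (P N)"
    "\<And>w. (\<lambda>N. P N w) \<longlonglongrightarrow> q w" "\<And>N w. \<bar>P N w\<bar> \<le> B w"
  using assms unfolding poly_limit_def by blast

lemma poly_limit_poly_approximable:
  fixes q :: "real ^ 'n \<Rightarrow> real"
  assumes "poly_limit q" shows "poly_approximable q"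
proof -
  obtain P B where B: "exp_bounded B" and P: "\<And>N::nat. real_polynomial_function (P N)" "\<And>w. (\<lambda>N. P N w) \<longlonglongrightarrow> q w"
    and PB: "\<And>N w. \<bar>P N w\<bar> \<le> B w"
    using assms by (rule poly_limitE) blast
  obtain C c where C: "0 \<le> C" "0 \<le> c" "\<And>w. \<bar>B w\<bar> \<le> C * exp (c * norm w)"
    using B by (rule exp_boundedE) blast
  have PC: "\<bar>P N w\<bar> \<le> C * exp (c * norm w)" for N w using PB[of N w] C(3)[of w] by linarith
  have [measurable]: "P N \<in> borel_measurable borel" for N using P(1) by measurable
  have q: "q \<in> borel_measurable borel"
    by (rule borel_measurable_LIMSEQ_real[of _ P]) (use P in auto)
  have "exp_bounded (\<lambda>w :: real ^ 'n. C * exp (c * norm w))"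
    using C by (intro exp_boundedI[of _ C c]) simp
  then have "square_integrable (\<lambda>w :: real ^ 'n. C * exp (c * norm w))"
    by (intro exp_bounded_square_integrable) auto
  then show ?thesis
    by (rule poly_approximable_dominated[OF q real_polynomial_function_poly_approximable[OF P(1)] _ PC P(2)])
qed

lemma poly_limit_const [simp]: "poly_limit (\<lambda>_. k)"
  unfolding poly_limit_def by (rule exI[of _ "\<lambda>_ _. k"], rule exI[of _ "\<lambda>_. \<bar>k\<bar>"]) auto

lemma poly_limit_add:
  assumes "poly_limit q" "poly_limit r" shows "poly_limit (\<lambda>w. q w + r w)"
proof -
  obtain P B where P: "exp_bounded B" "\<And>N::nat. real_polynomial_function (P N)" "\<And>w. (\<lambda>N. P N w) \<longlonglongrightarrow> q w"
    "\<And>N w. \<bar>P N w\<bar> \<le> B w" using assms(1) by (rule poly_limitE) blast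
  obtain Q D where Q: "exp_bounded D" "\<And>N::nat. real_polynomial_function (Q N)" "\<And>w. (\<lambda>N. Q N w) \<longlonglongrightarrow> r w"
    "\<And>N w. \<bar>Q N w\<bar> \<le> D w" using assms(2) by (rule poly_limitE) blast
  show ?thesis
    unfolding poly_limit_def
  proof (intro exI conjI allI)
    show "exp_bounded (\<lambda>w. B w + D w)" using P(1) Q(1) by auto
    show "real_polynomial_function (\<lambda>w. P N w + Q N w)" for N using P Q by auto
    show "(\<lambda>N. P N w + Q N w) \<longlonglongrightarrow> q w + r w" for w by (intro tendsto_add P Q)
    show "\<bar>P N w + Q N w\<bar> \<le> B w + D w" for N w using P(4)[of N w] Q(4)[of N w] by linarith
  qed
qed

lemma poly_limit_mult:
  assumes "poly_limit q" "poly_limit r" shows "poly_limit (\<lambda>w. q w * r w)"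
proof -
  obtain P B where P: "exp_bounded B" "\<And>N::nat. real_polynomial_function (P N)" "\<And>w. (\<lambda>N. P N w) \<longlonglongrightarrow> q w"
    "\<And>N w. \<bar>P N w\<bar> \<le> B w" using assms(1) by (rule poly_limitE) blast
  obtain Q D where Q: "exp_bounded D" "\<And>N::nat. real_polynomial_function (Q N)" "\<And>w. (\<lambda>N. Q N w) \<longlonglongrightarrow> r w"
    "\<And>N w. \<bar>Q N w\<bar> \<le> D w" using assms(2) by (rule poly_limitE) blast
  show ?thesis
    unfolding poly_limit_def
  proof (intro exI conjI allI)
    show "exp_bounded (\<lambda>w. B w * D w)" using P(1) Q(1) by auto
    show "real_polynomial_function (\<lambda>w. P N w * Q N w)" for N using P Q by auto
    show "(\<lambda>N. P N w * Q N w) \<longlonglongrightarrow> q w * r w" for w by (intro tendsto_mult P Q)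
    show "\<bar>P N w * Q N w\<bar> \<le> B w * D w" for N w
      unfolding abs_mult by (rule mult_mono'[OF P(4) Q(4)]) auto
  qed
qed

lemma poly_limit_sum:
  "(\<And>i. i \<in> I \<Longrightarrow> poly_limit (f i)) \<Longrightarrow> poly_limit (\<lambda>w. \<Sum>i\<in>I. f i w)"
  by (induction I rule: infinite_finite_induct) (auto intro!: poly_limit_add)

text \<open>The Taylor polynomials of the sine are bounded, uniformly in the degree, by the
  exponential series of the absolute value of the argument.\<close>

lemma poly_limit_sin:
  fixes i :: "'n::finite"
  shows "poly_limit (\<lambda>w :: real ^ 'n. sin (l * (w $ i)))"
  unfolding poly_limit_def
proof (intro exI conjI allI)
  show "exp_bounded (\<lambda>w :: real ^ 'n. exp (\<bar>l\<bar> * norm w))" by (rule exp_boundedI[of _ 1 "\<bar>l\<bar>"]) simp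
  fix N :: nat and w :: "real ^ 'n"
  show "real_polynomial_function (\<lambda>w :: real ^ 'n. \<Sum>n<N. sin_coeff n * (l * (w $ i)) ^ n)"
    by (intro real_polynomial_function_sum real_polynomial_function.intros(2,4)
         real_polynomial_function_power real_polynomial_function.intros(1)[OF bounded_linear_vec_nth]) auto
  show "(\<lambda>N. \<Sum>n<N. sin_coeff n * (l * (w $ i)) ^ n) \<longlonglongrightarrow> sin (l * (w $ i))"
    using sin_converges[of "l * (w $ i)"] by (simp add: sums_def)
  let ?x = "\<bar>l * (w $ i)\<bar>"
  have "\<bar>\<Sum>n<N. sin_coeff n * (l * (w $ i)) ^ n\<bar> \<le> (\<Sum>n<N. inverse (fact n) * ?x ^ n)"
  proof (rule sum_abs[THEN order_trans], rule sum_mono)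
    fix n
    have "\<bar>sin_coeff n :: real\<bar> \<le> inverse (fact n)" by (simp add: sin_coeff_def abs_mult power_abs divide_inverse)
    then show "\<bar>sin_coeff n * (l * (w $ i)) ^ n\<bar> \<le> inverse (fact n) * ?x ^ n"
      unfolding abs_mult[of "sin_coeff n"] power_abs by (rule mult_right_mono) simp
  qed
  also have "\<dots> \<le> exp ?x"
    unfolding exp_def using summable_exp[of ?x] by (auto intro!: sum_le_suminf)
  also have "\<dots> \<le> exp (\<bar>l\<bar> * norm w)"
    using component_le_norm_cart[of w i] by (simp add: abs_mult mult_left_mono)
  finally show "\<bar>\<Sum>n<N. sin_coeff n * (l * (w $ i)) ^ n\<bar> \<le> exp (\<bar>l\<bar> * norm w)" .
qed

lemma bounded_linear_cart_expand:
  fixes f :: "real ^ 'n \<Rightarrow> real"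
  assumes "bounded_linear f" shows "f w = (\<Sum>i\<in>UNIV. f (axis i 1) * (w $ i))"
proof -
  have "w = (\<Sum>i\<in>UNIV. (w $ i) *\<^sub>R axis i 1)"
    using basis_expansion[of w] by (simp add: scalar_mult_eq_scaleR)
  then have "f w = f (\<Sum>i\<in>UNIV. (w $ i) *\<^sub>R axis i 1)" by simp
  then show ?thesis
    using assms by (simp add: linear_sum bounded_linear.linear linear_cmul mult.commute)
qed

lemma poly_limit_poly_sin:
  fixes p :: "real ^ 'n \<Rightarrow> real"
  assumes "real_polynomial_function p"
  shows "poly_limit (\<lambda>w. p (\<chi> i. sin (l * (w $ i))))"
  using assms
proof (induction rule: real_polynomial_function.induct)
  case (linear f)
  show ?case
    unfolding bounded_linear_cart_expand[OF linear, of "\<chi> i. sin (l * (_ $ i))"]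
    by (intro poly_limit_sum poly_limit_mult poly_limit_const) (simp add: poly_limit_sin)
qed (auto intro: poly_limit_add poly_limit_mult)

text \<open>
  After the substitution \<open>x \<mapsto> sin (x / L)\<close> the Weierstrass approximation on the unit cube is
  controlled on the whole space, and polynomials in sines are dominated limits of their Taylor
  polynomials.
\<close>

lemma poly_approximable_bounded_continuous:
  fixes f :: "real ^ 'n \<Rightarrow> real"
  assumes cont: "continuous_on UNIV f" and B: "\<And>w. \<bar>f w\<bar> \<le> B"
  shows "poly_approximable f"
proof -
  define I :: "(real ^ 'n) set" where "I = cbox (\<chi> i. -1) (\<chi> i. 1)"
  define L where "L n = real (Suc n)" for n
  have L: "L n > 0" for n by (simp add: L_def)
  have I: "s \<in> I \<longleftrightarrow> (\<forall>i. -1 \<le> s $ i \<and> s $ i \<le> 1)" for s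
    by (simp add: I_def mem_box_cart)
  have "\<exists>p. real_polynomial_function p \<and> (\<forall>s\<in>I. \<bar>f (\<chi> i. L n * arcsin (s $ i)) - p s\<bar> < 1 / L n)" for n
  proof -
    have "continuous_on I (\<lambda>s. f (\<chi> i. L n * arcsin (s $ i)))"
    proof (rule continuous_on_compose2[OF cont])
      show "continuous_on I (\<lambda>s. \<chi> i. L n * arcsin (s $ i))"
        by (intro continuous_on_vec_lambda continuous_on_mult continuous_on_const continuous_on_arcsin continuous_intros)
           (auto simp: I)
    qed auto
    from Stone_Weierstrass_real_polynomial_function[OF _ this, of "1 / L n"]
    show ?thesis using L[of n] by (metis I_def compact_cbox zero_less_divide_1_iff)
  qed
  then obtain p where p: "\<And>n. real_polynomial_function (p n)"
    "\<And>n s. s \<in> I \<Longrightarrow> \<bar>f (\<chi> i. L n * arcsin (s $ i)) - p n s\<bar> < 1 / L n" by metis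
  define q where "q n w = p n (\<chi> i. sin (1 / L n * (w $ i)))" for n w
  have q: "poly_approximable (q n)" for n
    unfolding q_def by (intro poly_limit_poly_approximable poly_limit_poly_sin p)
  \<comment> \<open>\<open>arcsin\<close> after \<open>sin\<close> is the identity only near the
    origin, but everywhere it produces some point of the space, so the bound \<open>B\<close> on
    \<open>f\<close> still controls \<open>q n w\<close>.\<close>
  have qB: "\<bar>q n w\<bar> \<le> B + 1" for n w
  proof -
    have "(\<chi> i. sin (1 / L n * (w $ i))) \<in> I" by (simp add: I)
    from p(2)[OF this, of n] have "\<bar>f (\<chi> i. L n * arcsin (sin (1 / L n * (w $ i)))) - q n w\<bar> < 1 / L n"
      by (simp add: q_def)
    moreover have "1 / L n \<le> 1" by (simp add: L_def)
    ultimately show ?thesis using B[of "\<chi> i. L n * arcsin (sin (1 / L n * (w $ i)))"] by linarith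
  qed
  have lim: "(\<lambda>n. q n w) \<longlonglongrightarrow> f w" for w
  proof -
    obtain m where m: "norm w < real m" using reals_Archimedean2 by blast
    have ev: "eventually (\<lambda>n. \<bar>q n w - f w\<bar> \<le> 1 / L n) sequentially"
    proof (rule eventually_sequentiallyI)
      fix n assume "m \<le> n"
      \<comment> \<open>As \<open>L n\<close> exceeds the norm of \<open>w\<close>, the rescaled
        coordinates lie between -1 and 1, inside the range where \<open>arcsin\<close> inverts
        \<open>sin\<close>; the approximated value is then exactly \<open>f w\<close>.\<close>
      have "L n * arcsin (sin (1 / L n * (w $ i))) = w $ i" for i
      proof -
        have "\<bar>w $ i\<bar> \<le> L n" using component_le_norm_cart[of w i] m \<open>m \<le> n\<close> by (simp add: L_def)
        then have "\<bar>1 / L n * (w $ i)\<bar> \<le> 1" using L[of n] by (simp add: abs_mult divide_le_eq)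
        moreover have "1 \<le> pi / 2" using pi_gt3 by simp
        ultimately have "arcsin (sin (1 / L n * (w $ i))) = 1 / L n * (w $ i)"
          by (intro arcsin_sin) linarith+
        then show ?thesis using L[of n] by simp
      qed
      then have "(\<chi> i. L n * arcsin (sin (1 / L n * (w $ i)))) = w" by (simp add: vec_eq_iff)
      moreover have "(\<chi> i. sin (1 / L n * (w $ i))) \<in> I" by (simp add: I)
      ultimately show "\<bar>q n w - f w\<bar> \<le> 1 / L n"
        using p(2)[of "\<chi> i. sin (1 / L n * (w $ i))" n] by (simp add: q_def abs_minus_commute)
    qed
    have "(\<lambda>n. 1 / L n) \<longlonglongrightarrow> 0" unfolding L_def using LIMSEQ_inverse_real_of_nat by (simp add: inverse_eq_divide)
    from Lim_null_comparison[OF _ this, of "\<lambda>n. q n w - f w"] ev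
    show ?thesis by (simp add: LIM_zero_iff)
  qed
  have f: "f \<in> borel_measurable borel" by (rule borel_measurable_continuous_onI[OF cont])
  show ?thesis
    by (rule poly_approximable_dominated[OF f q square_integrable_const qB lim])
qed

lemma poly_approximable_closed_indicator:
  fixes C :: "(real ^ 'n) set"
  assumes "closed C" shows "poly_approximable (indicator C)"
proof (cases "C = {}")
  \<comment> \<open>By convention \<open>infdist w {} = 0\<close>, so the cut-offs of the other case
    would converge to 1 instead of 0 here.\<close>
  case True
  then have "indicator C = (\<lambda>_ :: real ^ 'n. 0 :: real)" by auto
  then show ?thesis by simp
next
  case False
  define g where "g n w = max 0 (1 - real n * infdist w C)" for n :: nat and w
  have g: "poly_approximable (g n)" for n
  proof (rule poly_approximable_bounded_continuous)
    show "continuous_on UNIV (g n)" unfolding g_def by (intro continuous_intros)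
    show "\<bar>g n w\<bar> \<le> 1" for w using infdist_nonneg[of w C] by (simp add: g_def)
  qed
  have lim: "(\<lambda>n. g n w) \<longlonglongrightarrow> indicator C w" for w
  proof (cases "w \<in> C")
    case True
    then show ?thesis by (simp add: g_def)
  next
    case nC: False
    then have d: "0 < infdist w C"
      using infdist_pos_not_in_closed[OF assms False nC] by simp
    obtain m where m: "1 / infdist w C < real m" using reals_Archimedean2 by blast
    have "eventually (\<lambda>n. g n w = 0) sequentially"
    proof (rule eventually_sequentiallyI)
      fix n assume "m \<le> n"
      then have "1 / infdist w C < real n" using m by linarith
      then show "g n w = 0" using d by (simp add: g_def divide_less_eq max_def)
    qed
    then have "(\<lambda>n. g n w) \<longlonglongrightarrow> 0" by (rule tendsto_eventually)
    then show ?thesis using nC by simp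
  qed
  have "\<bar>g n w\<bar> \<le> 1" for n w using infdist_nonneg[of w C] by (simp add: g_def)
  from poly_approximable_dominated[OF _ g square_integrable_const this lim] show ?thesis
    using assms by simp
qed

text \<open>A Dynkin argument: linearity and closure under dominated limits handle complements and
  disjoint unions, while the generating closed sets supply the stability under
  intersections.\<close>

lemma poly_approximable_indicator:
  fixes A :: "(real ^ 'n) set"
  assumes "A \<in> sets borel" shows "poly_approximable (indicator A)"
proof -
  have b: "sets borel = sigma_sets UNIV (Collect (closed :: (real ^ 'n) set \<Rightarrow> bool))"
    by (simp add: borel_eq_closed)
  have "Int_stable (Collect (closed :: (real ^ 'n) set \<Rightarrow> bool))" by (auto simp: Int_stable_def)
  moreover have "Collect closed \<subseteq> Pow (UNIV :: (real ^ 'n) set)" by simp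
  moreover have "A \<in> sigma_sets UNIV (Collect closed)" using assms b by simp
  ultimately show ?thesis
  proof (induction rule: sigma_sets_induct_disjoint)
    case (compl A)
    have "poly_approximable (\<lambda>w. 1 + (-1) * indicator A w)"
      by (intro poly_approximable_add poly_approximable_cmult poly_approximable_const compl)
    moreover have "(\<lambda>w. 1 + (-1) * indicator A w) = (indicator (UNIV - A) :: real ^ 'n \<Rightarrow> real)"
      by (auto simp: indicator_def)
    ultimately show ?case by simp
  next
    case (union A)
    have eq: "indicator (\<Union>i<n. A i) = (\<lambda>w. \<Sum>i<n. indicator (A i) w :: real)" for n
      using union(1) by (intro ext indicator_UN_disjoint) (auto simp: disjoint_family_on_def)
    have g: "poly_approximable (indicator (\<Union>i<n. A i))" for n
      unfolding eq by (intro poly_approximable_sum union)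
    have m: "(indicator (\<Union>i. A i) :: real ^ 'n \<Rightarrow> real) \<in> borel_measurable borel"
      using union(2) b by (intro borel_measurable_indicator sets.countable_UN) auto
    show ?case
      by (rule poly_approximable_dominated[OF m g square_integrable_const[of 1] _ LIMSEQ_indicator_UN])
         (simp add: indicator_def)
  next
    case empty
    show ?case by (rule poly_approximable_closed_indicator) simp
  qed (auto intro: poly_approximable_closed_indicator)
qed

lemma poly_dense:
  fixes f :: "real ^ 'n \<Rightarrow> real"
  assumes f: "square_integrable f" shows "poly_approximable f"
proof -
  have [measurable]: "f \<in> borel_measurable borel" using f by auto
  obtain F where F: "\<And>i. simple_function gaussian (F i)" "\<And>x. (\<lambda>i. F i x) \<longlonglongrightarrow> f x"
    "\<And>i x. \<bar>F i x\<bar> \<le> 2 * \<bar>f x\<bar>"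
    using borel_measurable_implies_sequence_metric[of f gaussian 0] by auto
  have "poly_approximable (F i)" for i
  proof -
    have fin: "finite (range (F i))" using F(1)[of i] by (simp add: simple_function_def)
    have meas: "F i -` {y} \<in> sets borel" for y
    proof (cases "y \<in> range (F i)")
      case True then show ?thesis using F(1)[of i] by (auto simp: simple_function_def)
    next
      case False
      then have "F i -` {y} = {}" by auto
      then show ?thesis by simp
    qed
    have "F i = (\<lambda>w. \<Sum>y\<in>range (F i). y * indicator (F i -` {y}) w)"
    proof
      fix w
      have "(\<Sum>y\<in>range (F i). y * indicator (F i -` {y}) w) = (\<Sum>y\<in>range (F i). if y = F i w then F i w else 0)"
        by (intro sum.cong) (auto simp: indicator_def)
      then show "F i w = (\<Sum>y\<in>range (F i). y * indicator (F i -` {y}) w)" using fin by simp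
    qed
    moreover have "poly_approximable (\<lambda>w. \<Sum>y\<in>range (F i). y * indicator (F i -` {y}) w)"
      by (intro poly_approximable_sum poly_approximable_cmult poly_approximable_indicator meas)
    ultimately show ?thesis by simp
  qed
  moreover have "square_integrable (\<lambda>w. 2 * \<bar>f w\<bar>)"
    using f by (intro square_integrable_cmult) (auto simp: square_integrable_def)
  ultimately show ?thesis
    by (intro poly_approximable_dominated[OF _ _ _ F(3) F(2)]) auto
qed

section \<open>Polynomials as combinations of Hermite tensors\<close>

lemma hermite_combI: "hermite_comb N (\<lambda>w. \<Sum>is | length is < N. c is * hermite_tensor is w)"
  unfolding hermite_comb_def by blast

lemma finite_lists_length_less [simp, intro]: "finite {is :: 'n::finite list. length is < N}"
proof -
  have "{is :: 'n list. length is < N} = (\<Union>k<N. {is. length is = k})" by auto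
  then show ?thesis by simp
qed

lemma hermite_comb_mono:
  assumes "hermite_comb N p" "N \<le> M" shows "hermite_comb M p"
proof -
  obtain c where p: "p = (\<lambda>w. \<Sum>is | length is < N. c is * hermite_tensor is w)"
    using assms(1) unfolding hermite_comb_def by blast
  have "p = (\<lambda>w. \<Sum>is | length is < M. (if length is < N then c is else 0) * hermite_tensor is w)"
    unfolding p by (intro ext sum.mono_neutral_cong_left) (use assms(2) in auto)
  then show ?thesis unfolding hermite_comb_def by (intro exI)
qed

lemma hermite_comb_zero [simp]: "hermite_comb N (\<lambda>_. 0)"
  using hermite_combI[of N "\<lambda>_. 0"] by simp

lemma hermite_comb_add:
  assumes "hermite_comb N p" "hermite_comb N q" shows "hermite_comb N (\<lambda>w. p w + q w)"
proof -
  obtain c d where "p = (\<lambda>w. \<Sum>is | length is < N. c is * hermite_tensor is w)"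
    "q = (\<lambda>w. \<Sum>is | length is < N. d is * hermite_tensor is w)"
    using assms unfolding hermite_comb_def by blast
  then show ?thesis
    using hermite_combI[of N "\<lambda>is. c is + d is"] by (simp add: distrib_right sum.distrib)
qed

lemma hermite_comb_cmult:
  assumes "hermite_comb N p" shows "hermite_comb N (\<lambda>w. k * p w)"
proof -
  obtain c where "p = (\<lambda>w. \<Sum>is | length is < N. c is * hermite_tensor is w)"
    using assms unfolding hermite_comb_def by blast
  then show ?thesis
    using hermite_combI[of N "\<lambda>is. k * c is"] by (simp add: sum_distrib_left mult.assoc)
qed

lemma hermite_comb_sum:
  "(\<And>i. i \<in> I \<Longrightarrow> hermite_comb N (f i)) \<Longrightarrow> hermite_comb N (\<lambda>w. \<Sum>i\<in>I. f i w)"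
  by (induction I rule: infinite_finite_induct) (auto intro: hermite_comb_add)

lemma hermite_comb_hermite_tensor:
  assumes "length is < N" shows "hermite_comb N (hermite_tensor (is :: 'n::finite list))"
proof -
  have "(\<Sum>js | length js < N. (if js = is then 1 else 0) * hermite_tensor js w) = hermite_tensor is w" for w
  proof -
    have "(\<Sum>js | length js < N. (if js = is then 1 else 0) * hermite_tensor js w)
      = (\<Sum>js | length js < N. if js = is then hermite_tensor is w else 0)"
      by (intro sum.cong) auto
    also have "\<dots> = hermite_tensor is w" using assms by simp
    finally show ?thesis .
  qed
  then show ?thesis using hermite_combI[of N "\<lambda>js. if js = is then 1 else 0"] by (simp cong: if_cong)
qed

lemma hermite_comb_wiener_ito: "k < N \<Longrightarrow> hermite_comb N (wiener_ito k u)"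
  unfolding wiener_ito_eq[abs_def]
  by (intro hermite_comb_sum hermite_comb_cmult hermite_comb_hermite_tensor) auto

lemma hermite_comb_times_nth:
  fixes p :: "real ^ 'n \<Rightarrow> real"
  assumes "hermite_comb N p" shows "hermite_comb (Suc N) (\<lambda>w. w $ i * p w)"
proof -
  obtain c where p: "p = (\<lambda>w. \<Sum>is | length is < N. c is * hermite_tensor is w)"
    using assms unfolding hermite_comb_def by blast
  have "w $ i * (c is * hermite_tensor is w)
    = c is * (hermite_tensor (i # is) w + real (count_list is i) * hermite_tensor (remove1 i is) w)" for w "is"
    by (simp add: hermite_tensor_Cons)
  then have "(\<lambda>w. w $ i * p w) = (\<lambda>w. \<Sum>is | length is < N.
      c is * (hermite_tensor (i # is) w + real (count_list is i) * hermite_tensor (remove1 i is) w))"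
    unfolding p sum_distrib_left by (simp only:)
  moreover have "hermite_comb (Suc N) \<dots>"
    by (intro hermite_comb_sum hermite_comb_cmult hermite_comb_add hermite_comb_hermite_tensor)
       (auto simp: length_remove1)
  ultimately show ?thesis by simp
qed

text \<open>Carrying an arbitrary combination \<open>q\<close> through the induction turns the case
  of a product into two successive multiplications. Only coordinate functions need work, and for
  these the Hermite recurrence is read backwards.\<close>

lemma hermite_comb_times_polynomial:
  fixes p q :: "real ^ 'n \<Rightarrow> real"
  assumes "real_polynomial_function p" "hermite_comb N q"
  shows "\<exists>M. hermite_comb M (\<lambda>w. p w * q w)"
  using assms
proof (induction arbitrary: N q rule: real_polynomial_function.induct)
  case (linear f)
  have "(\<lambda>w. f w * q w) = (\<lambda>w. \<Sum>i\<in>UNIV. f (axis i 1) * (w $ i * q w))"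
    by (rule ext, subst bounded_linear_cart_expand[OF linear(1)]) (simp add: sum_distrib_right mult.assoc)
  moreover have "hermite_comb (Suc N) \<dots>"
    by (intro hermite_comb_sum hermite_comb_cmult hermite_comb_times_nth linear)
  ultimately show ?case by metis
next
  case (const c)
  then show ?case using hermite_comb_cmult by blast
next
  case (add f g)
  obtain M1 M2 where "hermite_comb M1 (\<lambda>w. f w * q w)" "hermite_comb M2 (\<lambda>w. g w * q w)"
    using add by blast
  then have "hermite_comb (max M1 M2) (\<lambda>w. f w * q w + g w * q w)"
    by (intro hermite_comb_add) (auto elim: hermite_comb_mono)
  then show ?case by (auto simp: distrib_right)
next
  case (mult f g)
  obtain M where "hermite_comb M (\<lambda>w. g w * q w)" using mult by blast
  from mult.IH(1)[OF this] show ?case by (simp add: mult.assoc)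
qed

lemma real_polynomial_function_hermite_comb:
  fixes p :: "real ^ 'n \<Rightarrow> real"
  assumes "real_polynomial_function p" shows "\<exists>N. hermite_comb N p"
proof -
  have "hermite_comb 1 (hermite_tensor ([] :: 'n list))" by (rule hermite_comb_hermite_tensor) simp
  then have "hermite_comb 1 (\<lambda>_ :: real ^ 'n. 1)" by (simp add: hermite_tensor_Nil[abs_def])
  from hermite_comb_times_polynomial[OF assms this] show ?thesis by simp
qed

lemma hermite_comb_square_integrable: "hermite_comb N p \<Longrightarrow> square_integrable p"
  unfolding hermite_comb_def by (auto intro!: square_integrable_sum square_integrable_cmult)

section \<open>Chaos expansions and Parseval's identity\<close>

abbreviation chaos_sum :: "'n::finite chaos \<Rightarrow> nat \<Rightarrow> real ^ 'n \<Rightarrow> real" where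
  "chaos_sum u N w \<equiv> (\<Sum>k<N. wiener_ito k u w)"

lemma symmetric_chaos_coeff: "symmetric_tensors (chaos_coeff f)"
proof -
  have "hermite_tensor is = hermite_tensor js" if "mset is = mset js" for "is" js :: "'a list"
    unfolding hermite_tensor_def[abs_def] count_mset_eq_count_list[symmetric] that ..
  then show ?thesis
    unfolding symmetric_tensors_def chaos_coeff_def by (metis mset_eq_length)
qed

lemma square_integrable_chaos_sum [simp, intro]: "square_integrable (chaos_sum u N)"
  by (intro square_integrable_sum) auto

lemma integral_chaos_sum_hermite_tensor:
  fixes "is" :: "'n::finite list"
  assumes "symmetric_tensors u" "length is < N"
  shows "(\<E> w. chaos_sum u N w * hermite_tensor is w) = fact (length is) * u is"
proof -
  have "(\<E> w. chaos_sum u N w * hermite_tensor is w)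
      = (\<Sum>k<N. (\<E> w. hermite_tensor is w * wiener_ito k u w))"
    unfolding sum_distrib_right
    by (subst Bochner_Integration.integral_sum) (auto intro!: square_integrable_mult_integrable simp: mult.commute)
  also have "\<dots> = (\<Sum>k<N. if k = length is then fact (length is) * u is else 0)"
    by (intro sum.cong) (auto simp: integral_hermite_tensor_wiener_ito[OF assms(1)])
  finally show ?thesis using assms(2) by simp
qed

lemma chaos_sum_orthogonal:
  fixes f :: "real ^ 'n \<Rightarrow> real"
  assumes f: "square_integrable f" and q: "hermite_comb N q"
  shows "(\<E> w. (f w - chaos_sum (chaos_coeff f) N w) * q w) = 0"
proof -
  let ?r = "\<lambda>w. f w - chaos_sum (chaos_coeff f) N w"
  obtain c where c: "q = (\<lambda>w. \<Sum>is | length is < N. c is * hermite_tensor is w)"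
    using q unfolding hermite_comb_def by blast
  have r: "square_integrable ?r" using f by (intro square_integrable_diff) auto
  have 0: "(\<E> w. ?r w * hermite_tensor is w) = 0" if "length is < N" for "is"
  proof -
    have "(\<E> w. ?r w * hermite_tensor is w) =
        (\<E> w. f w * hermite_tensor is w) - (\<E> w. chaos_sum (chaos_coeff f) N w * hermite_tensor is w)"
      unfolding left_diff_distrib
      by (intro Bochner_Integration.integral_diff square_integrable_mult_integrable f) auto
    also have "\<dots> = 0"
      unfolding integral_chaos_sum_hermite_tensor[OF symmetric_chaos_coeff that] by (simp add: chaos_coeff_def)
    finally show ?thesis .
  qed
  have "(\<E> w. ?r w * q w) = (\<E> w. (\<Sum>is | length is < N. c is * (?r w * hermite_tensor is w)))"
    unfolding c sum_distrib_left by (simp only: mult.left_commute)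
  also have "\<dots> = (\<Sum>is | length is < N. c is * (\<E> w. ?r w * hermite_tensor is w))"
    by (subst Bochner_Integration.integral_sum) (auto intro!: square_integrable_mult_integrable r)
  finally show ?thesis by (simp add: 0)
qed

text \<open>Pythagoras: \<open>f - p\<close> splits into the residual, orthogonal to all
  combinations of order below \<open>N\<close>, and \<open>?q\<close>, itself such a combination.
  This transfers the density of the polynomials to the chaos sums.\<close>

lemma chaos_sum_best_approximation:
  fixes f :: "real ^ 'n \<Rightarrow> real"
  assumes f: "square_integrable f" and p: "hermite_comb N p"
  shows "(\<E> w. (f w - chaos_sum (chaos_coeff f) N w)\<^sup>2) \<le> (\<E> w. (f w - p w)\<^sup>2)"
proof -
  let ?S = "chaos_sum (chaos_coeff f) N" and ?q = "\<lambda>w. chaos_sum (chaos_coeff f) N w + (-1) * p w"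
  have q: "hermite_comb N ?q"
    by (intro hermite_comb_add hermite_comb_cmult p hermite_comb_sum hermite_comb_wiener_ito) auto
  have r: "square_integrable (\<lambda>w. f w - ?S w)" using f by (intro square_integrable_diff) auto
  note sq = hermite_comb_square_integrable[OF q]
  have "(\<E> w. (f w - p w)\<^sup>2)
      = (\<E> w. (f w - ?S w)\<^sup>2 + (?q w)\<^sup>2 + 2 * ((f w - ?S w) * ?q w))"
    by (rule Bochner_Integration.integral_cong) (auto simp: power2_eq_square algebra_simps)
  also have "\<dots> = (\<E> w. (f w - ?S w)\<^sup>2) + (\<E> w. (?q w)\<^sup>2)
      + 2 * (\<E> w. (f w - ?S w) * ?q w)"
    using square_integrableD(2)[OF r] square_integrableD(2)[OF sq] square_integrable_mult_integrable[OF r sq]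
    by (simp del: mult_minus1)
  also have "(\<E> w. (f w - ?S w) * ?q w) = 0" by (rule chaos_sum_orthogonal[OF f q])
  finally show ?thesis by simp
qed

lemma chaos_sum_converges:
  fixes f :: "real ^ 'n \<Rightarrow> real"
  assumes f: "square_integrable f"
  shows "(\<lambda>N. (\<E> w. (f w - chaos_sum (chaos_coeff f) N w)\<^sup>2)) \<longlonglongrightarrow> 0"
proof (rule LIMSEQ_I)
  fix \<epsilon> :: real assume "\<epsilon> > 0"
  then obtain p where p: "real_polynomial_function p" "(\<E> w. (f w - p w)\<^sup>2) < \<epsilon>"
    using poly_dense[OF f] unfolding poly_approximable_def by blast
  obtain M where M: "hermite_comb M p" using real_polynomial_function_hermite_comb[OF p(1)] by blast
  show "\<exists>no. \<forall>N\<ge>no. norm ((\<E> w. (f w - chaos_sum (chaos_coeff f) N w)\<^sup>2) - 0) < \<epsilon>"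
  proof (intro exI allI impI)
    fix N assume "M \<le> N"
    from chaos_sum_best_approximation[OF f hermite_comb_mono[OF M this]] p(2)
    have "(\<E> w. (f w - chaos_sum (chaos_coeff f) N w)\<^sup>2) < \<epsilon>" by linarith
    then show "norm ((\<E> w. (f w - chaos_sum (chaos_coeff f) N w)\<^sup>2) - 0) < \<epsilon>" by simp
  qed
qed

lemma nn_integral_square_eq:
  assumes "square_integrable f"
  shows "(\<E>\<^sup>+ w. ennreal ((f w)\<^sup>2)) = ennreal (\<E> w. (f w)\<^sup>2)"
  using square_integrableD(2)[OF assms] by (intro nn_integral_eq_integral) auto

lemma tendsto_integral_mult:
  assumes f: "\<And>N. square_integrable (\<lambda>w. f w - s N w)" and f': "square_integrable f" and g: "square_integrable g"
    and lim: "(\<lambda>N::nat. (\<E> w. (f w - s N w)\<^sup>2)) \<longlonglongrightarrow> 0"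
  shows "(\<lambda>N. (\<E> w. s N w * g w)) \<longlonglongrightarrow> (\<E> w. f w * g w)"
proof -
  let ?C = "(\<E> w. (g w)\<^sup>2)"
  have b: "norm ((\<E> w. s N w * g w) - (\<E> w. f w * g w)) \<le> sqrt ((\<E> w. (f w - s N w)\<^sup>2) * ?C)" for N
  proof -
    have fg: "integrable gaussian (\<lambda>w. f w * g w)" "integrable gaussian (\<lambda>w. (f w - s N w) * g w)"
      using square_integrable_mult_integrable[OF f' g] square_integrable_mult_integrable[OF f g] by auto
    have "(\<E> w. s N w * g w) = (\<E> w. f w * g w - (f w - s N w) * g w)"
      by (simp add: left_diff_distrib)
    also have "\<dots> = (\<E> w. f w * g w) - (\<E> w. (f w - s N w) * g w)"
      using fg by (rule Bochner_Integration.integral_diff)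
    finally have "norm ((\<E> w. s N w * g w) - (\<E> w. f w * g w)) = \<bar>(\<E> w. (f w - s N w) * g w)\<bar>"
      by simp
    also have "\<dots> \<le> sqrt ((\<E> w. (f w - s N w)\<^sup>2) * ?C)"
      by (rule real_le_rsqrt) (use integral_cauchy_schwarz[OF f g] in simp)
    finally show ?thesis .
  qed
  have "(\<lambda>N. sqrt ((\<E> w. (f w - s N w)\<^sup>2) * ?C)) \<longlonglongrightarrow> sqrt (0 * ?C)"
    by (intro tendsto_intros lim)
  then have "(\<lambda>N. sqrt ((\<E> w. (f w - s N w)\<^sup>2) * ?C)) \<longlonglongrightarrow> 0" by simp
  from Lim_null_comparison[OF always_eventually this, OF allI, OF b]
  show ?thesis by (rule LIM_zero_cancel)
qed

text \<open>Tested against a fixed Hermite tensor, the partial sums of any expansion become constant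
  once \<open>N\<close> exceeds its order, so mean square convergence determines each coefficient.
  This justifies the definite description in \<open>chaos_of\<close>.\<close>

lemma has_chaos_expansion_unique:
  fixes f :: "real ^ 'n \<Rightarrow> real"
  assumes f: "square_integrable f" and u: "has_chaos_expansion f u"
  shows "u = chaos_coeff f"
proof
  fix "is" :: "'n list"
  have sym: "symmetric_tensors u" using u by (simp add: has_chaos_expansion_def)
  have d: "square_integrable (\<lambda>w. f w - chaos_sum u N w)" for N
    using f by (intro square_integrable_diff) auto
  have "(\<lambda>N. ennreal (\<E> w. (f w - chaos_sum u N w)\<^sup>2)) \<longlonglongrightarrow> ennreal 0"
    using u unfolding has_chaos_expansion_def nn_integral_square_eq[OF d] by simp
  then have "(\<lambda>N. (\<E> w. (f w - chaos_sum u N w)\<^sup>2)) \<longlonglongrightarrow> 0"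
    by (rule tendsto_ennrealD) auto
  from tendsto_integral_mult[OF d f _ this, of "hermite_tensor is"]
  have "(\<lambda>N. (\<E> w. chaos_sum u N w * hermite_tensor is w)) \<longlonglongrightarrow> (\<E> w. f w * hermite_tensor is w)"
    by simp
  moreover have "(\<lambda>N. (\<E> w. chaos_sum u N w * hermite_tensor is w)) \<longlonglongrightarrow> fact (length is) * u is"
    by (rule tendsto_eventually, rule eventually_sequentiallyI[of "Suc (length is)"])
       (simp add: integral_chaos_sum_hermite_tensor[OF sym])
  ultimately have "(\<E> w. f w * hermite_tensor is w) = fact (length is) * u is"
    by (rule LIMSEQ_unique)
  then show "u is = chaos_coeff f is" by (simp add: chaos_coeff_def)
qed

lemma has_chaos_expansion_chaos_coeff:
  fixes f :: "real ^ 'n \<Rightarrow> real"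
  assumes f: "square_integrable f" shows "has_chaos_expansion f (chaos_coeff f)"
proof -
  have d: "square_integrable (\<lambda>w. f w - chaos_sum (chaos_coeff f) N w)" for N
    using f by (intro square_integrable_diff) auto
  show ?thesis
    unfolding has_chaos_expansion_def nn_integral_square_eq[OF d]
    using tendsto_ennrealI[OF chaos_sum_converges[OF f]] square_integrableD(1)[OF f] symmetric_chaos_coeff by auto
qed

lemma chaos_of_eq: "square_integrable f \<Longrightarrow> chaos_of f = chaos_coeff f"
  unfolding chaos_of_def
  by (rule the_equality) (auto intro: has_chaos_expansion_chaos_coeff has_chaos_expansion_unique)

text \<open>Only \<open>f\<close> is expanded: integrating its component of order \<open>k\<close>
  against \<open>g\<close> produces the coefficients of \<open>g\<close> by their definition, and
  Cauchy-Schwarz allows the passage to the limit. No double series arises.\<close>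

theorem chaos_parseval:
  fixes f g :: "real ^ 'n \<Rightarrow> real"
  assumes f: "square_integrable f" and g: "square_integrable g"
  shows "(\<lambda>k. fact k * tensor_inner k (chaos_coeff f) (chaos_coeff g)) sums (\<E> w. f w * g w)"
proof -
  have eq: "(\<E> w. wiener_ito k (chaos_coeff f) w * g w)
      = fact k * tensor_inner k (chaos_coeff f) (chaos_coeff g)" for k
  proof -
    have "(\<E> w. wiener_ito k (chaos_coeff f) w * g w)
      = (\<E> w. (\<Sum>is | length is = k. chaos_coeff f is * (g w * hermite_tensor is w)))"
      unfolding wiener_ito_eq sum_distrib_right by (simp only: mult_ac)
    also have "\<dots> = (\<Sum>is | length is = k. chaos_coeff f is * (\<E> w. g w * hermite_tensor is w))"
      by (subst Bochner_Integration.integral_sum) (auto intro!: square_integrable_mult_integrable g)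
    also have "\<dots> = fact k * tensor_inner k (chaos_coeff f) (chaos_coeff g)"
      unfolding tensor_inner_def sum_distrib_left
      by (intro sum.cong) (auto simp: chaos_coeff_def[of g])
    finally show ?thesis .
  qed
  have d: "square_integrable (\<lambda>w. f w - chaos_sum (chaos_coeff f) N w)" for N
    using f by (intro square_integrable_diff) auto
  have "(\<E> w. chaos_sum (chaos_coeff f) N w * g w)
      = (\<Sum>k<N. fact k * tensor_inner k (chaos_coeff f) (chaos_coeff g))" for N
    unfolding sum_distrib_right
    by (subst Bochner_Integration.integral_sum) (auto intro!: square_integrable_mult_integrable g simp: eq)
  then show ?thesis
    using tendsto_integral_mult[OF d f g chaos_sum_converges[OF f]] by (simp add: sums_def)
qed

section \<open>The Ornstein-Uhlenbeck operator and the Poincare inequality\<close>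

lemma distr_gaussian_mix':
  fixes a b :: real
  assumes "a\<^sup>2 + b\<^sup>2 = 1" "a \<noteq> 0"
  shows "distr (gaussian \<Otimes>\<^sub>M gaussian) borel (\<lambda>z :: (real ^ 'n) \<times> (real ^ 'n). a *\<^sub>R fst z + b *\<^sub>R snd z) = gaussian"
  using distr_gaussian_mix[OF assms, where 'n='n] by (simp add: case_prod_beta')

lemma nn_integral_gaussian_mix:
  fixes a b :: real and f :: "real ^ 'n \<Rightarrow> ennreal"
  assumes "a\<^sup>2 + b\<^sup>2 = 1" "a \<noteq> 0" and [measurable]: "f \<in> borel_measurable borel"
  shows "(\<integral>\<^sup>+z. f (a *\<^sub>R fst z + b *\<^sub>R snd z) \<partial>(gaussian \<Otimes>\<^sub>M gaussian)) = (\<E>\<^sup>+ w. f w)"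
  by (subst (2) distr_gaussian_mix'[OF assms(1,2), symmetric], subst nn_integral_distr) auto

lemma integral_gaussian_mix:
  fixes a b :: real and f :: "real ^ 'n \<Rightarrow> real"
  assumes "a\<^sup>2 + b\<^sup>2 = 1" "a \<noteq> 0" and [measurable]: "f \<in> borel_measurable borel"
  shows "(\<integral>z. f (a *\<^sub>R fst z + b *\<^sub>R snd z) \<partial>(gaussian \<Otimes>\<^sub>M gaussian)) = (\<E> w. f w)"
  by (subst (2) distr_gaussian_mix'[OF assms(1,2), symmetric], subst integral_distr) auto

lemma integrable_gaussian_mix:
  fixes a b :: real and f :: "real ^ 'n \<Rightarrow> real"
  assumes "a\<^sup>2 + b\<^sup>2 = 1" "a \<noteq> 0" and [measurable]: "f \<in> borel_measurable borel"
    and "integrable gaussian f"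
  shows "integrable (gaussian \<Otimes>\<^sub>M gaussian) (\<lambda>z. f (a *\<^sub>R fst z + b *\<^sub>R snd z))"
proof -
  have "integrable (distr (gaussian \<Otimes>\<^sub>M gaussian) borel (\<lambda>z :: (real ^ 'n) \<times> (real ^ 'n). a *\<^sub>R fst z + b *\<^sub>R snd z)) f"
    unfolding distr_gaussian_mix'[OF assms(1,2)] by fact
  then show ?thesis by (subst (asm) integrable_distr_eq) auto
qed

lemma AE_gaussian_mix_square_integrable:
  fixes a b :: real and f :: "real ^ 'n \<Rightarrow> real"
  assumes ab: "a\<^sup>2 + b\<^sup>2 = 1" "a \<noteq> 0" and f: "square_integrable f"
  shows "AE x in gaussian. square_integrable (\<lambda>y. f (a *\<^sub>R x + b *\<^sub>R y))"
proof -
  have [measurable]: "f \<in> borel_measurable borel" using f by auto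
  have "integrable (gaussian \<Otimes>\<^sub>M gaussian) (\<lambda>z. (f (a *\<^sub>R fst z + b *\<^sub>R snd z))\<^sup>2)"
    by (rule integrable_gaussian_mix[OF ab, of "\<lambda>w. (f w)\<^sup>2"]) (use f in auto)
  from gaussian_pair.AE_integrable_fst'[OF this] show ?thesis
    unfolding square_integrable_def by eventually_elim simp
qed

text \<open>The reflection \<open>(x, y) \<mapsto> (a x + b y, b x - a y)\<close> interchanges \<open>x\<close> and \<open>a x + b y\<close>.\<close>

lemma gaussian_mix_symmetric:
  fixes a b :: real and h :: "(real ^ 'n) \<times> (real ^ 'n) \<Rightarrow> real"
  assumes ab: "a\<^sup>2 + b\<^sup>2 = 1" "a \<noteq> 0" and [measurable]: "h \<in> borel_measurable (borel \<Otimes>\<^sub>M borel)"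
  shows "(\<integral>z. h (a *\<^sub>R fst z + b *\<^sub>R snd z, fst z) \<partial>(gaussian \<Otimes>\<^sub>M gaussian)) =
    (\<integral>z. h (fst z, a *\<^sub>R fst z + b *\<^sub>R snd z) \<partial>(gaussian \<Otimes>\<^sub>M gaussian))"
proof -
  let ?P = "gaussian \<Otimes>\<^sub>M gaussian :: ((real ^ 'n) \<times> (real ^ 'n)) measure"
  let ?T = "\<lambda>(x :: real ^ 'n, y). (a *\<^sub>R x + b *\<^sub>R y, b *\<^sub>R x - a *\<^sub>R y)"
  have inv: "a *\<^sub>R (a *\<^sub>R x + b *\<^sub>R y) + b *\<^sub>R (b *\<^sub>R x - a *\<^sub>R y) = x" for x y :: "real ^ 'n"
  proof -
    have "a *\<^sub>R (a *\<^sub>R x + b *\<^sub>R y) + b *\<^sub>R (b *\<^sub>R x - a *\<^sub>R y) = (a\<^sup>2 + b\<^sup>2) *\<^sub>R x"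
      by (simp add: algebra_simps power2_eq_square)
    then show ?thesis using ab by simp
  qed
  have "(\<integral>z. h (fst z, a *\<^sub>R fst z + b *\<^sub>R snd z) \<partial>?P) =
      (\<integral>z. h (fst z, a *\<^sub>R fst z + b *\<^sub>R snd z) \<partial>distr ?P (borel \<Otimes>\<^sub>M borel) ?T)"
    by (simp add: distr_gaussian_reflect[OF ab])
  also have "\<dots> = (\<integral>z. h (a *\<^sub>R fst z + b *\<^sub>R snd z, fst z) \<partial>?P)"
    by (subst integral_distr) (auto simp: case_prod_beta' inv)
  finally show ?thesis by simp
qed

lemma Gamma_fun_measurable [measurable]:
  assumes [measurable]: "f \<in> borel_measurable borel"
  shows "Gamma_fun a f \<in> borel_measurable borel"
  unfolding Gamma_fun_def by measurable

lemma Gamma_fun_coeff: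
  fixes a :: real
  assumes "0 < a" "a \<le> 1" shows "a\<^sup>2 + (sqrt (1 - a\<^sup>2))\<^sup>2 = 1" "a \<noteq> 0"
  using assms by (auto simp: abs_square_le_1)

text \<open>Jensen's inequality on almost every section, obtained from Cauchy-Schwarz against the
  constant 1.\<close>

lemma square_integrable_conditional:
  fixes f :: "(real ^ 'n) \<times> (real ^ 'n) \<Rightarrow> real"
  assumes [measurable]: "f \<in> borel_measurable (gaussian \<Otimes>\<^sub>M gaussian)"
    and f: "integrable (gaussian \<Otimes>\<^sub>M gaussian) (\<lambda>z. (f z)\<^sup>2)"
  shows "square_integrable (\<lambda>x. (\<E> y. f (x, y)))"
  unfolding square_integrable_def
proof
  have m: "f \<in> borel_measurable (borel \<Otimes>\<^sub>M borel)"
    using assms(1) by (simp cong: measurable_cong_sets sets_pair_measure_cong)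
  note [measurable] = m
  show "(\<lambda>x. (\<E> y. f (x, y))) \<in> borel_measurable borel" by measurable
  show "integrable gaussian (\<lambda>x. (\<E> y. f (x, y))\<^sup>2)"
  proof (rule Bochner_Integration.integrable_bound[OF gaussian_pair.integrable_fst'[OF f]])
    show "AE x in gaussian. norm ((\<E> y. f (x, y))\<^sup>2) \<le> norm (\<E> y. (f (x, y))\<^sup>2)"
      using gaussian_pair.AE_integrable_fst'[OF f]
    proof eventually_elim
      case (elim x)
      then have "square_integrable (\<lambda>y. f (x, y))" unfolding square_integrable_def by simp
      from integral_cauchy_schwarz[OF this square_integrable_const[of 1]]
      have "(\<E> y. f (x, y))\<^sup>2 \<le> (\<E> y. (f (x, y))\<^sup>2)"
        using gaussian.prob_space[where 'n='n] by simp
      then show ?case by simp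
    qed
  qed measurable
qed

lemma square_integrable_Gamma_fun:
  fixes f :: "real ^ 'n \<Rightarrow> real"
  assumes a: "0 < a" "a \<le> 1" and f: "square_integrable f"
  shows "square_integrable (Gamma_fun a f)"
proof -
  have [measurable]: "f \<in> borel_measurable borel" using f by auto
  have "integrable (gaussian \<Otimes>\<^sub>M gaussian) (\<lambda>z. (f (a *\<^sub>R fst z + sqrt (1 - a\<^sup>2) *\<^sub>R snd z))\<^sup>2)"
    by (rule integrable_gaussian_mix[OF Gamma_fun_coeff[OF a], of "\<lambda>w. (f w)\<^sup>2"]) (use f in auto)
  from square_integrable_conditional[OF _ this] show ?thesis
    unfolding Gamma_fun_def[abs_def] by simp
qed

lemma integral_Gamma_fun:
  fixes f :: "real ^ 'n \<Rightarrow> real"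
  assumes a: "0 < a" "a \<le> 1" and [measurable]: "f \<in> borel_measurable borel" and f: "integrable gaussian f"
  shows "(\<E> w. Gamma_fun a f w) = (\<E> w. f w)"
  using gaussian_pair.integral_fst'[OF integrable_gaussian_mix[OF Gamma_fun_coeff[OF a] _ f]]
    integral_gaussian_mix[OF Gamma_fun_coeff[OF a], of f]
  by (simp add: Gamma_fun_def)

text \<open>Both sides are integrals over the pair of \<open>x\<close> and \<open>a x + b y\<close>,
  which is exchangeable by the reflection. Square integrability of both functions makes the product
  integrable, as Fubini requires.\<close>

lemma Gamma_fun_symmetric:
  fixes f g :: "real ^ 'n \<Rightarrow> real"
  assumes a: "0 < a" "a \<le> 1" and f: "square_integrable f" and g: "square_integrable g"
  shows "(\<E> w. Gamma_fun a f w * g w) = (\<E> w. f w * Gamma_fun a g w)"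
proof -
  note ab = Gamma_fun_coeff[OF a]
  let ?b = "sqrt (1 - a\<^sup>2)" and ?P = "gaussian \<Otimes>\<^sub>M gaussian :: ((real ^ 'n) \<times> (real ^ 'n)) measure"
  have fm [measurable]: "f \<in> borel_measurable borel" "g \<in> borel_measurable borel" using f g by auto
  have int: "integrable ?P (\<lambda>z. p (a *\<^sub>R fst z + ?b *\<^sub>R snd z) * q (fst z))"
    if p: "square_integrable p" and q: "square_integrable q" for p q :: "real ^ 'n \<Rightarrow> real"
  proof (rule Bochner_Integration.integrable_bound)
    have [measurable]: "p \<in> borel_measurable borel" "q \<in> borel_measurable borel" using p q by auto
    have "integrable ?P (\<lambda>z. (p (a *\<^sub>R fst z + ?b *\<^sub>R snd z))\<^sup>2)"
      by (rule integrable_gaussian_mix[OF ab, of "\<lambda>w. (p w)\<^sup>2"]) (use p in auto)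
    moreover have "integrable ?P (\<lambda>z. (q (1 *\<^sub>R fst z + 0 *\<^sub>R snd z))\<^sup>2)"
      by (rule integrable_gaussian_mix[of 1 0 "\<lambda>w. (q w)\<^sup>2"]) (use q in auto)
    ultimately show "integrable ?P (\<lambda>z. ((p (a *\<^sub>R fst z + ?b *\<^sub>R snd z))\<^sup>2 + (q (fst z))\<^sup>2) / 2)" by simp
    show "(\<lambda>z. p (a *\<^sub>R fst z + ?b *\<^sub>R snd z) * q (fst z)) \<in> borel_measurable ?P" by measurable
    show "AE z in ?P. norm (p (a *\<^sub>R fst z + ?b *\<^sub>R snd z) * q (fst z))
        \<le> norm (((p (a *\<^sub>R fst z + ?b *\<^sub>R snd z))\<^sup>2 + (q (fst z))\<^sup>2) / 2)"
      using abs_mult_le_squares[of "p _" "q _"] by (intro AE_I2) simp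
  qed
  have "(\<E> w. Gamma_fun a f w * g w) = (\<integral>z. f (a *\<^sub>R fst z + ?b *\<^sub>R snd z) * g (fst z) \<partial>?P)"
    using gaussian_pair.integral_fst'[OF int[OF f g]] by (simp add: Gamma_fun_def)
  also have "\<dots> = (\<integral>z. f (fst z) * g (a *\<^sub>R fst z + ?b *\<^sub>R snd z) \<partial>?P)"
    using gaussian_mix_symmetric[OF ab, of "\<lambda>z. f (fst z) * g (snd z)"] by simp
  also have "\<dots> = (\<E> w. f w * Gamma_fun a g w)"
    using gaussian_pair.integral_fst'[OF int[OF g f]] by (simp add: Gamma_fun_def mult.commute)
  finally show ?thesis .
qed

text \<open>Symmetry moves the operator to the Hermite tensor, where Mehler's formula diagonalises
  it.\<close>

lemma chaos_coeff_Gamma_fun: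
  fixes f :: "real ^ 'n \<Rightarrow> real"
  assumes a: "0 < a" "a \<le> 1" and f: "square_integrable f"
  shows "chaos_coeff (Gamma_fun a f) = Gamma_chaos a (chaos_coeff f)"
proof
  fix "is" :: "'n list"
  have "Gamma_fun a (hermite_tensor is) = (\<lambda>w. a ^ length is * hermite_tensor is w)"
    unfolding Gamma_fun_def[abs_def] using hermite_tensor_mehler[OF Gamma_fun_coeff(1)[OF a]] by blast
  then have "(\<E> w. Gamma_fun a f w * hermite_tensor is w)
      = (\<E> w. a ^ length is * (f w * hermite_tensor is w))"
    using Gamma_fun_symmetric[OF a f, of "hermite_tensor is"] by (simp add: mult.left_commute)
  then show "chaos_coeff (Gamma_fun a f) is = Gamma_chaos a (chaos_coeff f) is"
    by (simp add: chaos_coeff_def Gamma_chaos_def)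
qed

lemma chaos_coeff_cong_AE:
  assumes "f \<in> borel_measurable borel" "g \<in> borel_measurable borel" "AE w in gaussian. f w = g w"
  shows "chaos_coeff f = chaos_coeff g"
proof
  fix "is"
  have "(\<E> w. f w * hermite_tensor is w) = (\<E> w. g w * hermite_tensor is w)"
    using assms by (intro integral_cong_AE) (auto elim: eventually_mono)
  then show "chaos_coeff f is = chaos_coeff g is" by (simp add: chaos_coeff_def)
qed

lemma tensor_inner_Suc:
  "tensor_inner (Suc k) u v = (\<Sum>i\<in>UNIV. tensor_inner k (\<lambda>is. u (i # is)) (\<lambda>is. v (i # is)))"
proof -
  have "(\<Sum>i\<in>UNIV. tensor_inner k (\<lambda>is. u (i # is)) (\<lambda>is. v (i # is)))
      = (\<Sum>z\<in>UNIV \<times> {is. length is = k}. u (fst z # snd z) * v (fst z # snd z))"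
    unfolding tensor_inner_def by (simp add: sum.cartesian_product case_prod_beta')
  also have "\<dots> = tensor_inner (Suc k) u v"
    unfolding tensor_inner_def
    by (rule sum.reindex_bij_witness[of _ "\<lambda>is. (hd is, tl is)" "\<lambda>z. fst z # snd z"])
       (auto simp: length_Suc_conv)
  finally show ?thesis by simp
qed

text \<open>In chaos coordinates the three integrals weight the same nonnegative numbers
  \<open>fact k * T k\<close> by \<open>1\<close>, \<open>\<alpha> ^ k\<close> and \<open>k\<close>;
  the last weight is the eigenvalue of the number operator.\<close>

theorem gaussian_poincare:
  fixes g :: "real ^ 'n \<Rightarrow> real"
  assumes \<alpha>: "0 < \<alpha>" "\<alpha> \<le> 1" and g: "square_integrable g" and D: "\<And>i. square_integrable (D i)"
    and ibp: "\<And>i is. (\<E> w. D i w * hermite_tensor is w) = (\<E> w. g w * hermite_tensor (i # is) w)"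
  shows "(\<E> w. (g w)\<^sup>2) - (\<E> w. (Gamma_fun (sqrt \<alpha>) g w)\<^sup>2)
    \<le> (1 - \<alpha>) * (\<Sum>i\<in>UNIV. (\<E> w. (D i w)\<^sup>2))"
proof -
  let ?u = "chaos_coeff g"
  define T where "T k = tensor_inner k ?u ?u" for k
  have T: "0 \<le> T k" for k unfolding T_def tensor_inner_def by (intro sum_nonneg) simp
  have sa: "0 < sqrt \<alpha>" "sqrt \<alpha> \<le> 1" using \<alpha> by auto
  have A: "(\<lambda>k. fact k * T k) sums (\<E> w. (g w)\<^sup>2)"
    using chaos_parseval[OF g g] by (simp add: T_def power2_eq_square)
  have "tensor_inner k (Gamma_chaos (sqrt \<alpha>) ?u) (Gamma_chaos (sqrt \<alpha>) ?u) = \<alpha> ^ k * T k" for k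
    unfolding T_def tensor_inner_def Gamma_chaos_def sum_distrib_left
  proof (rule sum.cong[OF refl], clarify)
    fix "is" :: "'n list"
    have "sqrt \<alpha> ^ length is * sqrt \<alpha> ^ length is = \<alpha> ^ length is"
      using \<alpha> by (simp add: power_mult_distrib[symmetric])
    then show "sqrt \<alpha> ^ length is * ?u is * (sqrt \<alpha> ^ length is * ?u is) = \<alpha> ^ length is * (?u is * ?u is)"
      by (simp add: mult.assoc mult.left_commute)
  qed
  then have B: "(\<lambda>k. fact k * (\<alpha> ^ k * T k)) sums (\<E> w. (Gamma_fun (sqrt \<alpha>) g w)\<^sup>2)"
    using chaos_parseval[OF square_integrable_Gamma_fun[OF sa g] square_integrable_Gamma_fun[OF sa g]]
    by (simp add: chaos_coeff_Gamma_fun[OF sa g] power2_eq_square)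
  have Di: "chaos_coeff (D i) is = real (Suc (length is)) * ?u (i # is)" for i "is"
    unfolding chaos_coeff_def ibp by simp
  \<comment> \<open>Summing over the index \<open>i\<close> split off from the list assembles the
    tensors of order \<open>k\<close> into the one of order \<open>Suc k\<close>. One of the two
    factors \<open>Suc k\<close> is then used to complete \<open>fact (Suc k)\<close>.\<close>
  have "(\<Sum>i\<in>UNIV. tensor_inner k (chaos_coeff (D i)) (chaos_coeff (D i))) = (real (Suc k))\<^sup>2 * T (Suc k)" for k
    unfolding T_def tensor_inner_Suc sum_distrib_left
    by (rule sum.cong[OF refl]) (simp add: tensor_inner_def Di sum_distrib_left power2_eq_square mult_ac)
  then have "(\<lambda>k. fact k * ((real (Suc k))\<^sup>2 * T (Suc k))) sums (\<Sum>i\<in>UNIV. (\<E> w. (D i w)\<^sup>2))"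
    using sums_sum[of UNIV "\<lambda>i k. fact k * tensor_inner k (chaos_coeff (D i)) (chaos_coeff (D i))", OF chaos_parseval[OF D D]]
    by (simp add: sum_distrib_left[symmetric] power2_eq_square)
  then have "(\<lambda>k. real (Suc k) * (fact (Suc k) * T (Suc k))) sums (\<Sum>i\<in>UNIV. (\<E> w. (D i w)\<^sup>2))"
    by (simp add: power2_eq_square mult_ac)
  \<comment> \<open>The index shift is free, since the factor \<open>real k\<close> annihilates the
    term at 0.\<close>
  then have "(\<lambda>k. real k * (fact k * T k)) sums (\<Sum>i\<in>UNIV. (\<E> w. (D i w)\<^sup>2))"
    by (rule sums_Suc_imp[rotated]) simp
  note C = sums_mult[OF this, of "1 - \<alpha>"]
  show ?thesis
  proof (rule sums_le[OF _ sums_diff[OF A B] C])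
    fix k
    \<comment> \<open>Bernoulli's inequality with increment \<open>\<alpha> - 1 \<ge> -1\<close>;
      equality holds for \<open>k = 0\<close> and \<open>k = 1\<close>.\<close>
    have "1 + real k * (\<alpha> - 1) \<le> (1 + (\<alpha> - 1)) ^ k"
      using \<alpha> by (intro Bernoulli_inequality) simp
    then have "1 - \<alpha> ^ k \<le> (1 - \<alpha>) * real k" by (simp add: algebra_simps)
    then have "(1 - \<alpha> ^ k) * (fact k * T k) \<le> (1 - \<alpha>) * real k * (fact k * T k)"
      using T by (intro mult_right_mono) auto
    then show "fact k * T k - fact k * (\<alpha> ^ k * T k) \<le> (1 - \<alpha>) * (real k * (fact k * T k))"
      by (simp add: algebra_simps)
  qed
qed

section \<open>Translates of functions with integrable power 3 + \<alpha>\<close>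

lemma young_square_powr:
  fixes x e :: real
  assumes \<alpha>: "0 < \<alpha>" and e: "0 \<le> e"
  shows "x\<^sup>2 * e \<le> \<bar>x\<bar> powr (3 + \<alpha>) + e powr ((3 + \<alpha>) / (1 + \<alpha>))"
proof -
  define p where "p = (3 + \<alpha>) / 2"
  define q where "q = (3 + \<alpha>) / (1 + \<alpha>)"
  have p: "p > 1" and q: "q > 1" and pq: "1 / p + 1 / q = 1"
    using \<alpha> by (simp_all add: p_def q_def add_divide_distrib[symmetric])
  have "x\<^sup>2 * e \<le> (x\<^sup>2) powr p / p + e powr q / q"
    using e by (intro Youngs_inequality p q pq) auto
  also have "\<dots> \<le> (x\<^sup>2) powr p + e powr q"
    using p q by (intro add_mono) (auto simp: divide_le_eq mult_le_cancel_left1)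
  also have "(x\<^sup>2) powr p = \<bar>x\<bar> powr (3 + \<alpha>)"
  proof -
    have "x\<^sup>2 = \<bar>x\<bar> powr 2" by simp
    then have "(x\<^sup>2) powr p = \<bar>x\<bar> powr (2 * p)" by (simp only: powr_powr)
    also have "2 * p = 3 + \<alpha>" by (simp add: p_def)
    finally show ?thesis .
  qed
  finally show ?thesis by (simp add: q_def)
qed

text \<open>
  Young's inequality with the exponents \<open>(3 + \<alpha>) / 2\<close> and \<open>q = (3 + \<alpha>) / (1 + \<alpha>)\<close>: the \<open>q\<close>-norm of
  \<open>shift_density y\<close> is \<open>exp (|y|\<^sup>2 / (1 + \<alpha>))\<close>.
\<close>

lemma nn_integral_shift_square_le:
  fixes f :: "real ^ 'n \<Rightarrow> real"
  assumes \<alpha>: "0 < \<alpha>" and s: "0 < s" and [measurable]: "f \<in> borel_measurable borel"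
  shows "(\<E>\<^sup>+ w. ennreal ((f (w + y))\<^sup>2)) \<le> ennreal (exp ((norm y)\<^sup>2 / (1 + \<alpha>))) *
    (ennreal (s\<^sup>2 / s powr (3 + \<alpha>)) * (\<E>\<^sup>+ w. ennreal (\<bar>f w\<bar> powr (3 + \<alpha>))) + ennreal (s\<^sup>2))"
proof -
  define q where "q = (3 + \<alpha>) / (1 + \<alpha>)"
  define K where "K = exp ((norm y)\<^sup>2 / (1 + \<alpha>))"
  have K: "K > 0" by (simp add: K_def)
  have q1: "q - 1 = 2 / (1 + \<alpha>)" using \<alpha> by (simp add: q_def field_simps)
  have b: "(shift_density y w / K) powr q = shift_density (q *\<^sub>R y) w" for w
  proof -
    have "shift_density y w / K = exp (w \<bullet> y - (norm y)\<^sup>2 / 2 - (norm y)\<^sup>2 / (1 + \<alpha>))"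
      by (simp add: shift_density_def K_def exp_diff)
    then have "(shift_density y w / K) powr q = exp (q * (w \<bullet> y - (norm y)\<^sup>2 / 2 - (norm y)\<^sup>2 / (1 + \<alpha>)))"
      by (simp add: powr_def)
    also have "q * (w \<bullet> y - (norm y)\<^sup>2 / 2 - (norm y)\<^sup>2 / (1 + \<alpha>)) = w \<bullet> (q *\<^sub>R y) - (norm (q *\<^sub>R y))\<^sup>2 / 2"
    proof -
      have "(norm y)\<^sup>2 / (1 + \<alpha>) = (norm y)\<^sup>2 * (q - 1) / 2" unfolding q1 by (metis mult.commute mult_2 nonzero_mult_div_cancel_left times_divide_eq_right zero_neq_numeral)
      then show ?thesis by (simp add: power_mult_distrib power2_eq_square field_simps)
    qed
    finally show ?thesis by (simp add: shift_density_def)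
  qed
  \<comment> \<open>Young's inequality is applied to \<open>f w / s\<close> and
    \<open>shift_density y w / K\<close>, where \<open>K\<close> normalises the last term to mean 1.
    The scale \<open>s\<close> stays free: the last term contributes only \<open>K * s^2\<close>, so
    a small \<open>s\<close> makes the whole bound small once \<open>f\<close> is small.\<close>
  have pt: "shift_density y w * (f w)\<^sup>2 \<le> K * (s\<^sup>2 / s powr (3 + \<alpha>) * \<bar>f w\<bar> powr (3 + \<alpha>) + s\<^sup>2 * shift_density (q *\<^sub>R y) w)" for w
  proof -
    have "(f w / s)\<^sup>2 * (shift_density y w / K) \<le> \<bar>f w / s\<bar> powr (3 + \<alpha>) + (shift_density y w / K) powr q"
      unfolding q_def using K by (intro young_square_powr \<alpha>) auto
    also have "\<bar>f w / s\<bar> powr (3 + \<alpha>) = \<bar>f w\<bar> powr (3 + \<alpha>) / s powr (3 + \<alpha>)"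
      using s by (simp add: powr_divide abs_divide)
    finally have "(f w / s)\<^sup>2 * (shift_density y w / K) \<le> \<bar>f w\<bar> powr (3 + \<alpha>) / s powr (3 + \<alpha>) + shift_density (q *\<^sub>R y) w"
      by (simp add: b)
    then have "K * s\<^sup>2 * ((f w / s)\<^sup>2 * (shift_density y w / K)) \<le> K * s\<^sup>2 * (\<bar>f w\<bar> powr (3 + \<alpha>) / s powr (3 + \<alpha>) + shift_density (q *\<^sub>R y) w)"
      using K by (intro mult_left_mono) auto
    moreover have "K * s\<^sup>2 * ((f w / s)\<^sup>2 * (shift_density y w / K)) = shift_density y w * (f w)\<^sup>2"
      using K s by (simp add: power_divide)
    ultimately show ?thesis by (simp add: distrib_left mult_ac)
  qed
  have "(\<E>\<^sup>+ w. ennreal ((f (w + y))\<^sup>2)) = (\<E>\<^sup>+ w. ennreal (shift_density y w) * ennreal ((f w)\<^sup>2))"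
    by (rule nn_integral_gaussian_shift) simp
  also have "\<dots> \<le> (\<E>\<^sup>+ w. ennreal K * (ennreal (s\<^sup>2 / s powr (3 + \<alpha>)) * ennreal (\<bar>f w\<bar> powr (3 + \<alpha>))
      + ennreal (s\<^sup>2) * ennreal (shift_density (q *\<^sub>R y) w)))"
    using pt K s by (intro nn_integral_mono)
      (simp add: ennreal_mult'[symmetric] ennreal_plus[symmetric] ennreal_leI del: ennreal_plus)
  also have "\<dots> = ennreal K * (ennreal (s\<^sup>2 / s powr (3 + \<alpha>)) * (\<E>\<^sup>+ w. ennreal (\<bar>f w\<bar> powr (3 + \<alpha>)))
      + ennreal (s\<^sup>2) * (\<E>\<^sup>+ w. ennreal (shift_density (q *\<^sub>R y) w)))"
    by (simp add: nn_integral_cmult nn_integral_add)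
  also have "(\<E>\<^sup>+ w. ennreal (shift_density (q *\<^sub>R y) w)) = 1"
    by (subst nn_integral_eq_integral) (auto simp: shift_density_integrable shift_density_integral)
  finally show ?thesis by (simp add: K_def)
qed

section \<open>Sobolev functions and their translates\<close>

lemma smooth_compact_supportD:
  assumes "smooth_compact_support m \<phi>"
  shows "\<And>x y. (\<And>i. i < m \<Longrightarrow> x i = y i) \<Longrightarrow> \<phi> x = \<phi> y"
    and "continuous_on UNIV \<phi>"
    and "\<And>i. i < m \<Longrightarrow> continuous_on UNIV (partial i \<phi>)"
    and "\<And>i x. i < m \<Longrightarrow> ((\<lambda>t. \<phi> (x(i := t))) has_real_derivative partial i \<phi> x) (at (x i))"
    and "\<exists>R. \<forall>x. \<phi> x \<noteq> 0 \<longrightarrow> (\<forall>i<m. \<bar>x i\<bar> \<le> R)"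
proof -
  note * = assms[unfolded smooth_compact_support_def]
  show "\<And>x y. (\<And>i. i < m \<Longrightarrow> x i = y i) \<Longrightarrow> \<phi> x = \<phi> y" using * by blast
  from * have I: "set I \<subseteq> {..<m} \<Longrightarrow> continuous_on UNIV (foldr partial I \<phi>) \<and>
        (\<forall>i<m. \<forall>x. (\<lambda>t. foldr partial I \<phi> (x(i := t))) differentiable (at (x i)))" for I by blast
  show "continuous_on UNIV \<phi>" using I[of "[]"] by simp
  show "\<And>i. i < m \<Longrightarrow> continuous_on UNIV (partial i \<phi>)" using I[of "[_]"] by simp
  show "\<And>i x. i < m \<Longrightarrow> ((\<lambda>t. \<phi> (x(i := t))) has_real_derivative partial i \<phi> x) (at (x i))"
    using I[of "[]"] unfolding partial_def by (simp add: DERIV_deriv_iff_real_differentiable)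
  show "\<exists>R. \<forall>x. \<phi> x \<noteq> 0 \<longrightarrow> (\<forall>i<m. \<bar>x i\<bar> \<le> R)" using * by blast
qed

lemma partial_local:
  assumes "smooth_compact_support m \<phi>" "i < m" "\<And>j. j < m \<Longrightarrow> x j = y j"
  shows "partial i \<phi> x = partial i \<phi> y"
proof -
  have "\<phi> (x(i := t)) = \<phi> (y(i := t))" for t
    by (rule smooth_compact_supportD(1)[OF assms(1)]) (use assms in auto)
  then show ?thesis using assms by (simp add: partial_def)
qed

text \<open>Beyond the box, \<open>\<phi>\<close> vanishes along a whole neighbourhood of
  \<open>x i\<close>: for \<open>j = i\<close> because the complement of an interval is open,
  otherwise because the coordinate \<open>j\<close> stays out of range while coordinate
  \<open>i\<close> moves.\<close>

lemma partial_support: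
  assumes \<phi>: "smooth_compact_support m \<phi>" and i: "i < m"
    and R: "\<And>x j. \<phi> x \<noteq> 0 \<Longrightarrow> j < m \<Longrightarrow> \<bar>x j\<bar> \<le> R"
    and x: "partial i \<phi> x \<noteq> 0" and j: "j < m"
  shows "\<bar>x j\<bar> \<le> R"
proof (rule ccontr)
  assume nR: "\<not> \<bar>x j\<bar> \<le> R"
  have "eventually (\<lambda>t. \<phi> (x(i := t)) = 0) (nhds (x i))"
  proof (cases "j = i")
    case True
    have "open {t. R < \<bar>t :: real\<bar>}" by (intro open_Collect_less continuous_intros)
    then have "eventually (\<lambda>t. t \<in> {t. R < \<bar>t\<bar>}) (nhds (x i))"
      using nR True by (intro eventually_nhds_in_open) auto
    then show ?thesis
      by eventually_elim (use R[of "x(i := _)" i] i in fastforce)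
  next
    case False
    then show ?thesis using R[of "x(i := _)" j] j nR by (intro always_eventually) fastforce
  qed
  then have "deriv (\<lambda>t. \<phi> (x(i := t))) (x i) = deriv (\<lambda>_. 0) (x i)"
    by (intro deriv_cong_ev) auto
  then show False using x by (simp add: partial_def)
qed

text \<open>Coordinates from \<open>m\<close> on are unrestricted, so the support need not be
  compact in the sequence space. Resetting them to 0 does not change \<open>\<psi>\<close> and puts
  the point into a product of compact sets, compact by Tychonoff.\<close>

lemma continuous_compact_support_bounded:
  fixes \<psi> :: "(nat \<Rightarrow> real) \<Rightarrow> real"
  assumes c: "continuous_on UNIV \<psi>" and loc: "\<And>x y. (\<And>i. i < m \<Longrightarrow> x i = y i) \<Longrightarrow> \<psi> x = \<psi> y"
    and R: "\<And>x i. \<psi> x \<noteq> 0 \<Longrightarrow> i < m \<Longrightarrow> \<bar>x i\<bar> \<le> R"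
  shows "\<exists>B. \<forall>x. \<bar>\<psi> x\<bar> \<le> B"
proof -
  define K where "K = PiE UNIV (\<lambda>i. if i < m then {-R..R} else {0})"
  have "compactin (product_topology (\<lambda>_. euclidean) UNIV) K"
    unfolding K_def compactin_PiE by auto
  then have "compact K" by (simp add: euclidean_product_topology)
  then have "compact (\<psi> ` K)"
    using c by (intro compact_continuous_image) (auto intro: continuous_on_subset)
  then obtain B where B: "\<And>z. z \<in> \<psi> ` K \<Longrightarrow> \<bar>z\<bar> \<le> B"
    using compact_imp_bounded bounded_iff by (metis real_norm_def)
  have "\<bar>\<psi> x\<bar> \<le> max B 0" for x
  proof (cases "\<psi> x = 0")
    case False
    define y where "y i = (if i < m then x i else 0)" for i
    have "\<psi> y = \<psi> x" by (rule loc) (simp add: y_def)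
    moreover have "y \<in> K" using R[OF False] by (force simp: K_def y_def abs_le_iff)
    ultimately have "\<bar>\<psi> x\<bar> \<le> B" by (metis B imageI)
    then show ?thesis by simp
  qed simp
  then show ?thesis by blast
qed

text \<open>Smoothness is given by partial derivatives on a sequence space, so the chain rule along
  a line is proved by releasing one coordinate at a time. Each step needs a total derivative in two
  real variables only, for which one partial derivative at the point and a continuous second one
  suffice.\<close>

lemma smooth_chain_rule_aux:
  fixes a b :: "nat \<Rightarrow> real"
  assumes \<phi>: "smooth_compact_support m \<phi>" and "k \<le> m"
  shows "((\<lambda>t. \<phi> (\<lambda>i. if i < k then a i + t * b i else x i)) has_real_derivative
     (\<Sum>j<k. b j * partial j \<phi> (\<lambda>i. if i < k then a i + t * b i else x i))) (at t)"
  using \<open>k \<le> m\<close>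
proof (induction k arbitrary: x)
  case (Suc k)
  then have k: "k < m" by simp
  \<comment> \<open>\<open>s\<close> moves the first \<open>k\<close> coordinates along the line and
    \<open>y\<close> is the coordinate \<open>k\<close> on its own; restricting to
    \<open>y = a k + s * b k\<close> recovers the path for \<open>Suc k\<close>.\<close>
  define z where "z s y = (\<lambda>i. if i < k then a i + s * b i else if i = k then y else x i)" for s y
  let ?y = "a k + t * b k"
  have z1: "z s y = (\<lambda>i. if i < k then a i + s * b i else (x(k := y)) i)" for s y
    by (auto simp: z_def)
  have z2: "z s (a k + s * b k) = (\<lambda>i. if i < Suc k then a i + s * b i else x i)" for s
    by (auto simp: z_def less_Suc_eq)
  have zc: "continuous_on UNIV (\<lambda>p. z (fst p) (snd p))"
  proof (rule continuous_on_coordinatewise_then_product)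
    fix i show "continuous_on UNIV (\<lambda>p. z (fst p) (snd p) i)"
      unfolding z_def by (cases "i < k"; cases "i = k") (auto intro!: continuous_intros)
  qed
  have pc: "continuous_on UNIV (\<lambda>p. partial k \<phi> (z (fst p) (snd p)))"
    by (rule continuous_on_compose2[OF smooth_compact_supportD(3)[OF \<phi> k] zc]) auto
  let ?S = "\<Sum>j<k. b j * partial j \<phi> (z t ?y)"
  have "((\<lambda>(s, y). \<phi> (z s y)) has_derivative
     (\<lambda>(ts, ty). ts * ?S + blinfun_apply (blinfun_scaleR_left (partial k \<phi> (z t ?y))) ty)) (at (t, ?y) within UNIV \<times> UNIV)"
  proof (rule has_derivative_partialsI)
    show "((\<lambda>s. \<phi> (z s ?y)) has_derivative (\<lambda>ts. ts * ?S)) (at t within UNIV)"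
      using Suc.IH[of "x(k := ?y)"] k unfolding z1 has_field_derivative_def by (simp add: mult.commute[of _ "sum _ _"])
    show "((\<lambda>y. \<phi> (z s y)) has_derivative blinfun_apply (blinfun_scaleR_left (partial k \<phi> (z s y)))) (at y within UNIV)" for s y
    proof -
      have "(z s y)(k := u) = z s u" for u by (auto simp: z_def)
      moreover have "z s y k = y" by (simp add: z_def)
      ultimately have "((\<lambda>u. \<phi> (z s u)) has_real_derivative partial k \<phi> (z s y)) (at y)"
        using smooth_compact_supportD(4)[OF \<phi> k, of "z s y"] by simp
      then show ?thesis by (simp add: has_field_derivative_def mult.commute[of _ "partial _ _ _"])
    qed
    have "continuous_on UNIV (\<lambda>p. blinfun_scaleR_left (partial k \<phi> (z (fst p) (snd p))))"
      by (rule bounded_linear.continuous_on[OF bounded_linear_blinfun_scaleR_left pc])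
    then show "continuous (at (t, ?y) within UNIV \<times> UNIV) (\<lambda>(s, y). blinfun_scaleR_left (partial k \<phi> (z s y)))"
      by (simp add: continuous_on_eq_continuous_within case_prod_beta')
  qed auto
  then have D: "((\<lambda>p. \<phi> (z (fst p) (snd p))) has_derivative
     (\<lambda>p. fst p * ?S + snd p * partial k \<phi> (z t ?y))) (at (t, ?y))"
    by (simp add: case_prod_beta')
  have "((\<lambda>s. (s, a k + s * b k)) has_derivative (\<lambda>h. (h, h * b k))) (at t)"
    by (auto intro!: derivative_eq_intros)
  from has_derivative_compose[OF this D]
  have "((\<lambda>s. \<phi> (z s (a k + s * b k))) has_derivative (\<lambda>h. h * ?S + h * b k * partial k \<phi> (z t ?y))) (at t)"
    by simp
  then have "((\<lambda>s. \<phi> (z s (a k + s * b k))) has_real_derivative (\<Sum>j<Suc k. b j * partial j \<phi> (z t ?y))) (at t)"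
  proof -
    have "(\<lambda>h. h * ?S + h * b k * partial k \<phi> (z t ?y)) = (*) (\<Sum>j<Suc k. b j * partial j \<phi> (z t ?y))"
      by (auto simp: fun_eq_iff algebra_simps)
    then show ?thesis
      using \<open>((\<lambda>s. \<phi> (z s (a k + s * b k))) has_derivative _) (at t)\<close> by (simp add: has_field_derivative_def)
  qed
  then show ?case unfolding z2 .
qed simp

lemma smooth_chain_rule:
  fixes h :: "nat \<Rightarrow> real ^ 'n"
  assumes \<phi>: "smooth_compact_support m \<phi>"
  shows "((\<lambda>t. \<phi> (cyl_coords m h (w + t *\<^sub>R e))) has_real_derivative
     (\<Sum>j<m. partial j \<phi> (cyl_coords m h w) *\<^sub>R h j) \<bullet> e) (at 0)"
proof -
  have c: "cyl_coords m h (w + t *\<^sub>R e) = (\<lambda>i. if i < m then w \<bullet> h i + t * (e \<bullet> h i) else 0)" for t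
    by (auto simp: cyl_coords_def inner_add_left)
  have c0: "(\<lambda>i. if i < m then w \<bullet> h i + 0 * (e \<bullet> h i) else 0) = cyl_coords m h w"
    by (simp add: cyl_coords_def cong: if_cong)
  have "(\<Sum>j<m. partial j \<phi> (cyl_coords m h w) *\<^sub>R h j) \<bullet> e
      = (\<Sum>j<m. (e \<bullet> h j) * partial j \<phi> (\<lambda>i. if i < m then w \<bullet> h i + 0 * (e \<bullet> h i) else 0))"
    unfolding inner_sum_left c0 by (rule sum.cong) (simp_all add: inner_commute mult.commute)
  then show ?thesis
    unfolding c using smooth_chain_rule_aux[OF \<phi> order_refl, of "\<lambda>i. w \<bullet> h i" "\<lambda>i. e \<bullet> h i" "\<lambda>_. 0" 0] by simp
qed

lemma continuous_on_cyl_coords: "continuous_on UNIV (cyl_coords m h)"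
proof (rule continuous_on_coordinatewise_then_product)
  fix i show "continuous_on UNIV (\<lambda>w. cyl_coords m h w i)"
    unfolding cyl_coords_def by (cases "i < m") (auto intro!: continuous_intros)
qed

text \<open>The analytic facts about cylindrical functions that the passage to the closure relies
  on. Boundedness places both functions in the growth class of the Gaussian integration by
  parts.\<close>

lemma has_cyl_gradientD:
  fixes F :: "real ^ 'n \<Rightarrow> real"
  assumes "has_cyl_gradient F DF"
  shows "F \<in> borel_measurable borel" "DF \<in> borel_measurable borel"
    and "\<exists>B. \<forall>w. \<bar>F w\<bar> \<le> B" "\<exists>B. \<forall>w. norm (DF w) \<le> B"
    and "\<And>w i. ((\<lambda>t. F (w + t *\<^sub>R axis i 1)) has_real_derivative DF w $ i) (at 0)"
proof -
  obtain m h \<phi> where \<phi>: "smooth_compact_support m \<phi>" and F: "F = (\<lambda>w. \<phi> (cyl_coords m h w))"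
    and DF: "DF = (\<lambda>w. \<Sum>j<m. partial j \<phi> (cyl_coords m h w) *\<^sub>R h j)"
    using assms unfolding has_cyl_gradient_def by blast
  have pc: "continuous_on UNIV (\<lambda>w. partial j \<phi> (cyl_coords m h w))" if "j < m" for j
    by (rule continuous_on_compose2[OF smooth_compact_supportD(3)[OF \<phi> that] continuous_on_cyl_coords]) auto
  show "F \<in> borel_measurable borel"
    unfolding F
    by (intro borel_measurable_continuous_onI continuous_on_compose2[OF smooth_compact_supportD(2)[OF \<phi>] continuous_on_cyl_coords]) auto
  show "DF \<in> borel_measurable borel"
    unfolding DF by (intro borel_measurable_continuous_onI continuous_on_sum continuous_on_scaleR pc continuous_on_const) auto
  obtain R where R: "\<And>x i. \<phi> x \<noteq> 0 \<Longrightarrow> i < m \<Longrightarrow> \<bar>x i\<bar> \<le> R"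
    using smooth_compact_supportD(5)[OF \<phi>] by blast
  have "\<exists>B. \<forall>x. \<bar>\<phi> x\<bar> \<le> B"
  proof (rule continuous_compact_support_bounded)
    show "continuous_on UNIV \<phi>" by (rule smooth_compact_supportD(2)[OF \<phi>])
    show "\<phi> x = \<phi> y" if "\<And>i. i < m \<Longrightarrow> x i = y i" for x y
      using \<phi> that by (rule smooth_compact_supportD(1))
    show "\<bar>x i\<bar> \<le> R" if "\<phi> x \<noteq> 0" "i < m" for x i
      using that by (rule R)
  qed
  then show "\<exists>B. \<forall>w. \<bar>F w\<bar> \<le> B" unfolding F by blast
  have "\<exists>B. \<forall>x. \<bar>partial j \<phi> x\<bar> \<le> B" if j: "j < m" for j
  proof (rule continuous_compact_support_bounded)
    show "continuous_on UNIV (partial j \<phi>)" by (rule smooth_compact_supportD(3)[OF \<phi> j])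
    show "partial j \<phi> x = partial j \<phi> y" if "\<And>i. i < m \<Longrightarrow> x i = y i" for x y
      using \<phi> j that by (rule partial_local)
    show "\<bar>x i\<bar> \<le> R" if "partial j \<phi> x \<noteq> 0" "i < m" for x i
      using \<phi> j R that by (rule partial_support)
  qed
  then obtain B where B: "\<And>j x. j < m \<Longrightarrow> \<bar>partial j \<phi> x\<bar> \<le> B j" by metis
  have "norm (DF w) \<le> (\<Sum>j<m. B j * norm (h j))" for w
    unfolding DF by (rule order_trans[OF norm_sum], rule sum_mono) (auto intro!: mult_right_mono B)
  then show "\<exists>B. \<forall>w. norm (DF w) \<le> B" by blast
  show "((\<lambda>t. F (w + t *\<^sub>R axis i 1)) has_real_derivative DF w $ i) (at 0)" for w i
    using smooth_chain_rule[OF \<phi>, of h w "axis i 1"] unfolding F DF by (simp add: inner_axis)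
qed

section \<open>Integration by parts on the Sobolev closure\<close>

lemma exp_bounded_bounded:
  assumes "\<And>w. \<bar>F w\<bar> \<le> B" shows "exp_bounded F"
  by (rule exp_boundedI[of F B 0]) (use assms in auto)

lemma borel_measurable_vec_nth_comp [measurable (raw)]:
  fixes f :: "'b \<Rightarrow> real ^ 'n"
  assumes "f \<in> M \<rightarrow>\<^sub>M borel" shows "(\<lambda>x. f x $ i) \<in> borel_measurable M"
  using assms by (rule measurable_compose) (intro borel_measurable_continuous_onI continuous_intros)

lemma cyl_gradient_integration_by_parts:
  fixes F :: "real ^ 'n \<Rightarrow> real"
  assumes F: "has_cyl_gradient F DF"
  shows "(\<E> w. DF (w + y) $ i * hermite_tensor is w) = (\<E> w. F (w + y) * hermite_tensor (i # is) w)"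
proof (rule gaussian_integration_by_parts_hermite)
  note [measurable] = has_cyl_gradientD(1,2)[OF F]
  obtain B where B: "\<And>w. \<bar>F w\<bar> \<le> B" using has_cyl_gradientD(3)[OF F] by blast
  obtain B' where B': "\<And>w. norm (DF w) \<le> B'" using has_cyl_gradientD(4)[OF F] by blast
  show "((\<lambda>t. F (w + t *\<^sub>R axis i 1 + y)) has_real_derivative DF (w + y) $ i) (at 0)" for w
    using has_cyl_gradientD(5)[OF F, of "w + y" i] by (simp add: algebra_simps)
  show "(\<lambda>w. F (w + y)) \<in> borel_measurable borel" "(\<lambda>w. DF (w + y) $ i) \<in> borel_measurable borel" by measurable
  show "exp_bounded (\<lambda>w. F (w + y))" by (rule exp_bounded_bounded[of _ B]) (rule B)
  have "\<bar>DF (w + y) $ i\<bar> \<le> B'" for w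
    using component_le_norm_cart[of "DF (w + y)" i] B'[of "w + y"] by linarith
  then show "exp_bounded (\<lambda>w. DF (w + y) $ i)" by (rule exp_bounded_bounded)
qed

text \<open>In the Young bound for a translate only the term \<open>K * s^2\<close> survives as the
  moments of order \<open>3 + \<alpha>\<close> tend to 0. Hence \<open>s\<close> is fixed first,
  making this term half of the target, and \<open>j\<close> grows afterwards.\<close>

lemma nn_integral_shift_square_tendsto_0:
  fixes f :: "nat \<Rightarrow> real ^ 'n \<Rightarrow> real"
  assumes \<alpha>: "0 < \<alpha>" and [measurable]: "\<And>j. f j \<in> borel_measurable borel"
    and lim: "(\<lambda>j. (\<E>\<^sup>+ w. ennreal (\<bar>f j w\<bar> powr (3 + \<alpha>)))) \<longlonglongrightarrow> 0"
  shows "(\<lambda>j. (\<E>\<^sup>+ w. ennreal ((f j (w + y))\<^sup>2))) \<longlonglongrightarrow> 0"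
proof (rule order_tendstoI)
  fix a :: ennreal assume "0 < a"
  obtain \<epsilon> where e: "0 < \<epsilon>" "ennreal \<epsilon> < a"
  proof (cases a)
    case (real r)
    then show ?thesis using \<open>0 < a\<close> that[of "r / 2"] by (simp add: ennreal_less_iff)
  next
    case top
    then show ?thesis using that[of 1] by simp
  qed
  define K where "K = exp ((norm y)\<^sup>2 / (1 + \<alpha>))"
  define s where "s = sqrt (\<epsilon> / (2 * K))"
  have K: "0 < K" by (simp add: K_def)
  have s: "0 < s" "K * s\<^sup>2 = \<epsilon> / 2" using K e by (auto simp: s_def)
  let ?R = "\<lambda>j. ennreal K * (ennreal (s\<^sup>2 / s powr (3 + \<alpha>)) * (\<E>\<^sup>+ w. ennreal (\<bar>f j w\<bar> powr (3 + \<alpha>))) + ennreal (s\<^sup>2))"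
  have "?R \<longlonglongrightarrow> ennreal K * (ennreal (s\<^sup>2 / s powr (3 + \<alpha>)) * 0 + ennreal (s\<^sup>2))"
    by (intro ennreal_tendsto_cmult tendsto_add tendsto_const lim) auto
  also have "ennreal K * (ennreal (s\<^sup>2 / s powr (3 + \<alpha>)) * 0 + ennreal (s\<^sup>2)) = ennreal (\<epsilon> / 2)"
    using K by (simp add: ennreal_mult'[symmetric] s(2))
  finally have lim_R: "?R \<longlonglongrightarrow> ennreal (\<epsilon> / 2)" .
  have "ennreal (\<epsilon> / 2) < a"
    using e by (intro le_less_trans[OF _ e(2)] ennreal_leI) auto
  then have "eventually (\<lambda>j. ?R j < a) sequentially" by (rule order_tendstoD(2)[OF lim_R])
  then show "eventually (\<lambda>j. (\<E>\<^sup>+ w. ennreal ((f j (w + y))\<^sup>2)) < a) sequentially"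
  proof eventually_elim
    case (elim j)
    then show ?case
      unfolding K_def by (rule le_less_trans[OF nn_integral_shift_square_le[OF \<alpha> s(1) assms(2)]])
  qed
qed simp

lemma powr_add_le:
  fixes a b p :: real
  assumes "0 \<le> a" "0 \<le> b" "0 < p" shows "(a + b) powr p \<le> 2 powr p * (a powr p + b powr p)"
proof -
  have "(a + b) powr p \<le> (2 * max a b) powr p" using assms by (intro powr_mono2) auto
  also have "\<dots> = 2 powr p * (max a b) powr p" using assms by (simp add: powr_mult)
  also have "(max a b) powr p \<le> a powr p + b powr p" by (auto simp: max_def)
  finally show ?thesis by (simp add: mult_left_mono)
qed

text \<open>One bounded function at finite distance is enough; it will be a member of the
  approximating cylindrical sequence.\<close>

lemma nn_integral_powr_finite_of_close:
  fixes g G :: "real ^ 'n \<Rightarrow> 'a::euclidean_space"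
  assumes [measurable]: "g \<in> borel_measurable borel" "G \<in> borel_measurable borel" and p: "0 < p"
    and B: "\<And>w. norm (G w) \<le> B" and fin: "(\<E>\<^sup>+ w. ennreal (norm (G w - g w) powr p)) < \<infinity>"
  shows "(\<E>\<^sup>+ w. ennreal (norm (g w) powr p)) < \<infinity>"
proof -
  have pt: "norm (g w) powr p \<le> 2 powr p * (B powr p + norm (G w - g w) powr p)" for w
  proof -
    have "norm (g w) \<le> B + norm (G w - g w)"
      using norm_triangle_ineq4[of "G w" "G w - g w"] B[of w] by simp
    moreover have "0 \<le> B" using B[of w] norm_ge_zero[of "G w"] by linarith
    moreover have "norm (g w) powr p \<le> (B + norm (G w - g w)) powr p"
      using calculation p by (intro powr_mono2) auto
    ultimately show ?thesis
      using powr_add_le[of B "norm (G w - g w)" p] p by (simp add: order_trans)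
  qed
  have "(\<E>\<^sup>+ w. ennreal (norm (g w) powr p)) \<le>
      (\<E>\<^sup>+ w. ennreal (2 powr p) * (ennreal (B powr p) + ennreal (norm (G w - g w) powr p)))"
    by (intro nn_integral_mono) (simp add: ennreal_mult'[symmetric] ennreal_plus[symmetric] ennreal_leI pt del: ennreal_plus)
  also have "\<dots> = ennreal (2 powr p) * (ennreal (B powr p) + (\<E>\<^sup>+ w. ennreal (norm (G w - g w) powr p)))"
    by (simp add: nn_integral_cmult nn_integral_add)
  also have "\<dots> < \<infinity>" using fin by (simp add: ennreal_mult_less_top)
  finally show ?thesis .
qed

lemma square_integrable_shift:
  fixes f :: "real ^ 'n \<Rightarrow> real"
  assumes \<alpha>: "0 < \<alpha>" and [measurable]: "f \<in> borel_measurable borel"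
    and fin: "(\<E>\<^sup>+ w. ennreal (\<bar>f w\<bar> powr (3 + \<alpha>))) < \<infinity>"
  shows "square_integrable (\<lambda>w. f (w + y))"
proof -
  have "(\<E>\<^sup>+ w. ennreal ((f (w + y))\<^sup>2)) < \<infinity>"
    using fin by (intro le_less_trans[OF nn_integral_shift_square_le[OF \<alpha> zero_less_one]])
      (auto simp: ennreal_mult_less_top)
  then show ?thesis unfolding square_integrable_def by (simp add: integrable_iff_bounded)
qed

text \<open>Convergence of order \<open>3 + \<alpha>\<close> implies mean square convergence of
  every translate, of the functions and of the gradient components alike. Pairings with a fixed
  Hermite tensor therefore converge, and both sides of the integration by parts pass to the
  limit.\<close>

lemma has_sobolev_gradientD:
  fixes f :: "real ^ 'n \<Rightarrow> real"
  assumes \<alpha>: "0 < \<alpha>" and f: "has_sobolev_gradient (3 + \<alpha>) f Df"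
  shows "f \<in> borel_measurable borel" "Df \<in> borel_measurable borel"
    and "(\<E>\<^sup>+ w. ennreal (\<bar>f w\<bar> powr (3 + \<alpha>))) < \<infinity>"
    and "(\<E>\<^sup>+ w. ennreal (norm (Df w) powr (3 + \<alpha>))) < \<infinity>"
    and "\<And>y i is. (\<E> w. Df (w + y) $ i * hermite_tensor is w)
        = (\<E> w. f (w + y) * hermite_tensor (i # is) w)"
proof -
  note * = f[unfolded has_sobolev_gradient_def]
  show fm [measurable]: "f \<in> borel_measurable borel" "Df \<in> borel_measurable borel" using * by auto
  obtain F DF where F: "\<And>j::nat. has_cyl_gradient (F j) (DF j)"
    and lim: "(\<lambda>j. (\<E>\<^sup>+  w. ennreal (\<bar>F j w - f w\<bar> powr (3 + \<alpha>)))
            + (\<E>\<^sup>+  w. ennreal (norm (DF j w - Df w) powr (3 + \<alpha>)))) \<longlonglongrightarrow> 0"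
    using * by blast
  note [measurable] = has_cyl_gradientD(1,2)[OF F]
  have lim1: "(\<lambda>j. (\<E>\<^sup>+  w. ennreal (\<bar>F j w - f w\<bar> powr (3 + \<alpha>)))) \<longlonglongrightarrow> 0"
    by (rule tendsto_sandwich[OF _ _ tendsto_const lim]) (auto intro!: always_eventually)
  have lim2: "(\<lambda>j. (\<E>\<^sup>+  w. ennreal (norm (DF j w - Df w) powr (3 + \<alpha>)))) \<longlonglongrightarrow> 0"
    by (rule tendsto_sandwich[OF _ _ tendsto_const lim]) (auto intro!: always_eventually)
  have "eventually (\<lambda>j. (\<E>\<^sup>+  w. ennreal (\<bar>F j w - f w\<bar> powr (3 + \<alpha>))) < 1 \<and>
      (\<E>\<^sup>+  w. ennreal (norm (DF j w - Df w) powr (3 + \<alpha>))) < 1) sequentially"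
    by (intro eventually_conj order_tendstoD(2)[OF lim1] order_tendstoD(2)[OF lim2]) auto
  then obtain j where j: "(\<E>\<^sup>+  w. ennreal (\<bar>F j w - f w\<bar> powr (3 + \<alpha>))) < 1"
      "(\<E>\<^sup>+  w. ennreal (norm (DF j w - Df w) powr (3 + \<alpha>))) < 1"
    by (auto simp: eventually_sequentially)
  obtain B where B: "\<And>w. \<bar>F j w\<bar> \<le> B" using has_cyl_gradientD(3)[OF F] by blast
  obtain B' where B': "\<And>w. norm (DF j w) \<le> B'" using has_cyl_gradientD(4)[OF F] by blast
  show f_fin: "(\<E>\<^sup>+ w. ennreal (\<bar>f w\<bar> powr (3 + \<alpha>))) < \<infinity>"
    using nn_integral_powr_finite_of_close[of f "F j" "3 + \<alpha>" B] \<alpha> B j(1)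
    by (simp add: order_less_trans[OF _ ennreal_one_less_top])
  show Df_fin: "(\<E>\<^sup>+ w. ennreal (norm (Df w) powr (3 + \<alpha>))) < \<infinity>"
    using nn_integral_powr_finite_of_close[of Df "DF j" "3 + \<alpha>" B'] \<alpha> B' j(2)
    by (simp add: order_less_trans[OF _ ennreal_one_less_top])
  fix y :: "real ^ 'n" and i :: 'n and "is" :: "'n list"
  have comp: "(\<E>\<^sup>+ w. ennreal (\<bar>G w $ i\<bar> powr (3 + \<alpha>))) \<le> (\<E>\<^sup>+ w. ennreal (norm (G w) powr (3 + \<alpha>)))"
    for G :: "real ^ 'n \<Rightarrow> real ^ 'n"
    using \<alpha> by (intro nn_integral_mono ennreal_leI powr_mono2 component_le_norm_cart) auto
  have conv: "(\<lambda>j. (\<E> w. G j (w + y) * hermite_tensor js w)) \<longlonglongrightarrow> (\<E> w. g (w + y) * hermite_tensor js w)"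
    if Gm [measurable]: "\<And>j. G j \<in> borel_measurable borel" "g \<in> borel_measurable borel"
      and g: "(\<E>\<^sup>+ w. ennreal (\<bar>g w\<bar> powr (3 + \<alpha>))) < \<infinity>"
      and B: "\<And>j. \<exists>B. \<forall>w. \<bar>G j w\<bar> \<le> B"
      and l: "(\<lambda>j. (\<E>\<^sup>+ w. ennreal (\<bar>G j w - g w\<bar> powr (3 + \<alpha>)))) \<longlonglongrightarrow> 0"
    for G :: "nat \<Rightarrow> real ^ 'n \<Rightarrow> real" and g js
  proof -
    have sg: "square_integrable (\<lambda>w. g (w + y))" by (rule square_integrable_shift[OF \<alpha> _ g]) simp
    have "square_integrable (\<lambda>w. G j (w + y))" for j
      using B[of j] by (auto intro!: exp_bounded_square_integrable exp_bounded_bounded)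
    then have d: "square_integrable (\<lambda>w. g (w + y) - G j (w + y))" for j
      by (intro square_integrable_diff sg)
    have "(\<lambda>j. (\<E>\<^sup>+ w. ennreal ((g (w + y) - G j (w + y))\<^sup>2))) \<longlonglongrightarrow> 0"
      using l by (intro nn_integral_shift_square_tendsto_0[OF \<alpha>, of "\<lambda>j w. g w - G j w"])
        (auto simp: abs_minus_commute)
    then have "(\<lambda>j. ennreal (\<E> w. (g (w + y) - G j (w + y))\<^sup>2)) \<longlonglongrightarrow> ennreal 0"
      unfolding nn_integral_square_eq[OF d] by simp
    then have "(\<lambda>j. (\<E> w. (g (w + y) - G j (w + y))\<^sup>2)) \<longlonglongrightarrow> 0"
      by (rule tendsto_ennrealD) auto
    from tendsto_integral_mult[OF d sg square_integrable_hermite_tensor this] show ?thesis .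
  qed
  have 1: "(\<lambda>j. (\<E> w. F j (w + y) * hermite_tensor (i # is) w)) \<longlonglongrightarrow> (\<E> w. f (w + y) * hermite_tensor (i # is) w)"
    by (rule conv[OF _ _ f_fin has_cyl_gradientD(3)[OF F] lim1]) auto
  have 2: "(\<lambda>j. (\<E> w. DF j (w + y) $ i * hermite_tensor is w)) \<longlonglongrightarrow> (\<E> w. Df (w + y) $ i * hermite_tensor is w)"
  proof (rule conv)
    show "(\<E>\<^sup>+ w. ennreal (\<bar>Df w $ i\<bar> powr (3 + \<alpha>))) < \<infinity>"
      using comp[of Df] Df_fin by (rule le_less_trans)
    show "\<exists>B. \<forall>w. \<bar>DF j w $ i\<bar> \<le> B" for j
      using has_cyl_gradientD(4)[OF F, of j] component_le_norm_cart order_trans by blast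
    show "(\<lambda>j. (\<E>\<^sup>+ w. ennreal (\<bar>DF j w $ i - Df w $ i\<bar> powr (3 + \<alpha>)))) \<longlonglongrightarrow> 0"
      by (rule tendsto_sandwich[OF _ _ tendsto_const lim2])
         (use comp[of "\<lambda>w. DF _ w - Df w"] in \<open>auto intro!: always_eventually\<close>)
  qed measurable
  show "(\<E> w. Df (w + y) $ i * hermite_tensor is w) = (\<E> w. f (w + y) * hermite_tensor (i # is) w)"
    using LIMSEQ_unique[OF 2 1[folded cyl_gradient_integration_by_parts[OF F]]] .
qed

lemma sobolev_poincare_shift:
  fixes f :: "real ^ 'n \<Rightarrow> real"
  assumes \<alpha>: "0 < \<alpha>" "\<alpha> \<le> 1" and f: "has_sobolev_gradient (3 + \<alpha>) f Df"
  shows "(\<E> w. (f (w + y))\<^sup>2) - (\<E> w. (Gamma_fun (sqrt \<alpha>) (\<lambda>w. f (w + y)) w)\<^sup>2)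
    \<le> (1 - \<alpha>) * (\<E> w. (norm (Df (w + y)))\<^sup>2)"
proof -
  note D = has_sobolev_gradientD[OF \<alpha>(1) f]
  note [measurable] = D(1,2)
  have sq: "square_integrable (\<lambda>w. Df (w + y) $ i)" for i
  proof (rule square_integrable_shift[OF \<alpha>(1), of "\<lambda>w. Df w $ i"])
    have "(\<E>\<^sup>+ w. ennreal (\<bar>Df w $ i\<bar> powr (3 + \<alpha>))) \<le> (\<E>\<^sup>+ w. ennreal (norm (Df w) powr (3 + \<alpha>)))"
      using \<alpha> by (intro nn_integral_mono ennreal_leI powr_mono2 component_le_norm_cart) auto
    then show "(\<E>\<^sup>+ w. ennreal (\<bar>Df w $ i\<bar> powr (3 + \<alpha>))) < \<infinity>" using D(4) by (rule le_less_trans)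
  qed measurable
  have "(\<E> w. (norm (Df (w + y)))\<^sup>2) = (\<E> w. (\<Sum>i\<in>UNIV. (Df (w + y) $ i)\<^sup>2))"
    unfolding power2_norm_eq_inner inner_vec_def by (simp add: power2_eq_square)
  also have "\<dots> = (\<Sum>i\<in>UNIV. (\<E> w. (Df (w + y) $ i)\<^sup>2))"
    using square_integrableD(2)[OF sq] by (intro Bochner_Integration.integral_sum) auto
  finally show ?thesis
    using gaussian_poincare[OF \<alpha> square_integrable_shift[OF \<alpha>(1) D(1,3), of y] sq D(5)] by simp
qed

section \<open>The square of an Ornstein-Uhlenbeck average\<close>

text \<open>For \<open>\<beta> = (1 + \<alpha>) / 2\<close> this is the function \<open>v\<close> of
  the overview. The two arguments of \<open>f\<close>, with \<open>z\<close> and \<open>w\<close>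
  independent Gaussian, have correlation \<open>2 * \<beta> - 1\<close>.\<close>

definition pair_mean :: "real \<Rightarrow> (real ^ 'n \<Rightarrow> real) \<Rightarrow> real ^ 'n \<Rightarrow> real" where
  "pair_mean \<beta> f z = (\<E> w. f (sqrt \<beta> *\<^sub>R z + sqrt (1 - \<beta>) *\<^sub>R w) * f (sqrt \<beta> *\<^sub>R z - sqrt (1 - \<beta>) *\<^sub>R w))"

text \<open>The function \<open>\<Gamma>(1/k) \<xi>\<close>: \<open>k = 1\<close> gives the density
  itself, \<open>k = sqrt \<alpha>\<close> the weight in the second inequality, and
  \<open>k = sqrt \<beta>\<close> the function \<open>\<eta>\<close>.\<close>

definition shift_mean :: "real \<Rightarrow> (real ^ 'n) measure \<Rightarrow> real ^ 'n \<Rightarrow> real" where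
  "shift_mean k \<nu> w = (\<integral>y. shift_density (y /\<^sub>R k) w \<partial>\<nu>)"

lemma pair_mean_coeff:
  fixes \<beta> :: real
  assumes "0 < \<beta>" "\<beta> \<le> 1"
  shows "(sqrt \<beta>)\<^sup>2 + (sqrt (1 - \<beta>))\<^sup>2 = 1" "(sqrt \<beta>)\<^sup>2 + (- sqrt (1 - \<beta>))\<^sup>2 = 1" "sqrt \<beta> \<noteq> 0"
  using assms by auto

text \<open>Each of the two arguments of \<open>f\<close> is standard Gaussian by itself, so
  bounding the product by the mean of the squares requires nothing about their joint law.\<close>

lemma pair_mean_integrable:
  fixes f :: "real ^ 'n \<Rightarrow> real"
  assumes \<beta>: "0 < \<beta>" "\<beta> \<le> 1" and f: "square_integrable f"
  defines "h \<equiv> \<lambda>z. f (sqrt \<beta> *\<^sub>R fst z + sqrt (1 - \<beta>) *\<^sub>R snd z) * f (sqrt \<beta> *\<^sub>R fst z - sqrt (1 - \<beta>) *\<^sub>R snd z)"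
  shows "integrable (gaussian \<Otimes>\<^sub>M gaussian) h"
    and "(\<integral>\<^sup>+z. ennreal \<bar>h z\<bar> \<partial>(gaussian \<Otimes>\<^sub>M gaussian)) \<le> (\<E>\<^sup>+ w. ennreal ((f w)\<^sup>2))"
proof -
  note c = pair_mean_coeff[OF \<beta>]
  let ?P = "gaussian \<Otimes>\<^sub>M gaussian :: ((real ^ 'n) \<times> (real ^ 'n)) measure"
  let ?X = "\<lambda>z :: (real ^ 'n) \<times> (real ^ 'n). sqrt \<beta> *\<^sub>R fst z + sqrt (1 - \<beta>) *\<^sub>R snd z"
  let ?Y = "\<lambda>z :: (real ^ 'n) \<times> (real ^ 'n). sqrt \<beta> *\<^sub>R fst z - sqrt (1 - \<beta>) *\<^sub>R snd z"
  have [measurable]: "f \<in> borel_measurable borel" using f by auto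
  have hm [measurable]: "h \<in> borel_measurable ?P" unfolding h_def by measurable
  define k :: real where "k = 1 / 2"
  have k: "0 \<le> k" "k + k = 1" by (simp_all add: k_def)
  have "ennreal \<bar>h z\<bar> \<le> ennreal k * ennreal ((f (?X z))\<^sup>2) + ennreal k * ennreal ((f (?Y z))\<^sup>2)" for z
  proof -
    have "ennreal \<bar>h z\<bar> \<le> ennreal (k * (f (?X z))\<^sup>2 + k * (f (?Y z))\<^sup>2)"
      unfolding h_def k_def using abs_mult_le_squares[of "f (?X z)" "f (?Y z)"] by (intro ennreal_leI) simp
    then show ?thesis using k by (simp add: ennreal_mult')
  qed
  then have "(\<integral>\<^sup>+z. ennreal \<bar>h z\<bar> \<partial>?P) \<le> (\<integral>\<^sup>+z. ennreal k * ennreal ((f (?X z))\<^sup>2) + ennreal k * ennreal ((f (?Y z))\<^sup>2) \<partial>?P)"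
    by (rule nn_integral_mono)
  also have "\<dots> = ennreal k * (\<integral>\<^sup>+z. ennreal ((f (?X z))\<^sup>2) \<partial>?P) + ennreal k * (\<integral>\<^sup>+z. ennreal ((f (?Y z))\<^sup>2) \<partial>?P)"
    by (subst nn_integral_add, measurable) (simp add: nn_integral_cmult)
  also have "(\<integral>\<^sup>+z. ennreal ((f (?X z))\<^sup>2) \<partial>?P) = (\<E>\<^sup>+ w. ennreal ((f w)\<^sup>2))"
    using nn_integral_gaussian_mix[OF c(1,3), of "\<lambda>w. ennreal ((f w)\<^sup>2)"] by simp
  also have "(\<integral>\<^sup>+z. ennreal ((f (?Y z))\<^sup>2) \<partial>?P) = (\<E>\<^sup>+ w. ennreal ((f w)\<^sup>2))"
    using nn_integral_gaussian_mix[OF c(2,3), of "\<lambda>w. ennreal ((f w)\<^sup>2)"] by simp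
  also have "ennreal k * (\<E>\<^sup>+ w. ennreal ((f w)\<^sup>2)) + ennreal k * (\<E>\<^sup>+ w. ennreal ((f w)\<^sup>2))
      = (\<E>\<^sup>+ w. ennreal ((f w)\<^sup>2))"
    using k by (simp add: distrib_right[symmetric] ennreal_plus[symmetric] del: ennreal_plus)
  finally show le: "(\<integral>\<^sup>+z. ennreal \<bar>h z\<bar> \<partial>?P) \<le> (\<E>\<^sup>+ w. ennreal ((f w)\<^sup>2))" .
  also have "\<dots> < \<infinity>" using nn_integral_square_eq[OF f] by simp
  finally show "integrable ?P h" by (simp add: integrable_iff_bounded)
qed

lemma pair_mean_measurable [measurable]:
  assumes [measurable]: "f \<in> borel_measurable borel" shows "pair_mean \<beta> f \<in> borel_measurable borel"
  unfolding pair_mean_def by measurable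

lemma nn_integral_pair_mean_le:
  fixes f :: "real ^ 'n \<Rightarrow> real"
  assumes \<beta>: "0 < \<beta>" "\<beta> \<le> 1" and f: "square_integrable f"
  shows "(\<E>\<^sup>+ w. ennreal \<bar>pair_mean \<beta> f w\<bar>) \<le> (\<E>\<^sup>+ w. ennreal ((f w)\<^sup>2))"
proof -
  let ?P = "gaussian \<Otimes>\<^sub>M gaussian :: ((real ^ 'n) \<times> (real ^ 'n)) measure"
  let ?h = "\<lambda>z. f (sqrt \<beta> *\<^sub>R fst z + sqrt (1 - \<beta>) *\<^sub>R snd z) * f (sqrt \<beta> *\<^sub>R fst z - sqrt (1 - \<beta>) *\<^sub>R snd z)"
  have [measurable]: "f \<in> borel_measurable borel" using f by auto
  note h = pair_mean_integrable[OF \<beta> f]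
  have "(\<E>\<^sup>+ w. ennreal \<bar>pair_mean \<beta> f w\<bar>) \<le> (\<E>\<^sup>+ x. \<E>\<^sup>+ y. ennreal \<bar>?h (x, y)\<bar>)"
  proof (rule nn_integral_mono_AE)
    show "AE x in gaussian. ennreal \<bar>pair_mean \<beta> f x\<bar> \<le> (\<E>\<^sup>+ y. ennreal \<bar>?h (x, y)\<bar>)"
      using gaussian_pair.AE_integrable_fst'[OF h(1)]
    proof eventually_elim
      case (elim x)
      from integral_norm_bound_ennreal[OF elim] show ?case by (simp add: pair_mean_def)
    qed
  qed
  also have "\<dots> = (\<integral>\<^sup>+z. ennreal \<bar>?h z\<bar> \<partial>?P)"
    by (rule gaussian.nn_integral_fst) measurable
  finally show ?thesis using h(2) by (rule order_trans)
qed

lemma pair_mean_integrable':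
  assumes "0 < \<beta>" "\<beta> \<le> 1" "square_integrable f"
  shows "integrable gaussian (pair_mean \<beta> f)"
  using gaussian_pair.integrable_fst'[OF pair_mean_integrable(1)[OF assms]] by (simp add: pair_mean_def[abs_def])

lemma integrable_product_gaussian:
  fixes k :: "real ^ 'n \<Rightarrow> real"
  assumes k: "integrable gaussian k"
  shows "integrable (gaussian \<Otimes>\<^sub>M gaussian) (\<lambda>z. k (fst z) * k (snd z))"
proof (rule gaussian_pair.Fubini_integrable)
  have [measurable]: "k \<in> borel_measurable borel" using k by auto
  show "(\<lambda>z. k (fst z) * k (snd z)) \<in> borel_measurable (gaussian \<Otimes>\<^sub>M gaussian)" by measurable
  show "integrable gaussian (\<lambda>x. (\<E> y. norm (k (fst (x, y)) * k (snd (x, y)))))"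
    using k by (simp add: abs_mult)
qed (use k in simp)

text \<open>The square is a double integral over independent variables. After passing to their
  normalised sum and difference, the average over the difference is \<open>pair_mean\<close> and the
  average over the sum is the Ornstein-Uhlenbeck operator. The exceptional null set consists of
  points where the section of \<open>f\<close> is not square integrable.\<close>

lemma Gamma_fun_square_eq_pair_mean:
  fixes f :: "real ^ 'n \<Rightarrow> real"
  assumes \<alpha>: "0 < \<alpha>" "\<alpha> \<le> 1" and f: "square_integrable f"
  defines "\<beta> \<equiv> (1 + \<alpha>) / 2"
  shows "AE x in gaussian. (Gamma_fun (sqrt \<alpha>) f x)\<^sup>2 = Gamma_fun (sqrt (\<alpha> / \<beta>)) (pair_mean \<beta> f) x"
proof -
  let ?P = "gaussian \<Otimes>\<^sub>M gaussian :: ((real ^ 'n) \<times> (real ^ 'n)) measure"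
  have \<beta>: "0 < \<beta>" "\<beta> \<le> 1" "\<alpha> \<le> \<beta>" using \<alpha> by (auto simp: \<beta>_def)
  define r :: real where "r = 1 / sqrt 2"
  define c where "c = sqrt (1 - \<beta>)"
  have rr: "r\<^sup>2 + r\<^sup>2 = 1" "r \<noteq> 0" by (auto simp: r_def power_divide)
  have c1: "c = sqrt (1 - \<alpha>) * r"
    unfolding c_def r_def \<beta>_def by (simp add: real_sqrt_divide[symmetric] field_simps)
  \<comment> \<open>Since \<open>\<beta> - \<alpha> = 1 - \<beta>\<close>, the sum and the
    difference enter with the same coefficient \<open>c\<close>. This equation determines
    \<open>\<beta>\<close>.\<close>
  have c2: "sqrt \<beta> * sqrt (1 - (sqrt (\<alpha> / \<beta>))\<^sup>2) = c"
    using \<alpha> \<beta> unfolding c_def by (simp add: real_sqrt_mult[symmetric] right_diff_distrib) (simp add: \<beta>_def field_simps)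
  have c3: "sqrt \<beta> * sqrt (\<alpha> / \<beta>) = sqrt \<alpha>"
    using \<beta> by (simp add: real_sqrt_mult[symmetric])
  have sa: "0 < sqrt \<alpha>" "sqrt \<alpha> \<le> 1" using \<alpha> by auto
  have [measurable]: "f \<in> borel_measurable borel" using f by auto
  from AE_gaussian_mix_square_integrable[OF Gamma_fun_coeff[OF sa] f]
  show ?thesis
  proof eventually_elim
    case (elim x)
    define k where "k u = f (sqrt \<alpha> *\<^sub>R x + sqrt (1 - \<alpha>) *\<^sub>R u)" for u
    have [measurable]: "k \<in> borel_measurable borel" unfolding k_def by measurable
    have k: "integrable gaussian k"
      using square_integrable_integrable[OF elim] \<alpha> by (simp add: k_def[abs_def])
    let ?K = "\<lambda>z. k (fst z) * k (snd z)"
    let ?T = "\<lambda>(x :: real ^ 'n, y). (r *\<^sub>R x + r *\<^sub>R y, r *\<^sub>R x - r *\<^sub>R y)"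
    have K: "integrable ?P ?K" by (rule integrable_product_gaussian[OF k])
    have T: "?T \<in> ?P \<rightarrow>\<^sub>M (borel \<Otimes>\<^sub>M borel)" by measurable
    have KT: "integrable ?P (\<lambda>z. ?K (?T z))"
    proof -
      have "integrable (distr ?P (borel \<Otimes>\<^sub>M borel) ?T) ?K"
        using K by (simp only: distr_gaussian_reflect[OF rr])
      then show ?thesis by (rule integrable_distr[OF T])
    qed
    have pm: "pair_mean \<beta> f (sqrt (\<alpha> / \<beta>) *\<^sub>R x + sqrt (1 - (sqrt (\<alpha> / \<beta>))\<^sup>2) *\<^sub>R w) = (\<E> y. ?K (?T (w, y)))" for w
    proof -
      have "sqrt \<beta> *\<^sub>R (sqrt (\<alpha> / \<beta>) *\<^sub>R x + sqrt (1 - (sqrt (\<alpha> / \<beta>))\<^sup>2) *\<^sub>R w) = sqrt \<alpha> *\<^sub>R x + c *\<^sub>R w"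
        by (simp only: scaleR_add_right scaleR_scaleR c2 c3)
      then show ?thesis
        unfolding pair_mean_def k_def c_def[symmetric] by (simp add: c1 algebra_simps)
    qed
    have "Gamma_fun (sqrt (\<alpha> / \<beta>)) (pair_mean \<beta> f) x = (\<E> w. \<E> y. ?K (?T (w, y)))"
      unfolding Gamma_fun_def pm ..
    also have "\<dots> = (\<integral>z. ?K (?T z) \<partial>?P)" by (rule gaussian_pair.integral_fst'[OF KT])
    also have "\<dots> = (\<integral>z. ?K z \<partial>distr ?P (borel \<Otimes>\<^sub>M borel) ?T)"
      by (rule integral_distr[OF T, symmetric]) measurable
    also have "\<dots> = (\<integral>z. ?K z \<partial>?P)" unfolding distr_gaussian_reflect[OF rr] ..
    also have "\<dots> = (\<E> u. k u)\<^sup>2"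
      using gaussian_pair.integral_fst'[OF K] by (simp add: power2_eq_square)
    also have "(\<E> u. k u) = Gamma_fun (sqrt \<alpha>) f x"
      using \<alpha> by (simp add: Gamma_fun_def k_def)
    finally show ?case by simp
  qed
qed

text \<open>The Ornstein-Uhlenbeck operator preserves the mean. The left side occurs in the Poincare
  inequality, the right side in the evaluation of the pairing.\<close>

lemma integral_Gamma_fun_square:
  fixes f :: "real ^ 'n \<Rightarrow> real"
  assumes \<alpha>: "0 < \<alpha>" "\<alpha> \<le> 1" and f: "square_integrable f"
  shows "(\<E> x. (Gamma_fun (sqrt \<alpha>) f x)\<^sup>2) = (\<E> x. pair_mean ((1 + \<alpha>) / 2) f x)"
proof -
  let ?\<beta> = "(1 + \<alpha>) / 2"
  have \<beta>: "0 < ?\<beta>" "?\<beta> \<le> 1" using \<alpha> by auto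
  have a: "0 < sqrt (\<alpha> / ?\<beta>)" "sqrt (\<alpha> / ?\<beta>) \<le> 1" using \<alpha> by auto
  have [measurable]: "f \<in> borel_measurable borel" using f by auto
  have "(\<E> x. (Gamma_fun (sqrt \<alpha>) f x)\<^sup>2) = (\<E> x. Gamma_fun (sqrt (\<alpha> / ?\<beta>)) (pair_mean ?\<beta> f) x)"
    using Gamma_fun_square_eq_pair_mean[OF \<alpha> f] by (intro integral_cong_AE) auto
  also have "\<dots> = (\<E> x. pair_mean ?\<beta> f x)"
    by (rule integral_Gamma_fun[OF a _ pair_mean_integrable'[OF \<beta> f]]) measurable
  finally show ?thesis .
qed

lemma nn_integral_Gamma_fun_square_le:
  fixes f :: "real ^ 'n \<Rightarrow> real"
  assumes \<alpha>: "0 < \<alpha>" "\<alpha> \<le> 1" and f: "square_integrable f"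
  shows "(\<E>\<^sup>+ x. ennreal ((Gamma_fun (sqrt \<alpha>) f x)\<^sup>2)) \<le> (\<E>\<^sup>+ w. ennreal ((f w)\<^sup>2))"
proof -
  let ?\<beta> = "(1 + \<alpha>) / 2"
  have \<beta>: "0 < ?\<beta>" "?\<beta> \<le> 1" using \<alpha> by auto
  have sa: "0 < sqrt \<alpha>" "sqrt \<alpha> \<le> 1" using \<alpha> by auto
  have "(\<E>\<^sup>+ x. ennreal ((Gamma_fun (sqrt \<alpha>) f x)\<^sup>2)) = ennreal (\<E> x. pair_mean ?\<beta> f x)"
    by (simp add: nn_integral_square_eq[OF square_integrable_Gamma_fun[OF sa f]] integral_Gamma_fun_square[OF \<alpha> f])
  also have "\<dots> \<le> (\<E>\<^sup>+ x. ennreal \<bar>pair_mean ?\<beta> f x\<bar>)"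
    using integral_norm_bound_ennreal[OF pair_mean_integrable'[OF \<beta> f]]
    by (auto intro: order_trans[OF ennreal_leI[OF abs_ge_self]])
  also have "\<dots> \<le> (\<E>\<^sup>+ w. ennreal ((f w)\<^sup>2))" by (rule nn_integral_pair_mean_le[OF \<beta> f])
  finally show ?thesis .
qed

text \<open>
  With \<open>X = \<surd>\<beta> z + \<surd>(1 - \<beta>) w\<close> and \<open>Y = \<surd>\<beta> z - \<surd>(1 - \<beta>) w\<close> one has
  \<open>|X|\<^sup>2 + |Y|\<^sup>2 = (1 + \<alpha>) |z|\<^sup>2 + (1 - \<alpha>) |w|\<^sup>2 \<le> (1 + \<alpha>) (|z|\<^sup>2 + |w|\<^sup>2)\<close>, so the joint density of
  \<open>X\<close> and \<open>Y\<close> is dominated by a product and the integral splits. For \<open>\<alpha> = 1\<close> the map is degenerate.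
\<close>

lemma nn_integral_pair_square_finite:
  fixes f :: "real ^ 'n \<Rightarrow> real"
  assumes \<alpha>: "0 < \<alpha>" "\<alpha> < 1" and [measurable]: "f \<in> borel_measurable borel"
    and fin: "(\<E>\<^sup>+ w. ennreal (\<bar>f w\<bar> powr (3 + \<alpha>))) < \<infinity>"
  defines "b \<equiv> sqrt ((1 + \<alpha>) / 2)" and "c \<equiv> sqrt (1 - (1 + \<alpha>) / 2)"
  shows "(\<integral>\<^sup>+z. ennreal ((f (b *\<^sub>R fst z + c *\<^sub>R snd z) * f (b *\<^sub>R fst z - c *\<^sub>R snd z))\<^sup>2) \<partial>(gaussian \<Otimes>\<^sub>M gaussian)) < \<infinity>"
proof -
  define \<kappa> where "\<kappa> = (2 * pi) powr (- (real CARD('n) / 2))"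
  define e where "e x = exp (- (norm x)\<^sup>2 / (2 * (1 + \<alpha>)))" for x :: "real ^ 'n"
  have [measurable]: "e \<in> borel_measurable borel" unfolding e_def by measurable
  have \<kappa>: "0 < \<kappa>" by (simp add: \<kappa>_def)
  have e0: "0 \<le> e x" for x by (simp add: e_def)
  have b2: "b\<^sup>2 = (1 + \<alpha>) / 2" and c2: "c\<^sup>2 = (1 - \<alpha>) / 2" using \<alpha> by (auto simp: b_def c_def field_simps)
  have b: "0 < b" and c: "0 < c" using \<alpha> by (auto simp: b_def c_def)
  define J where "J = (\<integral>\<^sup>+x. ennreal ((f x)\<^sup>2 * e x) \<partial>lborel)"
  have J: "J < \<infinity>"
  proof -
    define q where "q = (3 + \<alpha>) / (1 + \<alpha>)"
    \<comment> \<open>Writing \<open>e\<close> as a multiple of the Gaussian density times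
      \<open>E\<close>, Young's inequality leaves \<open>E powr q\<close>, whose exponent is
      governed by \<open>l\<close>. Gaussian integrability needs \<open>l < 1\<close>, which after
      clearing denominators says just \<open>\<alpha> < 1\<close>.\<close>
    define l where "l = q * \<alpha> / (1 + \<alpha>)"
    have "(3 + \<alpha>) * \<alpha> < (1 + \<alpha>) * (1 + \<alpha>)" using \<alpha> by (simp add: algebra_simps)
    then have l: "l < 1" using \<alpha> by (simp add: l_def q_def divide_less_eq)
    have pt: "(f x)\<^sup>2 * e x \<le> (1 / \<kappa>) * (gauss_density x * (\<bar>f x\<bar> powr (3 + \<alpha>) + exp (l * (norm x)\<^sup>2 / 2)))" for x
    proof -
      define E where "E = exp (\<alpha> * (norm x)\<^sup>2 / (2 * (1 + \<alpha>)))"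
      have "(f x)\<^sup>2 * E \<le> \<bar>f x\<bar> powr (3 + \<alpha>) + E powr q"
        unfolding q_def by (rule young_square_powr) (use \<alpha> in \<open>auto simp: E_def\<close>)
      also have "E powr q = exp (l * (norm x)\<^sup>2 / 2)"
        using \<alpha> by (simp add: E_def powr_def l_def field_simps)
      finally have 1: "(f x)\<^sup>2 * E \<le> \<bar>f x\<bar> powr (3 + \<alpha>) + exp (l * (norm x)\<^sup>2 / 2)" .
      have "e x = (1 / \<kappa>) * (gauss_density x * E)"
      proof -
        have "- (norm x)\<^sup>2 / (2 * (1 + \<alpha>)) = - (norm x)\<^sup>2 / 2 + \<alpha> * (norm x)\<^sup>2 / (2 * (1 + \<alpha>))"
          using \<alpha> by (simp add: field_simps)
        then have "e x = exp (- (norm x)\<^sup>2 / 2) * E" by (simp only: e_def E_def exp_add)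
        then show ?thesis using \<kappa> by (simp add: gauss_density_def \<kappa>_def[symmetric])
      qed
      then have "(f x)\<^sup>2 * e x = (1 / \<kappa>) * (gauss_density x * ((f x)\<^sup>2 * E))" by simp
      also have "\<dots> \<le> (1 / \<kappa>) * (gauss_density x * (\<bar>f x\<bar> powr (3 + \<alpha>) + exp (l * (norm x)\<^sup>2 / 2)))"
        using \<kappa> 1 by (intro mult_left_mono) auto
      finally show ?thesis .
    qed
    have "J \<le> (\<integral>\<^sup>+x. ennreal (1 / \<kappa>) * (ennreal (gauss_density x) * (ennreal (\<bar>f x\<bar> powr (3 + \<alpha>)) + ennreal (exp (l * (norm x)\<^sup>2 / 2)))) \<partial>lborel)"
      unfolding J_def using pt \<kappa>
      by (intro nn_integral_mono) (simp add: ennreal_mult'[symmetric] ennreal_plus[symmetric] ennreal_leI del: ennreal_plus)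
    also have "\<dots> = ennreal (1 / \<kappa>) * (\<E>\<^sup>+ x. ennreal (\<bar>f x\<bar> powr (3 + \<alpha>)) + ennreal (exp (l * (norm x)\<^sup>2 / 2)))"
      by (simp add: nn_integral_cmult nn_integral_gaussian)
    also have "\<dots> = ennreal (1 / \<kappa>) * ((\<E>\<^sup>+ x. ennreal (\<bar>f x\<bar> powr (3 + \<alpha>)))
        + (\<E>\<^sup>+ x. ennreal (exp (l * (norm (x :: real ^ 'n))\<^sup>2 / 2))))"
      by (simp add: nn_integral_add)
    also have "\<dots> < \<infinity>"
      using fin nn_integral_gaussian_exp_norm2[OF l, where 'n='n] by (simp add: ennreal_mult_less_top)
    finally show ?thesis .
  qed
  define I where "I = (\<integral>\<^sup>+z. \<integral>\<^sup>+w. ennreal ((f (b *\<^sub>R z + c *\<^sub>R w))\<^sup>2 * e (b *\<^sub>R z + c *\<^sub>R w)) *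
      ennreal ((f (b *\<^sub>R z - c *\<^sub>R w))\<^sup>2 * e (b *\<^sub>R z - c *\<^sub>R w)) \<partial>lborel \<partial>lborel)"
  have "J * J = (\<integral>\<^sup>+x. \<integral>\<^sup>+y. ennreal ((f x)\<^sup>2 * e x) * ennreal ((f y)\<^sup>2 * e y) \<partial>lborel \<partial>lborel)"
    unfolding J_def by (simp add: nn_integral_cmult nn_integral_multc)
  \<comment> \<open>The Jacobian is a power of \<open>2 * b * c\<close>, positive because
    \<open>\<alpha> < 1\<close>; this is how finiteness of \<open>J\<close> reaches
    \<open>I\<close>.\<close>
  also have "\<dots> = ennreal (\<bar>b * (-c) - c * b\<bar> ^ DIM(real ^ 'n)) * I"
    using nn_integral_lborel_linear2[of b "-c" c b "\<lambda>z. ennreal ((f (fst z))\<^sup>2 * e (fst z)) * ennreal ((f (snd z))\<^sup>2 * e (snd z))"] b c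
    by (simp add: I_def)
  finally have "ennreal (\<bar>b * (-c) - c * b\<bar> ^ DIM(real ^ 'n)) * I < \<infinity>"
    using J by (metis ennreal_mult_less_top infinity_ennreal_def)
  moreover have "0 < \<bar>b * (-c) - c * b\<bar> ^ DIM(real ^ 'n)"
    using b c by (intro zero_less_power) (simp add: mult.commute)
  ultimately have I: "I < \<infinity>"
    by (auto simp: ennreal_mult_less_top)
  have pt: "gauss_density z * gauss_density w * (f (b *\<^sub>R z + c *\<^sub>R w) * f (b *\<^sub>R z - c *\<^sub>R w))\<^sup>2 \<le>
     \<kappa>\<^sup>2 * (((f (b *\<^sub>R z + c *\<^sub>R w))\<^sup>2 * e (b *\<^sub>R z + c *\<^sub>R w)) * ((f (b *\<^sub>R z - c *\<^sub>R w))\<^sup>2 * e (b *\<^sub>R z - c *\<^sub>R w)))" for z w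
  proof -
    have n: "(norm (b *\<^sub>R z + c *\<^sub>R w))\<^sup>2 + (norm (b *\<^sub>R z - c *\<^sub>R w))\<^sup>2 = 2 * b\<^sup>2 * (norm z)\<^sup>2 + 2 * c\<^sup>2 * (norm w)\<^sup>2"
      unfolding power2_norm_eq_inner
      by (simp add: inner_add_left inner_add_right inner_diff_left inner_diff_right inner_commute power2_eq_square algebra_simps)
    have "(norm (b *\<^sub>R z + c *\<^sub>R w))\<^sup>2 + (norm (b *\<^sub>R z - c *\<^sub>R w))\<^sup>2 \<le> (1 + \<alpha>) * ((norm z)\<^sup>2 + (norm w)\<^sup>2)"
    proof -
      have "2 * b\<^sup>2 = 1 + \<alpha>" "2 * c\<^sup>2 = 1 - \<alpha>" unfolding b2 c2 by simp_all
      then show ?thesis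
        unfolding n using \<alpha> mult_right_mono[of "1 - \<alpha>" "1 + \<alpha>" "(norm w)\<^sup>2"] by (simp add: distrib_left)
    qed
    then have "((norm (b *\<^sub>R z + c *\<^sub>R w))\<^sup>2 + (norm (b *\<^sub>R z - c *\<^sub>R w))\<^sup>2) / (2 * (1 + \<alpha>)) \<le> ((norm z)\<^sup>2 + (norm w)\<^sup>2) / 2"
    proof -
      have "X / (2 * a) \<le> Y / 2" if "X \<le> a * Y" "0 < a" for X Y a :: real
        using that by (simp add: field_simps)
      from this[OF \<open>_ \<le> (1 + \<alpha>) * _\<close>] \<alpha> show ?thesis by simp
    qed
    then have "exp (- ((norm z)\<^sup>2 + (norm w)\<^sup>2) / 2) \<le> e (b *\<^sub>R z + c *\<^sub>R w) * e (b *\<^sub>R z - c *\<^sub>R w)"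
      unfolding e_def exp_add[symmetric] by (simp add: add_divide_distrib)
    moreover have "gauss_density z * gauss_density w = \<kappa>\<^sup>2 * exp (- ((norm z)\<^sup>2 + (norm w)\<^sup>2) / 2)"
    proof -
      have "exp (- ((norm z)\<^sup>2 + (norm w)\<^sup>2) / 2) = exp (- (norm z)\<^sup>2 / 2) * exp (- (norm w)\<^sup>2 / 2)"
        by (simp add: exp_add[symmetric] add_divide_distrib)
      then show ?thesis by (simp add: gauss_density_def \<kappa>_def power2_eq_square)
    qed
    ultimately have "gauss_density z * gauss_density w \<le> \<kappa>\<^sup>2 * (e (b *\<^sub>R z + c *\<^sub>R w) * e (b *\<^sub>R z - c *\<^sub>R w))"
      by (simp add: mult_left_mono)
    from mult_right_mono[OF this, of "(f (b *\<^sub>R z + c *\<^sub>R w) * f (b *\<^sub>R z - c *\<^sub>R w))\<^sup>2"]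
    show ?thesis by (simp add: power_mult_distrib mult_ac)
  qed
  have "(\<integral>\<^sup>+z. ennreal ((f (b *\<^sub>R fst z + c *\<^sub>R snd z) * f (b *\<^sub>R fst z - c *\<^sub>R snd z))\<^sup>2) \<partial>(gaussian \<Otimes>\<^sub>M gaussian))
    = (\<integral>\<^sup>+z. \<integral>\<^sup>+w. ennreal (gauss_density z * gauss_density w) * ennreal ((f (b *\<^sub>R z + c *\<^sub>R w) * f (b *\<^sub>R z - c *\<^sub>R w))\<^sup>2) \<partial>lborel \<partial>lborel)"
    by (subst nn_integral_gaussian_pair) simp_all
  also have "\<dots> \<le> (\<integral>\<^sup>+z. \<integral>\<^sup>+w. ennreal (\<kappa>\<^sup>2) * (ennreal ((f (b *\<^sub>R z + c *\<^sub>R w))\<^sup>2 * e (b *\<^sub>R z + c *\<^sub>R w)) *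
      ennreal ((f (b *\<^sub>R z - c *\<^sub>R w))\<^sup>2 * e (b *\<^sub>R z - c *\<^sub>R w))) \<partial>lborel \<partial>lborel)"
    using pt e0 by (intro nn_integral_mono) (simp add: ennreal_mult'[symmetric] ennreal_leI)
  also have "\<dots> = ennreal (\<kappa>\<^sup>2) * I"
    unfolding I_def by (simp add: nn_integral_cmult)
  also have "\<dots> < \<infinity>" using I by (simp add: ennreal_mult_less_top)
  finally show ?thesis .
qed

lemma square_integrable_pair_mean:
  fixes f :: "real ^ 'n \<Rightarrow> real"
  assumes \<alpha>: "0 < \<alpha>" "\<alpha> \<le> 1" and [measurable]: "f \<in> borel_measurable borel"
    and fin: "(\<E>\<^sup>+ w. ennreal (\<bar>f w\<bar> powr (3 + \<alpha>))) < \<infinity>"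
  shows "square_integrable (pair_mean ((1 + \<alpha>) / 2) f)"
proof -
  let ?b = "sqrt ((1 + \<alpha>) / 2)" and ?c = "sqrt (1 - (1 + \<alpha>) / 2)"
  let ?h = "\<lambda>z. f (?b *\<^sub>R fst z + ?c *\<^sub>R snd z) * f (?b *\<^sub>R fst z - ?c *\<^sub>R snd z)"
  have m: "?h \<in> borel_measurable (gaussian \<Otimes>\<^sub>M gaussian)" by measurable
  have "(\<integral>\<^sup>+z. ennreal ((?h z)\<^sup>2) \<partial>(gaussian \<Otimes>\<^sub>M gaussian)) < \<infinity>"
  proof (cases "\<alpha> = 1")
    case False
    then show ?thesis using nn_integral_pair_square_finite[OF \<alpha>(1) _ _ fin] \<alpha> by simp
  next
    \<comment> \<open>Here the coefficient of the second variable is 0, both arguments of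
      \<open>f\<close> coincide with the first variable, and the squared product is the power of
      order \<open>4 = 3 + \<alpha>\<close>.\<close>
    case True
    have "(f x * f x)\<^sup>2 = \<bar>f x\<bar> powr 4" for x by (simp add: power2_eq_square power4_eq_xxxx abs_mult)
    then have "(\<integral>\<^sup>+z. ennreal ((?h z)\<^sup>2) \<partial>(gaussian \<Otimes>\<^sub>M gaussian)) = (\<E>\<^sup>+ w. ennreal (\<bar>f w\<bar> powr (3 + \<alpha>)))"
      using True nn_integral_gaussian_mix[of 1 0 "\<lambda>w. ennreal (\<bar>f w\<bar> powr 4)"] by simp
    then show ?thesis using fin by simp
  qed
  then have "integrable (gaussian \<Otimes>\<^sub>M gaussian) (\<lambda>z. (?h z)\<^sup>2)"
    using m by (simp add: integrable_iff_bounded)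
  from square_integrable_conditional[OF m this] show ?thesis
    by (simp add: pair_mean_def[abs_def])
qed

section \<open>The density of the convolution and the pairing\<close>

text \<open>The bound does not involve \<open>y\<close>, so \<open>shift_mean\<close> is a
  convergent integral at every point and for every probability measure.\<close>

lemma shift_density_le: "shift_density y w \<le> exp ((norm w)\<^sup>2 / 2)"
proof -
  have "0 \<le> (norm (w - y))\<^sup>2" by simp
  also have "(norm (w - y))\<^sup>2 = (norm w)\<^sup>2 - 2 * (w \<bullet> y) + (norm y)\<^sup>2"
    by (simp add: power2_norm_eq_inner inner_diff_left inner_diff_right inner_commute)
  finally show ?thesis by (simp add: shift_density_def)
qed

lemma shift_density_integrable_shift:
  fixes \<nu> :: "(real ^ 'n) measure"
  assumes "prob_space \<nu>" and [measurable_cong]: "sets \<nu> = sets borel"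
  shows "integrable \<nu> (\<lambda>y. shift_density (y /\<^sub>R k) w)"
proof -
  interpret prob_space \<nu> by fact
  show ?thesis
    by (rule integrable_const_bound[of _ "exp ((norm w)\<^sup>2 / 2)"]) (auto simp: shift_density_le)
qed

lemma shift_mean_measurable [measurable]:
  fixes \<nu> :: "(real ^ 'n) measure"
  assumes "prob_space \<nu>" and [measurable_cong]: "sets \<nu> = sets borel"
  shows "shift_mean k \<nu> \<in> borel_measurable borel"
proof -
  interpret prob_space \<nu> by fact
  show ?thesis unfolding shift_mean_def[abs_def] by measurable
qed

lemma shift_mean_nonneg: "0 \<le> shift_mean k \<nu> w"
  unfolding shift_mean_def by (rule Bochner_Integration.integral_nonneg) simp

lemma ennreal_shift_mean:
  fixes \<nu> :: "(real ^ 'n) measure"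
  assumes "prob_space \<nu>" "sets \<nu> = sets borel"
  shows "ennreal (shift_mean k \<nu> w) = (\<integral>\<^sup>+y. ennreal (shift_density (y /\<^sub>R k) w) \<partial>\<nu>)"
  unfolding shift_mean_def
  by (rule nn_integral_eq_integral[symmetric]) (simp_all add: shift_density_integrable_shift[OF assms])

text \<open>Fubini and the Cameron-Martin formula. The instance \<open>k = sqrt \<alpha>\<close>
  evaluates the weighted integral of the second inequality, the instance
  \<open>k = sqrt \<beta>\<close> the duality pairing.\<close>

lemma integral_shift_mean_mult:
  fixes \<nu> :: "(real ^ 'n) measure" and G :: "real ^ 'n \<Rightarrow> real"
  assumes \<nu>: "prob_space \<nu>" and s [measurable_cong]: "sets \<nu> = sets borel"
    and [measurable]: "G \<in> borel_measurable borel"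
    and fin: "(\<integral>\<^sup>+y. (\<E>\<^sup>+ w. ennreal \<bar>G (w + y /\<^sub>R k)\<bar>) \<partial>\<nu>) < \<infinity>"
  shows "(\<E> w. G w * shift_mean k \<nu> w) = (\<integral>y. (\<E> w. G (w + y /\<^sub>R k)) \<partial>\<nu>)"
proof -
  interpret \<nu>: prob_space \<nu> by fact
  interpret pair_sigma_finite \<nu> "gaussian :: (real ^ 'n) measure" ..
  let ?h = "\<lambda>y w. shift_density (y /\<^sub>R k) w * G w"
  have m: "(\<lambda>z. ?h (fst z) (snd z)) \<in> borel_measurable (\<nu> \<Otimes>\<^sub>M gaussian)" by measurable
  have "(\<integral>\<^sup>+z. ennreal (norm (?h (fst z) (snd z))) \<partial>(\<nu> \<Otimes>\<^sub>M gaussian))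
      = (\<integral>\<^sup>+y. (\<E>\<^sup>+ w. ennreal (norm (?h y w))) \<partial>\<nu>)"
    by (subst gaussian.nn_integral_fst[symmetric]) (use m in auto)
  also have "\<dots> = (\<integral>\<^sup>+y. (\<E>\<^sup>+ w. ennreal \<bar>G (w + y /\<^sub>R k)\<bar>) \<partial>\<nu>)"
    by (subst nn_integral_gaussian_shift) (simp_all add: abs_mult ennreal_mult')
  also have "\<dots> < \<infinity>" by (rule fin)
  finally have int: "integrable (\<nu> \<Otimes>\<^sub>M gaussian) (\<lambda>(y, w). ?h y w)"
    using m by (simp add: integrable_iff_bounded case_prod_beta')
  have "(\<E> w. G w * shift_mean k \<nu> w) = (\<E> w. \<integral>y. ?h y w \<partial>\<nu>)"
    by (simp add: shift_mean_def mult.commute)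
  also have "\<dots> = (\<integral>y. (\<E> w. ?h y w) \<partial>\<nu>)" by (rule Fubini_integral[OF int])
  also have "\<dots> = (\<integral>y. (\<E> w. G (w + y /\<^sub>R k)) \<partial>\<nu>)"
    by (subst integral_gaussian_shift) simp_all
  finally show ?thesis .
qed

lemma shift_density_mult:
  fixes a c :: "real ^ 'n"
  shows "(\<E>\<^sup>+ w. ennreal (shift_density a w) * ennreal (shift_density c w)) = ennreal (exp (a \<bullet> c))"
proof -
  have eq: "shift_density c (w + a) = exp (a \<bullet> c) * shift_density c w" for w
    by (simp add: shift_density_def exp_add[symmetric] inner_add_left)
  have "(\<E>\<^sup>+ w. ennreal (shift_density a w) * ennreal (shift_density c w))
      = (\<E>\<^sup>+ w. ennreal (shift_density c (w + a)))"
    by (rule nn_integral_gaussian_shift[symmetric]) simp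
  also have "\<dots> = ennreal (exp (a \<bullet> c)) * (\<E>\<^sup>+ w. ennreal (shift_density c w))"
    unfolding eq by (simp add: ennreal_mult' nn_integral_cmult)
  also have "(\<E>\<^sup>+ w. ennreal (shift_density c w)) = 1"
    by (subst nn_integral_eq_integral) (auto simp: shift_density_integrable shift_density_integral)
  finally show ?thesis by simp
qed

text \<open>Expanding the square leaves a double integral of
  \<open>exp ((y \<bullet> y') / k^2)\<close>, which
  \<open>2 (y \<bullet> y') \<le> |y|^2 + |y'|^2\<close> splits into a product. For
  \<open>k = sqrt \<beta>\<close> one has \<open>2 k^2 = 1 + \<alpha>\<close>, so the condition
  becomes the moment hypothesis of the theorem.\<close>

lemma square_integrable_shift_mean:
  fixes \<nu> :: "(real ^ 'n) measure"
  assumes \<nu>: "prob_space \<nu>" and s [measurable_cong]: "sets \<nu> = sets borel" and k: "0 < k"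
    and fin: "(\<integral>\<^sup>+y. ennreal (exp ((norm y)\<^sup>2 / (2 * k\<^sup>2))) \<partial>\<nu>) < \<infinity>"
  shows "square_integrable (shift_mean k \<nu>)"
proof -
  interpret \<nu>: prob_space \<nu> by fact
  interpret g\<nu>: pair_sigma_finite "gaussian :: (real ^ 'n) measure" \<nu> ..
  note [measurable] = shift_mean_measurable[OF \<nu> s]
  let ?e = "\<lambda>y w. ennreal (shift_density (y /\<^sub>R k) w)"
  have "(\<E>\<^sup>+ w. ennreal ((shift_mean k \<nu> w)\<^sup>2)) =
      (\<E>\<^sup>+ w. (\<integral>\<^sup>+y. ?e y w \<partial>\<nu>) * (\<integral>\<^sup>+y. ?e y w \<partial>\<nu>))"
    by (simp add: ennreal_shift_mean[OF \<nu> s, symmetric] power2_eq_square ennreal_mult shift_mean_nonneg)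
  also have "\<dots> = (\<E>\<^sup>+ w. \<integral>\<^sup>+y. ?e y w * (\<integral>\<^sup>+y'. ?e y' w \<partial>\<nu>) \<partial>\<nu>)"
    by (simp add: nn_integral_multc)
  also have "\<dots> = (\<integral>\<^sup>+y. (\<E>\<^sup>+ w. ?e y w * (\<integral>\<^sup>+y'. ?e y' w \<partial>\<nu>)) \<partial>\<nu>)"
    by (rule g\<nu>.Fubini'[symmetric]) measurable
  also have "\<dots> = (\<integral>\<^sup>+y. (\<E>\<^sup>+ w. \<integral>\<^sup>+y'. ?e y w * ?e y' w \<partial>\<nu>) \<partial>\<nu>)"
    by (simp add: nn_integral_cmult)
  also have "\<dots> = (\<integral>\<^sup>+y. \<integral>\<^sup>+y'. (\<E>\<^sup>+ w. ?e y w * ?e y' w) \<partial>\<nu> \<partial>\<nu>)"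
  proof (rule nn_integral_cong)
    fix y
    show "(\<E>\<^sup>+ w. \<integral>\<^sup>+y'. ?e y w * ?e y' w \<partial>\<nu>) = (\<integral>\<^sup>+y'. (\<E>\<^sup>+ w. ?e y w * ?e y' w) \<partial>\<nu>)"
      by (rule g\<nu>.Fubini'[symmetric]) measurable
  qed
  also have "\<dots> = (\<integral>\<^sup>+y. \<integral>\<^sup>+y'. ennreal (exp ((y /\<^sub>R k) \<bullet> (y' /\<^sub>R k))) \<partial>\<nu> \<partial>\<nu>)"
    by (simp only: shift_density_mult)
  also have "\<dots> \<le> (\<integral>\<^sup>+y. \<integral>\<^sup>+y'. ennreal (exp ((norm y)\<^sup>2 / (2 * k\<^sup>2))) * ennreal (exp ((norm y')\<^sup>2 / (2 * k\<^sup>2))) \<partial>\<nu> \<partial>\<nu>)"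
  proof (intro nn_integral_mono)
    fix y y' :: "real ^ 'n"
    have "0 \<le> (norm (y - y'))\<^sup>2" by simp
    also have "(norm (y - y'))\<^sup>2 = (norm y)\<^sup>2 - 2 * (y \<bullet> y') + (norm y')\<^sup>2"
      by (simp add: power2_norm_eq_inner inner_diff_left inner_diff_right inner_commute)
    finally have "(y \<bullet> y') / k\<^sup>2 \<le> (((norm y)\<^sup>2 + (norm y')\<^sup>2) / 2) / k\<^sup>2"
      using k by (intro divide_right_mono) auto
    moreover have "(y /\<^sub>R k) \<bullet> (y' /\<^sub>R k) = (y \<bullet> y') / k\<^sup>2"
      using k by (simp add: power2_eq_square field_simps)
    ultimately have "(y /\<^sub>R k) \<bullet> (y' /\<^sub>R k) \<le> (norm y)\<^sup>2 / (2 * k\<^sup>2) + (norm y')\<^sup>2 / (2 * k\<^sup>2)"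
      by (simp only: add_divide_distrib divide_divide_eq_left)
    then show "ennreal (exp ((y /\<^sub>R k) \<bullet> (y' /\<^sub>R k))) \<le> ennreal (exp ((norm y)\<^sup>2 / (2 * k\<^sup>2))) * ennreal (exp ((norm y')\<^sup>2 / (2 * k\<^sup>2)))"
      by (simp add: ennreal_mult'[symmetric] exp_add[symmetric] ennreal_leI del: inner_scaleR_left inner_scaleR_right)
  qed
  also have "\<dots> = (\<integral>\<^sup>+y. ennreal (exp ((norm y)\<^sup>2 / (2 * k\<^sup>2))) \<partial>\<nu>) * (\<integral>\<^sup>+y. ennreal (exp ((norm y)\<^sup>2 / (2 * k\<^sup>2))) \<partial>\<nu>)"
    by (simp add: nn_integral_cmult nn_integral_multc)
  also have "\<dots> < \<infinity>" using fin by (simp add: ennreal_mult_less_top)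
  finally show ?thesis by (simp add: square_integrable_def integrable_iff_bounded)
qed

text \<open>At the mixed argument the exponential factors, because \<open>k^2 + c^2 = 1\<close>,
  into one in \<open>w\<close> and one in \<open>z\<close> of mean 1. All integrands are
  nonnegative, so the identity holds at every point.\<close>

lemma Gamma_fun_shift_mean:
  fixes \<nu> :: "(real ^ 'n) measure"
  assumes \<nu>: "prob_space \<nu>" and s [measurable_cong]: "sets \<nu> = sets borel" and k: "0 < k" "k \<le> 1"
  shows "Gamma_fun k (shift_mean k \<nu>) w = shift_mean 1 \<nu> w"
proof -
  interpret \<nu>: prob_space \<nu> by fact
  interpret g\<nu>: pair_sigma_finite "gaussian :: (real ^ 'n) measure" \<nu> ..
  note [measurable] = shift_mean_measurable[OF \<nu> s]
  define c where "c = sqrt (1 - k\<^sup>2)"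
  have kc: "k\<^sup>2 + c\<^sup>2 = 1" unfolding c_def using Gamma_fun_coeff(1)[OF k] .
  have eq: "shift_density (y /\<^sub>R k) (k *\<^sub>R w + c *\<^sub>R z) = shift_density y w * shift_density ((c / k) *\<^sub>R y) z" for y z
  proof -
    have "(norm y)\<^sup>2 / k\<^sup>2 = (norm y)\<^sup>2 * (k\<^sup>2 + c\<^sup>2) / k\<^sup>2" unfolding kc by simp
    also have "\<dots> = (norm y)\<^sup>2 + (norm y)\<^sup>2 * c\<^sup>2 / k\<^sup>2" using k by (simp add: field_simps)
    finally have 1: "(norm (y /\<^sub>R k))\<^sup>2 = (norm y)\<^sup>2 + (norm ((c / k) *\<^sub>R y))\<^sup>2"
      using k by (simp add: power_mult_distrib power_divide power_inverse divide_inverse mult_ac)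
    have 2: "(k *\<^sub>R w + c *\<^sub>R z) \<bullet> (y /\<^sub>R k) = w \<bullet> y + z \<bullet> ((c / k) *\<^sub>R y)"
      using k by (simp add: inner_add_left field_simps)
    show ?thesis unfolding shift_density_def 1 2 exp_add[symmetric] by (simp add: add_divide_distrib)
  qed
  have "(\<E>\<^sup>+ z. ennreal (shift_mean k \<nu> (k *\<^sub>R w + c *\<^sub>R z))) =
      (\<E>\<^sup>+ z. \<integral>\<^sup>+y. ennreal (shift_density (y /\<^sub>R k) (k *\<^sub>R w + c *\<^sub>R z)) \<partial>\<nu>)"
    by (simp only: ennreal_shift_mean[OF \<nu> s])
  also have "\<dots> = (\<integral>\<^sup>+y. (\<E>\<^sup>+ z. ennreal (shift_density (y /\<^sub>R k) (k *\<^sub>R w + c *\<^sub>R z))) \<partial>\<nu>)"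
    by (rule g\<nu>.Fubini'[symmetric]) measurable
  also have "\<dots> = (\<integral>\<^sup>+y. ennreal (shift_density y w) * (\<E>\<^sup>+ z. ennreal (shift_density ((c / k) *\<^sub>R y) z)) \<partial>\<nu>)"
    unfolding eq by (simp add: ennreal_mult' nn_integral_cmult)
  also have "\<dots> = (\<integral>\<^sup>+y. ennreal (shift_density y w) \<partial>\<nu>)"
    by (subst nn_integral_eq_integral) (auto simp: shift_density_integrable shift_density_integral)
  also have "\<dots> = ennreal (shift_mean 1 \<nu> w)" by (simp add: ennreal_shift_mean[OF \<nu> s])
  finally show ?thesis
    unfolding Gamma_fun_def c_def[symmetric]
    by (subst integral_eq_nn_integral) (auto simp: shift_mean_nonneg)
qed

lemma convolution_gaussian_eq_density:
  fixes \<nu> :: "(real ^ 'n) measure"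
  assumes \<nu>: "prob_space \<nu>" and s [measurable_cong]: "sets \<nu> = sets borel"
  shows "convolution gaussian \<nu> = density gaussian (\<lambda>w. ennreal (shift_mean 1 \<nu> w))"
    and "g \<in> borel_measurable borel \<Longrightarrow>
      (\<integral>\<^sup>+w. g w \<partial>convolution gaussian \<nu>) = (\<integral>\<^sup>+y. (\<E>\<^sup>+ w. g (w + y)) \<partial>\<nu>)"
proof -
  interpret \<nu>: prob_space \<nu> by fact
  interpret g\<nu>: pair_sigma_finite "gaussian :: (real ^ 'n) measure" \<nu> ..
  note [measurable] = shift_mean_measurable[OF \<nu> s]
  show nn: "(\<integral>\<^sup>+w. g w \<partial>convolution gaussian \<nu>) = (\<integral>\<^sup>+y. (\<E>\<^sup>+ w. g (w + y)) \<partial>\<nu>)"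
    if [measurable]: "g \<in> borel_measurable borel" for g
  proof -
    have "(\<integral>\<^sup>+w. g w \<partial>convolution gaussian \<nu>) = (\<E>\<^sup>+ w. \<integral>\<^sup>+y. g (w + y) \<partial>\<nu>)"
      by (rule nn_integral_convolution) (auto simp: s \<nu>.finite_measure_axioms gaussian.finite_measure_axioms)
    also have "\<dots> = (\<integral>\<^sup>+y. (\<E>\<^sup>+ w. g (w + y)) \<partial>\<nu>)"
      by (rule g\<nu>.Fubini'[symmetric]) measurable
    finally show ?thesis .
  qed
  show "convolution gaussian \<nu> = density gaussian (\<lambda>w. ennreal (shift_mean 1 \<nu> w))"
  proof (rule measure_eqI)
    fix A assume "A \<in> sets (convolution gaussian \<nu>)"
    then have A [measurable]: "A \<in> sets borel" by simp
    have "emeasure (convolution gaussian \<nu>) A = (\<integral>\<^sup>+w. indicator A w \<partial>convolution gaussian \<nu>)"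
      by simp
    also have "\<dots> = (\<integral>\<^sup>+y. (\<E>\<^sup>+ w. indicator A (w + y)) \<partial>\<nu>)"
      by (rule nn) simp
    also have "\<dots> = (\<integral>\<^sup>+y. (\<E>\<^sup>+ w. ennreal (shift_density y w) * indicator A w) \<partial>\<nu>)"
      by (subst nn_integral_gaussian_shift) simp_all
    also have "\<dots> = (\<E>\<^sup>+ w. \<integral>\<^sup>+y. ennreal (shift_density y w) * indicator A w \<partial>\<nu>)"
      by (rule g\<nu>.Fubini') measurable
    also have "\<dots> = (\<E>\<^sup>+ w. ennreal (shift_mean 1 \<nu> w) * indicator A w)"
      by (simp add: nn_integral_multc ennreal_shift_mean[OF \<nu> s])
    also have "\<dots> = emeasure (density gaussian (\<lambda>w. ennreal (shift_mean 1 \<nu> w))) A"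
      by (simp add: emeasure_density)
    finally show "emeasure (convolution gaussian \<nu>) A = emeasure (density gaussian (\<lambda>w. ennreal (shift_mean 1 \<nu> w))) A" .
  qed simp
qed

lemma integral_convolution_square:
  fixes \<nu> :: "(real ^ 'n) measure" and g :: "real ^ 'n \<Rightarrow> real"
  assumes \<nu>: "prob_space \<nu>" and s [measurable_cong]: "sets \<nu> = sets borel"
    and [measurable]: "g \<in> borel_measurable borel"
    and sq: "\<And>y. square_integrable (\<lambda>w. g (w + y))"
    and fin: "(\<integral>\<^sup>+y. (\<E>\<^sup>+ w. ennreal ((g (w + y))\<^sup>2)) \<partial>\<nu>) < \<infinity>"
  shows "(\<integral>w. (g w)\<^sup>2 \<partial>convolution gaussian \<nu>) = (\<integral>y. (\<E> w. (g (w + y))\<^sup>2) \<partial>\<nu>)"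
    and "integrable \<nu> (\<lambda>y. (\<E> w. (g (w + y))\<^sup>2))"
proof -
  have m: "(\<lambda>y. (\<E> w. (g (w + y))\<^sup>2)) \<in> borel_measurable \<nu>" by measurable
  have eq: "(\<integral>\<^sup>+w. ennreal ((g w)\<^sup>2) \<partial>convolution gaussian \<nu>) = (\<integral>\<^sup>+y. ennreal (\<E> w. (g (w + y))\<^sup>2) \<partial>\<nu>)"
    using convolution_gaussian_eq_density(2)[OF \<nu> s, of "\<lambda>w. ennreal ((g w)\<^sup>2)"]
    by (simp add: nn_integral_square_eq[OF sq])
  have "(\<integral>w. (g w)\<^sup>2 \<partial>convolution gaussian \<nu>) = enn2real (\<integral>\<^sup>+w. ennreal ((g w)\<^sup>2) \<partial>convolution gaussian \<nu>)"
    by (rule integral_eq_nn_integral) auto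
  also have "\<dots> = (\<integral>y. (\<E> w. (g (w + y))\<^sup>2) \<partial>\<nu>)"
    unfolding eq by (rule integral_eq_nn_integral[symmetric]) (use m in auto)
  finally show "(\<integral>w. (g w)\<^sup>2 \<partial>convolution gaussian \<nu>) = (\<integral>y. (\<E> w. (g (w + y))\<^sup>2) \<partial>\<nu>)" .
  show "integrable \<nu> (\<lambda>y. (\<E> w. (g (w + y))\<^sup>2))"
    using fin m unfolding nn_integral_square_eq[OF sq] by (simp add: integrable_iff_bounded)
qed

lemma nn_integral_shift_square_finite:
  fixes \<nu> :: "(real ^ 'n) measure" and g :: "real ^ 'n \<Rightarrow> real"
  assumes \<alpha>: "0 < \<alpha>" and s [measurable_cong]: "sets \<nu> = sets borel" and [measurable]: "g \<in> borel_measurable borel"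
    and fin: "(\<integral>\<^sup>+ y. ennreal (exp ((norm y)\<^sup>2 / (1 + \<alpha>))) \<partial>\<nu>) < \<infinity>"
    and g: "(\<E>\<^sup>+ w. ennreal (\<bar>g w\<bar> powr (3 + \<alpha>))) < \<infinity>"
  shows "(\<integral>\<^sup>+y. (\<E>\<^sup>+ w. ennreal ((g (w + y))\<^sup>2)) \<partial>\<nu>) < \<infinity>"
proof -
  let ?N = "(\<E>\<^sup>+ w. ennreal (\<bar>g w\<bar> powr (3 + \<alpha>))) + 1"
  have "(\<integral>\<^sup>+y. (\<E>\<^sup>+ w. ennreal ((g (w + y))\<^sup>2)) \<partial>\<nu>) \<le> (\<integral>\<^sup>+y. ennreal (exp ((norm y)\<^sup>2 / (1 + \<alpha>))) * ?N \<partial>\<nu>)"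
    using nn_integral_shift_square_le[OF \<alpha> zero_less_one assms(3)] by (intro nn_integral_mono) simp
  also have "\<dots> = (\<integral>\<^sup>+ y. ennreal (exp ((norm y)\<^sup>2 / (1 + \<alpha>))) \<partial>\<nu>) * ?N"
    by (rule nn_integral_multc) measurable
  also have "\<dots> < \<infinity>" using fin g by (simp add: ennreal_mult_less_top)
  finally show ?thesis .
qed

section \<open>The duality pairing and the conclusion\<close>

lemma chaos_pairing_Gamma_cancel:
  assumes "k \<noteq> 0"
  shows "chaos_pairing (Gamma_chaos (1 / k) u) (Gamma_chaos k v) = chaos_pairing u v"
proof -
  have "tensor_inner n (Gamma_chaos (1 / k) u) (Gamma_chaos k v) = tensor_inner n u v" for n
    unfolding tensor_inner_def Gamma_chaos_def
  proof (rule sum.cong[OF refl])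
    fix "is" :: "'a list"
    have "(1 / k) ^ length is * k ^ length is = 1"
      using assms by (simp add: power_mult_distrib[symmetric])
    then show "(1 / k) ^ length is * u is * (k ^ length is * v is) = u is * v is"
      by (metis (no_types) mult.assoc mult.left_commute mult_1)
  qed
  then show ?thesis by (simp add: chaos_pairing_def)
qed

lemma Gamma_chaos_Gamma_chaos: "Gamma_chaos a (Gamma_chaos b u) = Gamma_chaos (a * b) u"
  by (auto simp: Gamma_chaos_def power_mult_distrib)

lemma square_integrable_cong_AE:
  assumes "square_integrable f" "g \<in> borel_measurable borel" "AE w in gaussian. f w = g w"
  shows "square_integrable g"
proof -
  have "integrable gaussian (\<lambda>w. (g w)\<^sup>2)"
    by (rule integrable_cong_AE_imp[OF square_integrableD(2)[OF assms(1)]]) (use assms(2,3) in \<open>auto elim: eventually_mono\<close>)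
  then show ?thesis using assms(2) by (simp add: square_integrable_def)
qed

theorem corollary3p10:
  fixes \<alpha> :: real
    and \<nu> \<rho> :: "(real ^ 'n) measure"
    and \<xi> f :: "real ^ 'n \<Rightarrow> real"
    and Df :: "real ^ 'n \<Rightarrow> real ^ 'n"
  assumes "0 < \<alpha>" and "\<alpha> \<le> 1"
    and "prob_space \<nu>" and "sets \<nu> = sets borel"
    and "(\<integral>\<^sup>+ y. ennreal (exp ((norm y)\<^sup>2 / (1 + \<alpha>))) \<partial>\<nu>) < \<infinity>"
    and "\<rho> = convolution gaussian \<nu>"
    and "\<xi> \<in> borel_measurable borel" and "\<And>w. 0 \<le> \<xi> w"
    and "\<rho> = density gaussian (\<lambda>w. ennreal (\<xi> w))"
    and "has_sobolev_gradient (3 + \<alpha>) f Df"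
  shows "(\<integral>w. \<bar>f w\<bar>\<^sup>2 \<partial>\<rho>) - chaos_pairing (alpha_product \<alpha> f f) (chaos_of \<xi>)
           \<le> (1 - \<alpha>) * (\<integral>w. (norm (Df w))\<^sup>2 \<partial>\<rho>)
       \<and> (\<integral>w. \<bar>f w\<bar>\<^sup>2 \<partial>\<rho>)
           - (\<integral>w. \<bar>Gamma_fun (sqrt \<alpha>) f w\<bar>\<^sup>2
                  * (\<integral>y. exp (w \<bullet> (y /\<^sub>R sqrt \<alpha>) - (norm y)\<^sup>2 / (2 * \<alpha>)) \<partial>\<nu>) \<partial>gaussian)
           \<le> (1 - \<alpha>) * (\<integral>w. (norm (Df w))\<^sup>2 \<partial>\<rho>)"
proof -
  note \<alpha> = assms(1,2) and \<nu> = assms(3) and s [measurable_cong] = assms(4) and fin = assms(5)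
  interpret \<nu>: prob_space \<nu> by fact
  note D = has_sobolev_gradientD[OF \<alpha>(1) assms(10)]
  note [measurable] = D(1,2) assms(7) shift_mean_measurable[OF \<nu> s]
  define \<beta> where "\<beta> = (1 + \<alpha>) / 2"
  have \<beta>: "0 < \<beta>" "\<beta> \<le> 1" "\<alpha> \<le> \<beta>" using \<alpha> by (auto simp: \<beta>_def)
  have sa: "0 < sqrt \<alpha>" "sqrt \<alpha> \<le> 1" and sb: "0 < sqrt \<beta>" "sqrt \<beta> \<le> 1"
    and sab: "0 < sqrt (\<alpha> / \<beta>)" "sqrt (\<alpha> / \<beta>) \<le> 1" using \<alpha> \<beta> by auto
  let ?g = "\<lambda>y w. f (w + y)"
  \<comment> \<open>Both forms of the inequality subtract the \<open>\<nu>\<close>-mean of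
    \<open>B\<close>: \<open>main\<close> proves the estimate with this common value,
    \<open>first\<close> and \<open>second\<close> identify the two subtracted terms with
    it.\<close>
  define B where "B y = (\<E> w. (Gamma_fun (sqrt \<alpha>) (?g y) w)\<^sup>2)" for y
  have sq: "square_integrable (?g y)" for y
    by (rule square_integrable_shift[OF \<alpha>(1) D(1,3)])
  have f: "square_integrable f" using sq[of 0] by simp
  have sqD: "square_integrable (\<lambda>w. norm (Df (w + y)))" for y
    by (rule square_integrable_shift[OF \<alpha>(1), of "\<lambda>w. norm (Df w)"]) (use D(4) in auto)
  have finf: "(\<integral>\<^sup>+y. (\<E>\<^sup>+ w. ennreal ((f (w + y))\<^sup>2)) \<partial>\<nu>) < \<infinity>"
    by (rule nn_integral_shift_square_finite[OF \<alpha>(1) s D(1) fin D(3)])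
  have finD: "(\<integral>\<^sup>+y. (\<E>\<^sup>+ w. ennreal ((norm (Df (w + y)))\<^sup>2)) \<partial>\<nu>) < \<infinity>"
    by (rule nn_integral_shift_square_finite[OF \<alpha>(1) s _ fin, of "\<lambda>w. norm (Df w)"]) (use D(4) in auto)
  note A = integral_convolution_square[OF \<nu> s D(1) sq finf]
  have "(\<lambda>w. norm (Df w)) \<in> borel_measurable borel" by measurable
  note C = integral_convolution_square[OF \<nu> s this sqD finD]
  have Bm: "B \<in> borel_measurable \<nu>" unfolding B_def Gamma_fun_def by measurable
  have B0: "0 \<le> B y" for y unfolding B_def by simp
  have BA: "B y \<le> (\<E> w. (f (w + y))\<^sup>2)" for y
    using nn_integral_Gamma_fun_square_le[OF \<alpha> sq, of y] unfolding B_def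
    by (simp add: nn_integral_square_eq sq square_integrable_Gamma_fun[OF sa sq])
  have intB: "integrable \<nu> B"
    by (rule Bochner_Integration.integrable_bound[OF A(2) Bm]) (use BA B0 in \<open>auto intro!: AE_I2\<close>)

  have main: "(\<integral>w. (f w)\<^sup>2 \<partial>\<rho>) - (\<integral>y. B y \<partial>\<nu>) \<le> (1 - \<alpha>) * (\<integral>w. (norm (Df w))\<^sup>2 \<partial>\<rho>)"
  proof -
    have "(\<integral>w. (f w)\<^sup>2 \<partial>\<rho>) - (\<integral>y. B y \<partial>\<nu>) = (\<integral>y. (\<E> w. (f (w + y))\<^sup>2) - B y \<partial>\<nu>)"
      unfolding assms(6) A(1) by (rule Bochner_Integration.integral_diff[OF A(2) intB, symmetric])
    also have "\<dots> \<le> (\<integral>y. (1 - \<alpha>) * (\<E> w. (norm (Df (w + y)))\<^sup>2) \<partial>\<nu>)"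
    proof (rule integral_mono)
      show "integrable \<nu> (\<lambda>y. (\<E> w. (f (w + y))\<^sup>2) - B y)"
        using A(2) intB by (rule Bochner_Integration.integrable_diff)
      show "integrable \<nu> (\<lambda>y. (1 - \<alpha>) * (\<E> w. (norm (Df (w + y)))\<^sup>2))"
        using C(2) by simp
      show "(\<E> w. (f (w + y))\<^sup>2) - B y \<le> (1 - \<alpha>) * (\<E> w. (norm (Df (w + y)))\<^sup>2)" for y
        unfolding B_def by (rule sobolev_poincare_shift[OF \<alpha> assms(10)])
    qed
    also have "\<dots> = (1 - \<alpha>) * (\<integral>w. (norm (Df w))\<^sup>2 \<partial>\<rho>)"
      unfolding assms(6) using C(1) by simp
    finally show ?thesis .
  qed

  have second: "(\<E> w. \<bar>Gamma_fun (sqrt \<alpha>) f w\<bar>\<^sup>2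
                  * (\<integral>y. exp (w \<bullet> (y /\<^sub>R sqrt \<alpha>) - (norm y)\<^sup>2 / (2 * \<alpha>)) \<partial>\<nu>)) = (\<integral>y. B y \<partial>\<nu>)"
  proof -
    have sm: "(\<integral>y. exp (w \<bullet> (y /\<^sub>R sqrt \<alpha>) - (norm y)\<^sup>2 / (2 * \<alpha>)) \<partial>\<nu>) = shift_mean (sqrt \<alpha>) \<nu> w" for w
    proof -
      have "(norm (y /\<^sub>R sqrt \<alpha>))\<^sup>2 = (norm y)\<^sup>2 / \<alpha>" for y :: "real ^ 'n"
        using \<alpha> by (simp add: power_mult_distrib power_inverse divide_inverse_commute)
      then have "(norm (y /\<^sub>R sqrt \<alpha>))\<^sup>2 / 2 = (norm y)\<^sup>2 / (2 * \<alpha>)" for y :: "real ^ 'n"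
        by (simp only: divide_divide_eq_left mult.commute)
      then show ?thesis by (simp only: shift_mean_def shift_density_def)
    qed
    \<comment> \<open>The operator scales its argument by \<open>sqrt \<alpha>\<close>, so
      translating the result by \<open>y /\<^sub>R sqrt \<alpha>\<close> amounts to translating
      \<open>f\<close> by \<open>y\<close>.\<close>
    have sh: "Gamma_fun (sqrt \<alpha>) f (w + y /\<^sub>R sqrt \<alpha>) = Gamma_fun (sqrt \<alpha>) (?g y) w" for w y
      unfolding Gamma_fun_def using \<alpha> by (simp add: scaleR_add_right add_ac)
    have "(\<integral>\<^sup>+y. (\<E>\<^sup>+ w. ennreal \<bar>(Gamma_fun (sqrt \<alpha>) f (w + y /\<^sub>R sqrt \<alpha>))\<^sup>2\<bar>) \<partial>\<nu>)
        \<le> (\<integral>\<^sup>+y. (\<E>\<^sup>+ w. ennreal ((f (w + y))\<^sup>2)) \<partial>\<nu>)"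
      unfolding sh abs_power2 by (rule nn_integral_mono) (rule nn_integral_Gamma_fun_square_le[OF \<alpha> sq])
    then have "(\<integral>\<^sup>+y. (\<E>\<^sup>+ w. ennreal \<bar>(Gamma_fun (sqrt \<alpha>) f (w + y /\<^sub>R sqrt \<alpha>))\<^sup>2\<bar>) \<partial>\<nu>) < \<infinity>"
      using finf by (rule le_less_trans)
    from integral_shift_mean_mult[OF \<nu> s _ this] show ?thesis
      unfolding sm power2_abs by (simp add: sh B_def)
  qed

  have first: "chaos_pairing (alpha_product \<alpha> f f) (chaos_of \<xi>) = (\<integral>y. B y \<partial>\<nu>)"
  proof -
    let ?v = "pair_mean \<beta> f" and ?\<eta> = "shift_mean (sqrt \<beta>) \<nu>"
    let ?h = "\<lambda>w. Gamma_fun (sqrt \<alpha>) f w * Gamma_fun (sqrt \<alpha>) f w"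
    have v: "square_integrable ?v"
      unfolding \<beta>_def by (rule square_integrable_pair_mean[OF \<alpha> D(1,3)])
    have "(sqrt \<beta>)\<^sup>2 * 2 = 1 + \<alpha>" using \<beta> by (simp add: \<beta>_def)
    then have \<eta>: "square_integrable ?\<eta>"
      using fin by (intro square_integrable_shift_mean[OF \<nu> s sb(1)]) (simp add: mult.commute)

    have AE_h: "AE w in gaussian. Gamma_fun (sqrt (\<alpha> / \<beta>)) ?v w = ?h w"
      using Gamma_fun_square_eq_pair_mean[OF \<alpha> f] unfolding \<beta>_def[symmetric]
      by eventually_elim (simp add: power2_eq_square)
    note Gv = square_integrable_Gamma_fun[OF sab v]
    have h: "square_integrable ?h" by (rule square_integrable_cong_AE[OF Gv _ AE_h]) measurable
    have "chaos_of ?h = Gamma_chaos (sqrt (\<alpha> / \<beta>)) (chaos_coeff ?v)"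
      unfolding chaos_of_eq[OF h] chaos_coeff_Gamma_fun[OF sab v, symmetric]
      by (rule chaos_coeff_cong_AE[symmetric, OF _ _ AE_h]) measurable
    then have "alpha_product \<alpha> f f = Gamma_chaos (1 / sqrt \<alpha> * sqrt (\<alpha> / \<beta>)) (chaos_coeff ?v)"
      unfolding alpha_product_def by (simp only: Gamma_chaos_Gamma_chaos)
    \<comment> \<open>The composite factor is still at least 1, so the product remains a formal
      series in general; the factor \<open>sqrt \<beta>\<close> contained in
      \<open>chaos_of \<xi>\<close> is what cancels it.\<close>
    moreover have "1 / sqrt \<alpha> * sqrt (\<alpha> / \<beta>) = 1 / sqrt \<beta>"
      using \<alpha> by (simp add: real_sqrt_divide)
    ultimately have u: "alpha_product \<alpha> f f = Gamma_chaos (1 / sqrt \<beta>) (chaos_coeff ?v)" by simp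

    \<comment> \<open>\<open>\<xi>\<close> is an arbitrary nonnegative version of the density;
      uniqueness of densities ties it to the explicit one up to a null set, which chaos coefficients
      do not see.\<close>
    have "AE w in gaussian. ennreal (shift_mean 1 \<nu> w) = ennreal (\<xi> w)"
      using assms(6,9) convolution_gaussian_eq_density(1)[OF \<nu> s]
      by (subst gaussian.density_unique_iff[symmetric]) auto
    then have AE_\<xi>: "AE w in gaussian. Gamma_fun (sqrt \<beta>) ?\<eta> w = \<xi> w"
      unfolding Gamma_fun_shift_mean[OF \<nu> s sb]
      by eventually_elim (simp add: assms(8) shift_mean_nonneg)
    have \<xi>: "square_integrable \<xi>"
      by (rule square_integrable_cong_AE[OF square_integrable_Gamma_fun[OF sb \<eta>] _ AE_\<xi>]) measurable
    have x: "chaos_of \<xi> = Gamma_chaos (sqrt \<beta>) (chaos_coeff ?\<eta>)"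
      unfolding chaos_of_eq[OF \<xi>] chaos_coeff_Gamma_fun[OF sb \<eta>, symmetric]
      by (rule chaos_coeff_cong_AE[symmetric, OF _ _ AE_\<xi>]) measurable

    \<comment> \<open>Both arguments of \<open>f\<close> scale the translation back to
      \<open>y\<close>, so translating \<open>v\<close> amounts to forming \<open>v\<close> from the
      translate of \<open>f\<close>.\<close>
    have sh: "?v (w + y /\<^sub>R sqrt \<beta>) = pair_mean \<beta> (?g y) w" for w y
      unfolding pair_mean_def using \<beta> by (simp add: scaleR_add_right add_ac algebra_simps)
    have "chaos_pairing (alpha_product \<alpha> f f) (chaos_of \<xi>) = chaos_pairing (chaos_coeff ?v) (chaos_coeff ?\<eta>)"
      unfolding u x using sb by (intro chaos_pairing_Gamma_cancel) auto
    also have "\<dots> = (\<E> w. ?v w * ?\<eta> w)"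
      unfolding chaos_pairing_def by (rule sums_unique[symmetric, OF chaos_parseval[OF v \<eta>]])
    also have "\<dots> = (\<integral>y. (\<E> w. ?v (w + y /\<^sub>R sqrt \<beta>)) \<partial>\<nu>)"
    proof (rule integral_shift_mean_mult[OF \<nu> s])
      have "(\<integral>\<^sup>+y. (\<E>\<^sup>+ w. ennreal \<bar>?v (w + y /\<^sub>R sqrt \<beta>)\<bar>) \<partial>\<nu>)
          \<le> (\<integral>\<^sup>+y. (\<E>\<^sup>+ w. ennreal ((f (w + y))\<^sup>2)) \<partial>\<nu>)"
        unfolding sh by (rule nn_integral_mono) (rule nn_integral_pair_mean_le[OF \<beta>(1,2) sq])
      then show "(\<integral>\<^sup>+y. (\<E>\<^sup>+ w. ennreal \<bar>?v (w + y /\<^sub>R sqrt \<beta>)\<bar>) \<partial>\<nu>) < \<infinity>"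
        using finf by (rule le_less_trans)
    qed measurable
    also have "\<dots> = (\<integral>y. B y \<partial>\<nu>)"
      unfolding sh B_def integral_Gamma_fun_square[OF \<alpha> sq, folded \<beta>_def] ..
    finally show ?thesis .
  qed

  show ?thesis
    unfolding first second using main by simp
qed

end
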